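(* Let $\beta>0$, $R>0$, $f_->0$, and write $\beta=k+\alpha$ with $k\in\mathbb{N}$ and $\alpha\in(0,1]$ (this determines $k$ and $\alpha$ uniquely). Let $(X_{t,T})_{t\in\mathbb{Z},T\ge T_0}$ be a mean-zero array which is $(\beta,R)$-weakly locally stationary with a local spectral density $f$ satisfying $f(u,\lambda)\ge f_-$ for all $u,\lambda\in\mathbb{R}$. Let $h:[0,1]\to\mathbb{R}$ satisfy (H), and suppose that (C) holds for some constant $C>0$ and some probability distribution $\mu$ on $\mathbb{R}$. Then, for any $d\ge1$, the estimator $\widehat{\boldsymbol\theta}_{t,T}(M)$ ($t\in\mathbb{Z}$, $T\ge T_0$, $M\in2\mathbb{N}^*$) satisfies $$\widehat{\boldsymbol\theta}_{t,T}(M)-\boldsymbol\theta_{t/T}=\sum_{\ell=1}^{k}\boldsymbol a_{h,f,\ell}\left(\frac MT\right)^{\ell}+O_{d,f_-,\|h\|_\infty,\|h'\|_\infty,\beta,R}\left(\frac1M+\left(\frac MT\right)^{\beta}\right)+\boldsymbol v_M ,$$ where $\boldsymbol a_{h,f,\ell}\in\mathbb{R}^d$ depends only on $h$, $f$ and $\ell$, and $\boldsymbol v_M=O_{L^{\bullet}(\mu),d,f_-,\|h\|_\infty,\|h'\|_\infty,\beta,R,C}(M^{-1/2})$. Moreover, if $h(x)=h(1-x)$ for $x\in[0,1]$, then $\boldsymbol a_{h,f,1}=0$.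
   Context: Notation: $\mathbb{N}=\{0,1,2,\dots\}$, $\mathbb{N}^*=\{1,2,\dots\}$; $\|\cdot\|$ is the Euclidean norm of vectors. All random variables are real-valued. Hölder balls. For $\alpha\in(0,1]$ and $g:\mathbb{R}\to\mathbb{C}^m$, $|g|_{\alpha,0}=\sup_{0<|s-s'|<1}\|g(s)-g(s')\|/|s-s'|^\alpha$. For $\beta=k+\alpha$ with $k\in\mathbb{N}$, $\alpha\in(0,1]$, $|g|_\beta=|g^{(k)}|_{\alpha,0}+\max_{0\le s\le k}\|g^{(s)}\|_\infty$ if $g$ is $k$ times differentiable, and $|g|_\beta=\infty$ otherwise. $\Lambda_m(\beta,R)=\{g:\mathbb{R}\to\mathbb{C}^m: |g|_\beta\le R\}$. Weak local stationarity. A local spectral density is a function $f:\mathbb{R}^2\to\mathbb{R}_+$ that is $2\pi$-periodic and locally integrable in its second variable; its local covariance function is $\gamma(u,\ell)=\int_{-\pi}^{\pi}e^{\mathrm{i}\ell\lambda}f(u,\lambda)\,d\lambda$, $u\in\mathbb{R}$, $\ell\in\mathbb{Z}$. An array $(X_{t,T})_{t\in\mathbb{Z},T\ge T_0}$ ($T$ integer, $T_0>0$) with finite variances is $(\beta,R)$-weakly locally stationary with local spectral density $f$ if $f(\cdot,\lambda)\in\Lambda_1(\beta,R)$ for all $\lambda\in\mathbb{R}$ and, with $\gamma^*(t,T,\ell)=\mathrm{cov}(X_{t,T},X_{t-\ell,T})$, $|\gamma^*(t,T,\ell)-\gamma(t/T,\ell)|\le R\,T^{-\min(1,\beta)}$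 for all $t,\ell\in\mathbb{Z}$, $T\ge T_0$. Local prediction coefficients. $\boldsymbol\theta_u=\Gamma_u^{-1}\boldsymbol\gamma_u$ with $\boldsymbol\gamma_u=[\gamma(u,1),\dots,\gamma(u,d)]'$, $\Gamma_u=(\gamma(u,i-j))_{1\le i,j\le d}$. Taper assumption (H). $h:[0,1]\to\mathbb{R}$ is piecewise continuously differentiable, that is, for $0=u_0<u_1<\dots<u_N=1$, $h$ is $\mathcal{C}^1$ on $(u_{i-1},u_i]$, $i=1,\dots,N$; moreover $\int_0^1h^2=1$, $\|h\|_\infty=\sup_{[0,1]}|h|<\infty$ and $\|h'\|_\infty=\max_{1\le i\le N}\sup_{u\in(u_{i-1},u_i]}|h'(u)|<\infty$. Local empirical covariance. For $M\in2\mathbb{N}^*$, $$\widehat\gamma_{T,M}(u,\ell)=\frac1{H_M}\sum_{\substack{t_1,t_2=1\\ t_1-t_2=\ell}}^{M}h\left(\tfrac{t_1}M\right)h\left(\tfrac{t_2}M\right)X_{\lfloor uT\rfloor+t_1-M/2,T}\,X_{\lfloor uT\rfloor+t_2-M/2,T},\qquad H_M=\sum_{k=1}^Mh^2(k/M),$$ with $\widehat\gamma_{T,M}(u,\ell)=0$ if $H_M=0$. Estimator. $\widehat{\boldsymbol\theta}_{t,T}(M)=\widehat\Gamma_{t,T,M}^{-1}\widehat{\boldsymbol\gamma}_{t,T,M}$, where $\widehat{\boldsymbol\gamma}_{t,T,M}=[\widehat\gamma_{T,M}(t/T,1),\dots,\widehat\gamma_{T,M}(t/T,d)]'$ and $\widehat\Gamma_{t,T,M}=(\widehat\gamma_{T,M}(t/T,i-j))_{1\le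 i,j\le d}$; by convention $\widehat{\boldsymbol\theta}_{t,T}(M)=0$ if $\widehat\Gamma_{t,T,M}$ is singular (which happens only when $\widehat\gamma_{T,M}(t/T,\ell)=0$ for all $\ell$). Order notation. $a=O_{\boldsymbol c}(b)$ means that (the norm of) $a$ is at most $C_{\boldsymbol c}|b|$ with $C_{\boldsymbol c}$ depending continuously and at most on $\boldsymbol c$. For random vectors or matrices $U_M$, $U_M=O_{L^p,\boldsymbol c}(u(M))$ means $\max_{i,j}(\mathbb{E}|U_{M,i,j}|^p)^{1/p}\le C_{p,\boldsymbol c}|u(M)|$ for all $M$, with $C_{p,\boldsymbol c}$ depending continuously and at most on $(p,\boldsymbol c)$. $U_M=O_{L^\bullet(\mu),\boldsymbol c}(u(M))$ means $U_M=O_{L^p,m_p,\boldsymbol c}(u(M))$ for all $p\in[1,\infty)$, where $m_p$ is a constant depending only on the absolute moments $\int|x|^q\mu(dx)$, $q\ge1$. Assumption (C) with constant $C>0$ and distribution $\mu$: for all $\ell\in\mathbb{Z}$, all $h$ satisfying (H), all $u\in\mathbb{R}$ and $T\ge T_0$, $\widehat\gamma_{T,M}(u,\ell)-\mathbb{E}[\widehat\gamma_{T,M}(u,\ell)]=O_{L^\bullet(\mu),\ell,\|h\|_\infty,\|h'\|_\infty,C}(M^{-1/2})$.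
   Formalization: The coefficients a_{h,f,ℓ} are taken as functions of u=t/T, since one vector for all t,T is impossible; the constants in (C) and in both error terms may also depend on the number N of pieces of h, since (C) uniform in N cannot hold when f≥f_->0. *)

theory Defs
  imports
    "HOL-Probability.Probability"
    "Jordan_Normal_Form.Gauss_Jordan_Elimination"
begin

unbundle no vec_syntax

section \<open>Hoelder balls\<close>

definition nth_vderiv :: "nat \<Rightarrow> (real \<Rightarrow> 'a::real_normed_vector) \<Rightarrow> real \<Rightarrow> 'a" where
  "nth_vderiv j g = ((\<lambda>\<phi> x. vector_derivative \<phi> (at x)) ^^ j) g"

definition times_differentiable :: "nat \<Rightarrow> (real \<Rightarrow> 'a::real_normed_vector) \<Rightarrow> bool" where
  "times_differentiable k g \<longleftrightarrow> (\<forall>j<k. \<forall>x. nth_vderiv j g differentiable (at x))"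

definition holder_seminorm :: "real \<Rightarrow> (real \<Rightarrow> 'a::real_normed_vector) \<Rightarrow> ennreal" where
  "holder_seminorm \<alpha> g =
     (SUP (x, y) \<in> {(x, y). 0 < \<bar>x - y\<bar> \<and> \<bar>x - y\<bar> < 1}.
        ennreal (norm (g x - g y) / \<bar>x - y\<bar> powr \<alpha>))"

definition sup_norm :: "(real \<Rightarrow> 'a::real_normed_vector) \<Rightarrow> ennreal" where
  "sup_norm g = (SUP x. ennreal (norm (g x)))"

text \<open>For \<open>\<beta> > 0\<close>, this is the unique \<open>k\<close> with \<open>\<beta> - k \<in> (0, 1]\<close>;
  an integer \<open>\<beta>\<close> gives \<open>k = \<beta> - 1\<close>.\<close>

definition holder_order :: "real \<Rightarrow> nat" where
  "holder_order \<beta> = nat (\<lceil>\<beta>\<rceil> - 1)"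

definition holder_norm :: "real \<Rightarrow> (real \<Rightarrow> 'a::real_normed_vector) \<Rightarrow> ennreal" where
  "holder_norm \<beta> g =
     (let k = holder_order \<beta>; \<alpha> = \<beta> - real k in
      if times_differentiable k g
      then holder_seminorm \<alpha> (nth_vderiv k g) + (MAX j\<in>{0..k}. sup_norm (nth_vderiv j g))
      else \<infinity>)"

definition holder_ball :: "real \<Rightarrow> real \<Rightarrow> (real \<Rightarrow> 'a::real_normed_vector) set" where
  "holder_ball \<beta> R = {g. holder_norm \<beta> g \<le> ennreal R}"

section \<open>Weak local stationarity\<close>

definition local_spectral_density :: "(real \<Rightarrow> real \<Rightarrow> real) \<Rightarrow> bool" where
  "local_spectral_density f \<longleftrightarrow>
     (\<forall>u \<xi>. 0 \<le> f u \<xi>) \<and>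
     (\<forall>u \<xi>. f u (\<xi> + 2 * pi) = f u \<xi>) \<and>
     (\<forall>u a b. (f u) absolutely_integrable_on {a..b})"

definition local_cov :: "(real \<Rightarrow> real \<Rightarrow> real) \<Rightarrow> real \<Rightarrow> int \<Rightarrow> complex" where
  "local_cov f u l =
     (LINT \<xi>:{-pi..pi}|lebesgue. exp (\<i> * of_int l * complex_of_real \<xi>) * complex_of_real (f u \<xi>))"

definition covar :: "'w measure \<Rightarrow> ('w \<Rightarrow> real) \<Rightarrow> ('w \<Rightarrow> real) \<Rightarrow> real" where
  "covar P U V =
     (\<integral>\<omega>. (U \<omega> - (\<integral>\<omega>'. U \<omega>' \<partial>P)) * (V \<omega> - (\<integral>\<omega>'. V \<omega>' \<partial>P)) \<partial>P)"

text \<open>An array \<open>X t T\<close> is only constrained (and only used) at \<open>T \<ge> T\<^sub>0\<close>.\<close>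

definition weakly_locally_stationary ::
  "'w measure \<Rightarrow> real \<Rightarrow> real \<Rightarrow> real \<Rightarrow> (int \<Rightarrow> nat \<Rightarrow> 'w \<Rightarrow> real) \<Rightarrow> (real \<Rightarrow> real \<Rightarrow> real) \<Rightarrow> bool"
  where
  "weakly_locally_stationary P \<beta> R T\<^sub>0 X f \<longleftrightarrow>
     local_spectral_density f \<and>
     (\<forall>t T. T\<^sub>0 \<le> real T \<longrightarrow>
        X t T \<in> borel_measurable P \<and> integrable P (\<lambda>\<omega>. (X t T \<omega>)\<^sup>2)) \<and>
     (\<forall>\<xi>. (\<lambda>u. f u \<xi>) \<in> holder_ball \<beta> R) \<and>
     (\<forall>t l T. T\<^sub>0 \<le> real T \<longrightarrow>
        norm (complex_of_real (covar P (X t T) (X (t - l) T)) - local_cov f (real_of_int t / real T) l)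
          \<le> R * real T powr (- min 1 \<beta>))"

section \<open>Prediction coefficients\<close>

text \<open>The vector \<open>\<Gamma>\<^sup>-\<^sup>1 \<gamma>\<close> with \<open>\<gamma> = (g 1, \<dots>, g d)\<close> and \<open>\<Gamma>\<close> the Toeplitz matrix of \<open>g\<close>, and \<open>0\<close> if
  \<open>\<Gamma>\<close> is singular. Indices are shifted by one since vectors are indexed by \<open>0, \<dots>, d - 1\<close>.\<close>

definition yule_walker :: "nat \<Rightarrow> (int \<Rightarrow> 'a::field) \<Rightarrow> 'a Matrix.vec" where
  "yule_walker d g =
     (case mat_inverse (Matrix.mat d d (\<lambda>(i, j). g (int i - int j))) of
        Some B \<Rightarrow> B *\<^sub>v Matrix.vec d (\<lambda>i. g (int i + 1))
      | None \<Rightarrow> 0\<^sub>v d)"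

definition local_pred_coeffs :: "nat \<Rightarrow> (real \<Rightarrow> real \<Rightarrow> real) \<Rightarrow> real \<Rightarrow> complex Matrix.vec" where
  "local_pred_coeffs d f u = yule_walker d (local_cov f u)"

section \<open>Tapers and the local Yule--Walker estimator\<close>

definition taper_norm :: "(real \<Rightarrow> real) \<Rightarrow> real" where
  "taper_norm h = (SUP x\<in>{0..1}. \<bar>h x\<bar>)"

text \<open>A function on \<open>[0, 1]\<close> is represented by a function on \<open>real\<close> whose values outside \<open>[0, 1]\<close>
  are irrelevant. At the right end point of a piece \<open>(u\<^sub>i\<^sub>-\<^sub>1, u\<^sub>i]\<close> the derivative is the one-sided
  one.\<close>

definition taper_deriv_norm :: "nat \<Rightarrow> (nat \<Rightarrow> real) \<Rightarrow> (real \<Rightarrow> real) \<Rightarrow> real" where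
  "taper_deriv_norm N u h =
     (MAX i\<in>{1..N}. SUP x\<in>{u (i - 1)<..u i}.
        \<bar>vector_derivative h (at x within {u (i - 1)<..u i})\<bar>)"

text \<open>The number \<open>N\<close> of pieces is kept explicit because the constants in the estimates below have to
  be allowed to depend on it. Given a grid \<open>{1/M, \<dots>, M/M}\<close>, a taper with bounded sup norm and
  vanishing derivative but with of the order of \<open>M\<close> pieces can vanish at all grid points except one.
  So bounds that are uniform in \<open>N\<close> cannot hold: \<open>emp_cov\<close> at lag \<open>0\<close> then is the square of a single
  observation, whose fluctuations are not of order \<open>M\<^sup>-\<^sup>1\<^sup>/\<^sup>2\<close>.\<close>

definition taper :: "nat \<Rightarrow> (nat \<Rightarrow> real) \<Rightarrow> (real \<Rightarrow> real) \<Rightarrow> bool" where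
  "taper N u h \<longleftrightarrow>
     1 \<le> N \<and> u 0 = 0 \<and> u N = 1 \<and> strict_mono_on {0..N} u \<and>
     (\<forall>i\<in>{1..N}.
        (\<exists>h'. (\<forall>x\<in>{u (i - 1)<..u i}. (h has_real_derivative h' x) (at x within {u (i - 1)<..u i})) \<and>
              continuous_on {u (i - 1)<..u i} h') \<and>
        bdd_above ((\<lambda>x. \<bar>vector_derivative h (at x within {u (i - 1)<..u i})\<bar>) ` {u (i - 1)<..u i})) \<and>
     bdd_above ((\<lambda>x. \<bar>h x\<bar>) ` {0..1}) \<and>
     (LINT x:{0..1}|lborel. (h x)\<^sup>2) = 1"

definition taper_mass :: "(real \<Rightarrow> real) \<Rightarrow> nat \<Rightarrow> real" where
  "taper_mass h M = (\<Sum>k=1..M. (h (real k / real M))\<^sup>2)"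

definition emp_cov ::
  "(real \<Rightarrow> real) \<Rightarrow> (int \<Rightarrow> nat \<Rightarrow> 'w \<Rightarrow> real) \<Rightarrow> nat \<Rightarrow> nat \<Rightarrow> real \<Rightarrow> int \<Rightarrow> 'w \<Rightarrow> real" where
  "emp_cov h X T M u l \<omega> =
     (if taper_mass h M = 0 then 0 else
      1 / taper_mass h M *
      (\<Sum>(t\<^sub>1, t\<^sub>2)\<in>{(t\<^sub>1, t\<^sub>2). t\<^sub>1 \<in> {1..M} \<and> t\<^sub>2 \<in> {1..M} \<and> int t\<^sub>1 - int t\<^sub>2 = l}.
         h (real t\<^sub>1 / real M) * h (real t\<^sub>2 / real M) *
         X (\<lfloor>u * real T\<rfloor> + int t\<^sub>1 - int (M div 2)) T \<omega> *
         X (\<lfloor>u * real T\<rfloor> + int t\<^sub>2 - int (M div 2)) T \<omega>))"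

definition pred_estimator ::
  "nat \<Rightarrow> (real \<Rightarrow> real) \<Rightarrow> (int \<Rightarrow> nat \<Rightarrow> 'w \<Rightarrow> real) \<Rightarrow> int \<Rightarrow> nat \<Rightarrow> nat \<Rightarrow> 'w \<Rightarrow> real Matrix.vec" where
  "pred_estimator d h X t T M \<omega> =
     yule_walker d (\<lambda>l. emp_cov h X T M (real_of_int t / real T) l \<omega>)"

section \<open>Stochastic order and the concentration assumption\<close>

definition Lp_bounded :: "'w measure \<Rightarrow> real \<Rightarrow> ('w \<Rightarrow> real) \<Rightarrow> real \<Rightarrow> bool" where
  "Lp_bounded P p U B \<longleftrightarrow>
     U \<in> borel_measurable P \<and> integrable P (\<lambda>\<omega>. \<bar>U \<omega>\<bar> powr p) \<and>
     (\<integral>\<omega>. \<bar>U \<omega>\<bar> powr p \<partial>P) powr (1 / p) \<le> B"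

definition abs_moments :: "real measure \<Rightarrow> real \<Rightarrow> ennreal" where
  "abs_moments \<mu> = (\<lambda>q\<in>{1..}. \<integral>\<^sup>+ x. ennreal (\<bar>x\<bar> powr q) \<partial>\<mu>)"

text \<open>\<open>K\<close> is the function giving the constant of the \<open>O\<close>-symbol, and \<open>m\<close> the function giving the
  numbers \<open>m\<^sub>p\<close> in terms of the absolute moments of \<open>\<mu>\<close>. Being implied by the notation, both are fixed
  independently of the array.\<close>

definition assumption_C ::
  "(nat \<Rightarrow> int \<Rightarrow> real \<Rightarrow> real \<Rightarrow> real \<Rightarrow> real \<Rightarrow> real \<Rightarrow> real) \<Rightarrow> (real \<Rightarrow> (real \<Rightarrow> ennreal) \<Rightarrow> real) \<Rightarrow>
   'w measure \<Rightarrow> real \<Rightarrow> (int \<Rightarrow> nat \<Rightarrow> 'w \<Rightarrow> real) \<Rightarrow> real \<Rightarrow> real measure \<Rightarrow> bool" where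
  "assumption_C K m P T\<^sub>0 X C \<mu> \<longleftrightarrow>
     (\<forall>l N s h u T. taper N s h \<longrightarrow> T\<^sub>0 \<le> real T \<longrightarrow>
        (\<forall>p M. 1 \<le> p \<longrightarrow> 0 < M \<longrightarrow> even M \<longrightarrow>
           Lp_bounded P p
             (\<lambda>\<omega>. emp_cov h X T M u l \<omega> - (\<integral>\<omega>'. emp_cov h X T M u l \<omega>' \<partial>P))
             (K N l p (m p (abs_moments \<mu>)) (taper_norm h) (taper_deriv_norm N s h) C
                * real M powr (- 1 / 2))))"

text \<open>Admissible dependence of the constants on their real parameters: continuity on the natural
  parameter domain, for every value of the discrete parameters. The order of the arguments is \<open>N\<close>,
  \<open>l\<close> or \<open>d\<close>, then \<open>p, m\<^sub>p\<close> (if present), then the remaining parameters.\<close>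

definition constC :: "(nat \<Rightarrow> int \<Rightarrow> real \<Rightarrow> real \<Rightarrow> real \<Rightarrow> real \<Rightarrow> real \<Rightarrow> real) \<Rightarrow> bool" where
  "constC K \<longleftrightarrow> (\<forall>N l.
     continuous_on ({1..} \<times> UNIV \<times> {0..} \<times> {0..} \<times> {0<..})
       (\<lambda>(p, m, b, b', C). K N l p m b b' C))"

definition const_bias ::
  "(nat \<Rightarrow> nat \<Rightarrow> real \<Rightarrow> real \<Rightarrow> real \<Rightarrow> real \<Rightarrow> real \<Rightarrow> real) \<Rightarrow> bool" where
  "const_bias K \<longleftrightarrow> (\<forall>N d.
     continuous_on ({0<..} \<times> {0..} \<times> {0..} \<times> {0<..} \<times> {0<..})
       (\<lambda>(f_min, b, b', \<beta>, R). K N d f_min b b' \<beta> R))"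

definition const_noise ::
  "(nat \<Rightarrow> nat \<Rightarrow> real \<Rightarrow> real \<Rightarrow> real \<Rightarrow> real \<Rightarrow> real \<Rightarrow> real \<Rightarrow> real \<Rightarrow> real \<Rightarrow> real) \<Rightarrow> bool" where
  "const_noise K \<longleftrightarrow> (\<forall>N d.
     continuous_on ({1..} \<times> UNIV \<times> {0<..} \<times> {0..} \<times> {0..} \<times> {0<..} \<times> {0<..} \<times> {0<..})
       (\<lambda>(p, m, f_min, b, b', \<beta>, R, C). K N d p m f_min b b' \<beta> R C))"

text \<open>In an expansion \<open>\<Sum>l=1..k. a h f l * (M/T)^l\<close> of the bias at rescaled time \<open>u = t/T\<close>, the
  coefficient \<open>a h f l\<close> is a function of \<open>u\<close>: for \<open>l = 1\<close> it involves the derivative of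
  \<open>local_cov f\<close> at \<open>u\<close>. What \<open>a\<close> must not depend on are the array, \<open>M\<close>, the probability space, and
  \<open>t\<close>, \<open>T\<close> other than through \<open>u\<close>.\<close>

end

theory Submission
  imports Defs "Jordan_Normal_Form.Determinant"
begin


text \<open>
  Put \<open>x = M / T\<close> and \<open>u = t / T\<close>. The estimator solves the Yule--Walker equations of the empirical
  covariances, the local predictor solves those of the local covariance function at \<open>u\<close>. The proof
  compares the two linear systems and has three ingredients.

  The bias of the covariances. Integrating the Taylor expansion of the spectral density in time yields
  that of the local covariance function. Averaging it over the block with the weights of the taper gives
  the mean of the empirical covariances as a polynomial in \<open>x\<close> whose coefficient of order \<open>j\<close> is the
  \<open>j\<close>th derivative of the local covariance, divided by \<open>j!\<close>, times the moment of order \<open>j\<close> of the squared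
  taper about \<open>1 / 2\<close> (\<open>emp_cov_mean_expansion\<close>). Sums over the grid differ from integrals by terms of order \<open>1 / M\<close>, because a piecewise
  smooth taper has bounded variation. For a symmetric taper the first moment vanishes.

  The expansion of the solution. The coefficients of the expansion of the predictor solve the
  Yule--Walker equations in the sense of formal power series in \<open>x\<close> (\<open>pred_coeff\<close>). The lower bound on
  the spectral density makes the local covariance matrix coercive (\<open>cov_toep_coercive\<close>), which bounds
  these coefficients and the distance of an approximate solution from the exact one.

  The boundedness of the estimator. The inverse of the empirical covariance matrix is not bounded, yet
  the estimator is: the empirical covariances are those of a finite sequence, hence of positive type, and
  for such covariances the Levinson--Durbin recursion, whose reflection coefficients have modulus at most
  one, bounds the solution of order \<open>d\<close> by \<open>2 ^ d\<close> (\<open>toep_solution_sum_bound\<close>).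

  Boundedness is what makes the comparison linear. The matrix of the means, applied to the difference
  between the estimator and the expanded predictor, gives the fluctuations of the empirical covariances
  multiplied by the bounded estimator, plus a deterministic error of the required order
  (\<open>solution_error\<close>). Whenever that matrix fails to be coercive, the required order is bounded from
  below, and boundedness of the estimator is enough (\<open>estimator_error\<close>). The resulting pointwise bound is
  the sum of a deterministic term and a linear combination of fluctuations, and cutting the error off at
  the deterministic term produces the two summands of the claim.

  The constants have to be continuous in \<open>\<beta>\<close>, whereas the number \<open>k\<close> of derivatives jumps at the
  integers. Therefore \<open>k\<close> is estimated by \<open>\<beta>\<close> throughout, also in exponents.
\<close>

section \<open>Toeplitz systems\<close>

definition toep :: "nat \<Rightarrow> (int \<Rightarrow> real) \<Rightarrow> (nat \<Rightarrow> real) \<Rightarrow> nat \<Rightarrow> real" where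
  "toep d g x i = (\<Sum>j<d. g (int i - int j) * x j)"

definition toep_form :: "nat \<Rightarrow> (int \<Rightarrow> real) \<Rightarrow> (nat \<Rightarrow> real) \<Rightarrow> real" where
  "toep_form d g x = (\<Sum>i<d. x i * toep d g x i)"

definition toep_pos :: "nat \<Rightarrow> (int \<Rightarrow> real) \<Rightarrow> bool" where
  "toep_pos d g \<longleftrightarrow> (\<forall>x. (\<exists>i<d. x i \<noteq> 0) \<longrightarrow> 0 < toep_form d g x)"

text \<open>A choice of the solution spares the entries of the inverse matrix; only existence and uniqueness in
  the positive definite case matter.\<close>

definition toep_solve :: "nat \<Rightarrow> (int \<Rightarrow> real) \<Rightarrow> (nat \<Rightarrow> real) \<Rightarrow> nat \<Rightarrow> real" where
  "toep_solve d g y = (SOME x. \<forall>i<d. toep d g x i = y i)"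

abbreviation toep_mat :: "nat \<Rightarrow> (int \<Rightarrow> 'a) \<Rightarrow> 'a Matrix.mat" where
  "toep_mat d g \<equiv> Matrix.mat d d (\<lambda>(i, j). g (int i - int j))"

abbreviation lag_vec :: "nat \<Rightarrow> (int \<Rightarrow> 'a) \<Rightarrow> 'a Matrix.vec" where
  "lag_vec d g \<equiv> Matrix.vec d (\<lambda>i. g (int i + 1))"

lemma toep_diff: "toep d g (\<lambda>i. x i - y i) i = toep d g x i - toep d g y i"
  by (simp add: toep_def algebra_simps sum_subtractf)

lemma toep_scale: "toep d g (\<lambda>i. c * x i) i = c * toep d g x i"
  by (simp add: toep_def algebra_simps sum_distrib_left)

lemma toep_diff_left: "toep d (\<lambda>l. g l - g' l) x i = toep d g x i - toep d g' x i"
  by (simp add: toep_def algebra_simps sum_subtractf)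

lemma toep_Suc: "toep (Suc d) g x i = toep d g x i + g (int i - int d) * x d"
  by (simp add: toep_def)

lemma toep_cong: "(\<And>j. j < d \<Longrightarrow> x j = y j) \<Longrightarrow> toep d g x i = toep d g y i"
  by (simp add: toep_def)

lemma abs_toep_le:
  assumes "\<And>j. j < d \<Longrightarrow> \<bar>g (int i - int j)\<bar> \<le> G" "\<And>j. j < d \<Longrightarrow> \<bar>x j\<bar> \<le> X" "0 \<le> G"
  shows "\<bar>toep d g x i\<bar> \<le> real d * G * X"
proof -
  have "\<bar>toep d g x i\<bar> \<le> (\<Sum>j<d. \<bar>g (int i - int j) * x j\<bar>)"
    unfolding toep_def by (rule sum_abs)
  also have "\<dots> \<le> (\<Sum>j<d. G * X)"
    by (intro sum_mono) (auto simp: abs_mult intro!: mult_mono assms)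
  finally show ?thesis by simp
qed

lemma mat_inverse_field:
  fixes A :: "'a::field Matrix.mat"
  assumes A: "A \<in> carrier_mat n n"
  shows "mat_inverse A = None \<Longrightarrow> det A = 0"
    and "mat_inverse A = Some B \<Longrightarrow> B \<in> carrier_mat n n \<and> A * B = 1\<^sub>m n \<and> B * A = 1\<^sub>m n \<and> det A \<noteq> 0"
proof -
  show "det A = 0" if "mat_inverse A = None"
    using mat_inverse(1)[OF A that, of "()"] det_non_zero_imp_unit[OF A, of "()"] by auto
  assume "mat_inverse A = Some B"
  from mat_inverse(2)[OF A this] have B: "B \<in> carrier_mat n n" "A * B = 1\<^sub>m n" "B * A = 1\<^sub>m n"
    by auto
  have "det A * det B = 1"
    using det_mult[OF A B(1)] B(2) by simp
  then show "B \<in> carrier_mat n n \<and> A * B = 1\<^sub>m n \<and> B * A = 1\<^sub>m n \<and> det A \<noteq> 0"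
    using B by auto
qed

text \<open>Cramer's rule. Since \<open>x / 0 = 0\<close>, it covers the singular case too; it shows that the solution is
  a measurable function of the entries, and that it is compatible with field homomorphisms.\<close>

lemma yule_walker_cramer:
  fixes g :: "int \<Rightarrow> 'a::field"
  assumes "i < d"
  shows "yule_walker d g $ i = det (replace_col (toep_mat d g) (lag_vec d g) i) / det (toep_mat d g)"
proof -
  let ?A = "toep_mat d g" and ?y = "lag_vec d g"
  have A: "?A \<in> carrier_mat d d" by simp
  show ?thesis
  proof (cases "mat_inverse ?A")
    case None
    then show ?thesis
      using mat_inverse_field(1)[OF A None] assms by (simp add: yule_walker_def)
  next
    case (Some B)
    from mat_inverse_field(2)[OF A Some]
    have B: "B \<in> carrier_mat d d" "?A * B = 1\<^sub>m d" "B * ?A = 1\<^sub>m d" "det ?A \<noteq> 0" by auto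
    have x: "yule_walker d g = B *\<^sub>v ?y"
      using Some by (simp add: yule_walker_def)
    have "?A *\<^sub>v (B *\<^sub>v ?y) = ?A * B *\<^sub>v ?y"
      using A B(1) by (subst assoc_mult_mat_vec) auto
    then have "?A *\<^sub>v (B *\<^sub>v ?y) = ?y"
      using B by simp
    moreover have "B *\<^sub>v ?y \<in> carrier_vec d"
      using B(1) by simp
    ultimately show ?thesis
      using cramer_lemma_mat[OF A, of "B *\<^sub>v ?y" i] assms B(4) x by simp
  qed
qed

lemma dim_yule_walker [simp]: "dim_vec (yule_walker d g) = d"
proof (cases "mat_inverse (toep_mat d g)")
  case None
  then show ?thesis by (simp add: yule_walker_def)
next
  case (Some B)
  then show ?thesis
    using mat_inverse_field(2)[of "toep_mat d g" d B] by (auto simp: yule_walker_def)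
qed

lemma yule_walker_complex_of_real:
  assumes "i < d"
  shows "yule_walker d (\<lambda>l. complex_of_real (g l)) $ i = complex_of_real (yule_walker d g $ i)"
proof -
  have 1: "toep_mat d (\<lambda>l. complex_of_real (g l)) = map_mat complex_of_real (toep_mat d g)"
    by (rule eq_matI) auto
  have 2: "replace_col (toep_mat d (\<lambda>l. complex_of_real (g l))) (lag_vec d (\<lambda>l. complex_of_real (g l))) i
     = map_mat complex_of_real (replace_col (toep_mat d g) (lag_vec d g) i)"
    by (rule eq_matI) (auto simp: replace_col_def)
  show ?thesis
    unfolding yule_walker_cramer[OF assms] 2 unfolding 1 of_real_hom.hom_det by simp
qed

lemma borel_measurable_det:
  fixes A :: "'w \<Rightarrow> real Matrix.mat"
  assumes "\<And>\<omega>. A \<omega> \<in> carrier_mat n n"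
    and "\<And>i j. i < n \<Longrightarrow> j < n \<Longrightarrow> (\<lambda>\<omega>. A \<omega> $$ (i, j)) \<in> borel_measurable P"
  shows "(\<lambda>\<omega>. det (A \<omega>)) \<in> borel_measurable P"
proof -
  have "(\<lambda>\<omega>. A \<omega> $$ (i, p i)) \<in> borel_measurable P" if "p permutes {0..<n}" "i \<in> {0..<n}" for p i
    using assms(2)[of i "p i"] permutes_in_image[OF that(1), of i] that(2) by auto
  then show ?thesis
    unfolding det_def'[OF assms(1)] by (intro borel_measurable_sum borel_measurable_times
        borel_measurable_const borel_measurable_prod) auto
qed

lemma borel_measurable_yule_walker:
  assumes g: "\<And>l. (\<lambda>\<omega>. g \<omega> l) \<in> borel_measurable P" and "i < d"
  shows "(\<lambda>\<omega>. yule_walker d (g \<omega>) $ i :: real) \<in> borel_measurable P"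
proof -
  have "(\<lambda>\<omega>. replace_col (toep_mat d (g \<omega>)) (lag_vec d (g \<omega>)) i $$ (k, j)) \<in> borel_measurable P"
    if "k < d" "j < d" for k j
    using that g by (cases "j = i") (simp_all add: replace_col_def)
  moreover have "(\<lambda>\<omega>. toep_mat d (g \<omega>) $$ (k, j)) \<in> borel_measurable P" if "k < d" "j < d" for k j
    using that g by simp
  ultimately show ?thesis
    unfolding yule_walker_cramer[OF assms(2)]
    by (intro borel_measurable_divide borel_measurable_det[where n = d])
       (auto simp: replace_col_def)
qed

lemma toep_mat_mult_vec:
  assumes "v \<in> carrier_vec d" "i < d"
  shows "(toep_mat d g *\<^sub>v v) $ i = toep d g (\<lambda>j. v $ j) i"
  using assms by (simp add: toep_def scalar_prod_def atLeast0LessThan)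

lemma det_toep_pos:
  assumes "toep_pos d g"
  shows "det (toep_mat d g) \<noteq> 0"
proof
  assume "det (toep_mat d g) = 0"
  then obtain v where v: "v \<in> carrier_vec d" "v \<noteq> 0\<^sub>v d" "toep_mat d g *\<^sub>v v = 0\<^sub>v d"
    using det_0_iff_vec_prod_zero[of "toep_mat d g" d] by auto
  have "toep d g (\<lambda>j. v $ j) i = 0" if "i < d" for i
    using toep_mat_mult_vec[OF v(1) that, of g] v(3) that by simp
  then have "toep_form d g (\<lambda>j. v $ j) = 0"
    by (simp add: toep_form_def)
  moreover have "\<exists>i<d. v $ i \<noteq> 0"
    using v by (auto simp: vec_eq_iff)
  ultimately have "0 < (0::real)"
    using assms[unfolded toep_pos_def, rule_format, of "\<lambda>j. v $ j"] by (simp only:)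
  then show False by simp
qed

lemma toep_pos_solvable:
  assumes "toep_pos d g"
  shows "\<exists>x. \<forall>i<d. toep d g x i = y i"
proof -
  let ?A = "toep_mat d g"
  have A: "?A \<in> carrier_mat d d" by simp
  obtain B where "mat_inverse ?A = Some B"
    using mat_inverse_field(1)[OF A] det_toep_pos[OF assms] by fastforce
  then have B: "B \<in> carrier_mat d d" "?A * B = 1\<^sub>m d"
    using mat_inverse_field(2)[OF A] by auto
  have "?A *\<^sub>v (B *\<^sub>v Matrix.vec d y) = ?A * B *\<^sub>v Matrix.vec d y"
    using A B(1) by (subst assoc_mult_mat_vec) auto
  then have "?A *\<^sub>v (B *\<^sub>v Matrix.vec d y) = Matrix.vec d y"
    using B by simp
  moreover have "B *\<^sub>v Matrix.vec d y \<in> carrier_vec d"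
    using B(1) by simp
  ultimately have "toep d g (\<lambda>j. (B *\<^sub>v Matrix.vec d y) $ j) i = y i" if "i < d" for i
    using toep_mat_mult_vec[of "B *\<^sub>v Matrix.vec d y" d i g] that by (simp only: index_vec)
  then show ?thesis by blast
qed

lemma toep_solve:
  assumes "toep_pos d g" "i < d"
  shows "toep d g (toep_solve d g y) i = y i"
  unfolding toep_solve_def using someI_ex[OF toep_pos_solvable[OF assms(1), of y]] assms(2) by blast

lemma toep_pos_unique:
  assumes "toep_pos d g" "\<And>i. i < d \<Longrightarrow> toep d g x i = toep d g y i" "i < d"
  shows "x i = y i"
proof (rule ccontr)
  assume "x i \<noteq> y i"
  then have "\<exists>i<d. (\<lambda>i. x i - y i) i \<noteq> 0"
    using assms(3) by auto
  then have "0 < toep_form d g (\<lambda>i. x i - y i)"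
    by (rule assms(1)[unfolded toep_pos_def, rule_format])
  moreover have "toep_form d g (\<lambda>i. x i - y i) = 0"
    unfolding toep_form_def toep_diff by (simp add: assms(2))
  ultimately show False by simp
qed

lemma toep_yule_walker:
  assumes "toep_pos d g" "i < d"
  shows "toep d g (\<lambda>j. yule_walker d g $ j) i = g (int i + 1)"
proof -
  let ?A = "toep_mat d g"
  have A: "?A \<in> carrier_mat d d" by simp
  obtain B where S: "mat_inverse ?A = Some B"
    using mat_inverse_field(1)[OF A] det_toep_pos[OF assms(1)] by fastforce
  then have B: "B \<in> carrier_mat d d" "?A * B = 1\<^sub>m d"
    using mat_inverse_field(2)[OF A] by auto
  have x: "yule_walker d g = B *\<^sub>v lag_vec d g"
    using S by (simp add: yule_walker_def)
  have "?A *\<^sub>v (B *\<^sub>v lag_vec d g) = ?A * B *\<^sub>v lag_vec d g"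
    using A B(1) by (subst assoc_mult_mat_vec) auto
  then have "?A *\<^sub>v yule_walker d g = lag_vec d g"
    using B x by simp
  moreover have "yule_walker d g \<in> carrier_vec d"
    by (rule carrier_vecI) simp
  ultimately show ?thesis
    using toep_mat_mult_vec[of "yule_walker d g" d i g] assms(2) by simp
qed

lemma yule_walker_zero:
  assumes "i < d"
  shows "yule_walker d (\<lambda>l. 0 :: real) $ i = 0"
proof -
  have "replace_col (toep_mat d (\<lambda>l. 0::real)) (lag_vec d (\<lambda>l. 0)) i = 0\<^sub>m d d"
    by (rule eq_matI) (auto simp: replace_col_def)
  moreover have "det (0\<^sub>m d d :: real Matrix.mat) = 0"
    using assms by (intro det_0_iff_vec_prod_zero[of "0\<^sub>m d d" d, THEN iffD2] exI[of _ "unit_vec d i"])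
      auto
  ultimately show ?thesis
    by (simp add: yule_walker_cramer[OF assms])
qed

text \<open>Testing the system against its solution bounds the largest coordinate \<open>m\<close> of the solution:
  \<open>\<kappa> m\<^sup>2\<close> is at most the quadratic form, which is at most \<open>d m \<epsilon>\<close>.\<close>

lemma coercive_solution_bound:
  assumes co: "\<And>x. \<kappa> * (\<Sum>i<d. (x i)\<^sup>2) \<le> toep_form d g x" and \<kappa>: "0 < \<kappa>"
    and \<epsilon>: "\<And>i. i < d \<Longrightarrow> \<bar>toep d g x i\<bar> \<le> \<epsilon>" and i: "i < d"
  shows "\<bar>x i\<bar> \<le> real d * \<epsilon> / \<kappa>"
proof -
  define m where "m = Max ((\<lambda>i. \<bar>x i\<bar>) ` {..<d})"
  have ne: "(\<lambda>i. \<bar>x i\<bar>) ` {..<d} \<noteq> {}" using i by auto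
  obtain j where j: "j < d" "m = \<bar>x j\<bar>"
    using Max_in[OF _ ne] unfolding m_def by auto
  have le: "\<bar>x i\<bar> \<le> m" if "i < d" for i
    unfolding m_def using that by (intro Max_ge) auto
  have "\<kappa> * m\<^sup>2 \<le> \<kappa> * (\<Sum>i<d. (x i)\<^sup>2)"
    using j \<kappa> member_le_sum[of j "{..<d}" "\<lambda>i. (x i)\<^sup>2"] by (intro mult_left_mono) auto
  also have "\<dots> \<le> toep_form d g x" by (rule co)
  also have "\<dots> \<le> (\<Sum>i<d. m * \<epsilon>)"
    unfolding toep_form_def
  proof (rule sum_mono)
    fix i assume "i \<in> {..<d}"
    then have "\<bar>x i\<bar> * \<bar>toep d g x i\<bar> \<le> m * \<epsilon>"
      using le[of i] \<epsilon>[of i] by (intro mult_mono) (auto intro: order_trans)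
    then show "x i * toep d g x i \<le> m * \<epsilon>"
      by (metis abs_le_D1 abs_mult)
  qed
  finally have *: "\<kappa> * m * m \<le> real d * \<epsilon> * m"
    by (simp add: power2_eq_square algebra_simps)
  have "m \<le> real d * \<epsilon> / \<kappa>"
  proof (cases "m = 0")
    case True
    have "0 \<le> \<epsilon>" using \<epsilon>[OF i] by linarith
    then show ?thesis using True \<kappa> by simp
  next
    case False
    then have "0 < m" using j by auto
    then have "\<kappa> * m \<le> real d * \<epsilon>" using * by simp
    then show ?thesis using \<kappa> by (simp add: field_simps)
  qed
  then show ?thesis using le[OF i] by linarith
qed

lemma coercive_imp_toep_pos:
  assumes co: "\<And>x. \<kappa> * (\<Sum>i<d. (x i)\<^sup>2) \<le> toep_form d g x" and \<kappa>: "0 < \<kappa>"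
  shows "toep_pos d g"
  unfolding toep_pos_def
proof (intro allI impI)
  fix x :: "nat \<Rightarrow> real"
  assume "\<exists>i<d. x i \<noteq> 0"
  then have "0 < (\<Sum>i<d. (x i)\<^sup>2)"
    by (auto intro!: sum_pos2)
  then show "0 < toep_form d g x"
    using co[of x] mult_pos_pos[OF \<kappa>] by fastforce
qed

lemma toep_form_perturb:
  assumes "\<And>l. \<bar>l\<bar> \<le> int d \<Longrightarrow> \<bar>g l - g' l\<bar> \<le> \<eta>"
  shows "\<bar>toep_form d g x - toep_form d g' x\<bar> \<le> real d * \<eta> * (\<Sum>i<d. (x i)\<^sup>2)"
proof -
  have "toep_form d g x - toep_form d g' x = (\<Sum>i<d. \<Sum>j<d. (g (int i - int j) - g' (int i - int j)) * (x i * x j))"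
    by (simp add: toep_form_def toep_def sum_subtractf[symmetric] sum_distrib_left algebra_simps)
  also have "\<bar>\<dots>\<bar> \<le> (\<Sum>i<d. \<Sum>j<d. \<bar>(g (int i - int j) - g' (int i - int j)) * (x i * x j)\<bar>)"
    by (intro order_trans[OF sum_abs] sum_mono order_refl)
  also have "\<dots> \<le> (\<Sum>i<d. \<Sum>j<d. \<eta> * (((x i)\<^sup>2 + (x j)\<^sup>2) / 2))"
  proof (intro sum_mono)
    fix i j assume "i \<in> {..<d}" "j \<in> {..<d}"
    then have 1: "\<bar>g (int i - int j) - g' (int i - int j)\<bar> \<le> \<eta>"
      by (intro assms) auto
    have "0 \<le> (\<bar>x i\<bar> - \<bar>x j\<bar>)\<^sup>2" by simp
    then have 2: "\<bar>x i * x j\<bar> \<le> ((x i)\<^sup>2 + (x j)\<^sup>2) / 2"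
      by (simp add: power2_diff abs_mult)
    show "\<bar>(g (int i - int j) - g' (int i - int j)) * (x i * x j)\<bar> \<le> \<eta> * (((x i)\<^sup>2 + (x j)\<^sup>2) / 2)"
      unfolding abs_mult[of "g (int i - int j) - g' (int i - int j)"]
      using 1 2 by (intro mult_mono) auto
  qed
  also have "\<dots> = real d * \<eta> * (\<Sum>i<d. (x i)\<^sup>2)"
  proof -
    have "(\<Sum>i<d. \<Sum>j<d. ((x i)\<^sup>2 + (x j)\<^sup>2) / 2) = real d * (\<Sum>i<d. (x i)\<^sup>2)"
      unfolding sum_divide_distrib[symmetric] sum.distrib sum_constant
      by (simp add: sum_distrib_left[symmetric])
    then show ?thesis
      by (simp only: sum_distrib_left[symmetric]) (simp add: algebra_simps)
  qed
  finally show ?thesis .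
qed

section \<open>Boundedness of Yule--Walker solutions\<close>

text \<open>An even Toeplitz matrix is invariant under reversal of the order of the coordinates.\<close>

lemma toep_reverse:
  assumes even: "\<And>l. g (- l) = g l" and "i < d"
  shows "toep d g (\<lambda>j. x (d - 1 - j)) i = toep d g x (d - 1 - i)"
proof -
  have "toep d g (\<lambda>j. x (d - 1 - j)) i = (\<Sum>j<d. g (int (d - 1 - i) - int (d - 1 - j)) * x (d - 1 - j))"
    unfolding toep_def
  proof (rule sum.cong)
    fix j assume j: "j \<in> {..<d}"
    have "g (int i - int j) = g (- (int i - int j))"
      by (rule even[symmetric])
    also have "- (int i - int j) = int (d - 1 - i) - int (d - 1 - j)"
      using j assms(2) by (auto simp: of_nat_diff)
    finally show "g (int i - int j) * x (d - 1 - j) = g (int (d - 1 - i) - int (d - 1 - j)) * x (d - 1 - j)"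
      by simp
  qed simp
  also have "\<dots> = (\<Sum>j<d. g (int (d - 1 - i) - int j) * x j)"
    by (rule sum.reindex_bij_witness[of _ "\<lambda>j. d - 1 - j" "\<lambda>j. d - 1 - j"]) auto
  finally show ?thesis by (simp add: toep_def)
qed

lemma toep_shift:
  "toep (Suc d) g x i = g (int i) * x 0 + (\<Sum>j<d. g (int i - int j - 1) * x (Suc j))"
  unfolding toep_def by (subst sum.lessThan_Suc_shift) (simp add: algebra_simps)

lemma toep_pos_mono:
  assumes "toep_pos d' g" "d \<le> d'"
  shows "toep_pos d g"
  unfolding toep_pos_def
proof (intro allI impI)
  fix x :: "nat \<Rightarrow> real"
  assume x: "\<exists>i<d. x i \<noteq> 0"
  define y where "y i = (if i < d then x i else 0)" for i
  have "toep d' g y i = toep d g x i" for i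
    unfolding toep_def using assms(2)
    by (intro sum.mono_neutral_cong_right) (auto simp: y_def)
  then have "toep_form d' g y = toep_form d g x"
    unfolding toep_form_def using assms(2)
    by (intro sum.mono_neutral_cong_right) (auto simp: y_def)
  moreover have "\<exists>i<d'. y i \<noteq> 0"
    using x assms(2) by (auto simp: y_def intro: less_le_trans)
  ultimately show "0 < toep_form d g x"
    using assms(1) unfolding toep_pos_def by metis
qed

text \<open>One step of the Levinson--Durbin recursion: the solution of order \<open>d + 1\<close> is obtained from that of
  order \<open>d\<close> by subtracting a multiple \<open>\<kappa>\<close> of its reversal, and the last coordinate \<open>\<kappa>\<close> has modulus at
  most one. For the latter, let \<open>s\<close> be the forward and backward prediction error of order \<open>d\<close> and \<open>r\<close> the
  covariance of the two prediction residuals; then \<open>\<kappa> = r / s\<close>, and the form takes the values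
  \<open>2 (s \<plusminus> r)\<close> at the sum and the difference of the residual filters.\<close>

lemma levinson_step:
  assumes even: "\<And>l. g (- l) = g l" and pos: "toep_pos (Suc (Suc d)) g"
    and \<theta>: "\<And>i. i < Suc d \<Longrightarrow> toep (Suc d) g \<theta> i = g (int i + 1)"
    and \<phi>: "\<And>i. i < d \<Longrightarrow> toep d g \<phi> i = g (int i + 1)"
  shows "\<bar>\<theta> d\<bar> \<le> 1" and "i < d \<Longrightarrow> \<theta> i = \<phi> i - \<theta> d * \<phi> (d - 1 - i)"
proof -
  define \<psi> where "\<psi> i = \<phi> (d - 1 - i)" for i
  have \<psi>: "toep d g \<psi> i = g (int d - int i)" if "i < d" for i
    using toep_reverse[of g i d \<phi>, OF even that] \<phi>[of "d - 1 - i"] that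
    unfolding \<psi>_def by (simp add: of_nat_diff)
  have pos_d: "toep_pos d g"
    using toep_pos_mono[OF pos] by simp
  have rec: "\<theta> i = \<phi> i - \<theta> d * \<psi> i" if "i < d" for i
  proof (rule toep_pos_unique[OF pos_d _ that, of \<theta> "\<lambda>i. \<phi> i - \<theta> d * \<psi> i"])
    fix i assume i: "i < d"
    have "toep d g \<theta> i = g (int i + 1) - g (int i - int d) * \<theta> d"
      using \<theta>[of i] i by (simp add: toep_Suc)
    also have "g (int i - int d) = g (int d - int i)"
      using even[of "int i - int d"] by simp
    finally show "toep d g \<theta> i = toep d g (\<lambda>i. \<phi> i - \<theta> d * \<psi> i) i"
      unfolding toep_diff toep_scale using \<phi>[OF i] \<psi>[OF i] by simp
  qed
  then show "i < d \<Longrightarrow> \<theta> i = \<phi> i - \<theta> d * \<phi> (d - 1 - i)"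
    by (simp add: \<psi>_def)
  \<comment> \<open>the prediction error variance and the covariance of the forward and backward residuals\<close>
  define s where "s = g 0 - (\<Sum>j<d. g (int j + 1) * \<phi> j)"
  define r where "r = g (int d + 1) - (\<Sum>j<d. g (int j + 1) * \<psi> j)"
  have rev1: "(\<Sum>j<d. g (int d - int j) * \<psi> j) = (\<Sum>j<d. g (int j + 1) * \<phi> j)"
    unfolding \<psi>_def by (rule sum.reindex_bij_witness[of _ "\<lambda>j. d - 1 - j" "\<lambda>j. d - 1 - j"])
      (auto simp: of_nat_diff algebra_simps)
  have rev2: "(\<Sum>j<d. g (int d - int j) * \<phi> j) = (\<Sum>j<d. g (int j + 1) * \<psi> j)"
    unfolding \<psi>_def by (rule sum.reindex_bij_witness[of _ "\<lambda>j. d - 1 - j" "\<lambda>j. d - 1 - j"])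
      (auto simp: of_nat_diff algebra_simps)
  have \<kappa>: "\<theta> d * s = r"
  proof -
    have "toep d g \<theta> d + g 0 * \<theta> d = g (int d + 1)"
      using \<theta>[of d] by (simp add: toep_Suc)
    moreover have "toep d g \<theta> d = toep d g (\<lambda>i. \<phi> i - \<theta> d * \<psi> i) d"
      by (rule toep_cong) (rule rec)
    ultimately have "toep d g \<phi> d - \<theta> d * toep d g \<psi> d + g 0 * \<theta> d = g (int d + 1)"
      unfolding toep_diff toep_scale by simp
    moreover have "toep d g \<phi> d = (\<Sum>j<d. g (int j + 1) * \<psi> j)" "toep d g \<psi> d = (\<Sum>j<d. g (int j + 1) * \<phi> j)"
      unfolding toep_def using rev1 rev2 by auto
    ultimately show ?thesis by (simp add: s_def r_def algebra_simps)
  qed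
  have form: "0 < s + e * r" if e: "e = 1 \<or> e = -1" for e :: real
  proof -
    \<comment> \<open>the forward residual filter plus or minus the backward one, according to the sign \<open>e\<close>\<close>
    define v where "v i = (if i = 0 then 1 else if i = Suc d then e else - \<phi> (i - 1) - e * \<psi> (i - 1))" for i
    have row: "toep (Suc (Suc d)) g v i
        = g (int i) - (\<Sum>j<d. g (int i - int j - 1) * \<phi> j) - e * (\<Sum>j<d. g (int i - int j - 1) * \<psi> j)
          + g (int i - int d - 1) * e" for i
      unfolding toep_Suc[of "Suc d"] toep_shift[of d]
      by (simp add: v_def algebra_simps sum_distrib_left sum_subtractf sum.distrib sum_negf)
    have mid: "toep (Suc (Suc d)) g v (Suc i) = 0" if "i < d" for i
    proof -
      have "toep (Suc (Suc d)) g v (Suc i) = g (int i + 1) - toep d g \<phi> i - e * toep d g \<psi> i + g (int i - int d) * e"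
        unfolding row by (simp add: toep_def algebra_simps)
      moreover have "g (int i - int d) = g (int d - int i)"
        using even[of "int i - int d"] by simp
      ultimately show ?thesis
        using \<phi>[OF that] \<psi>[OF that] by simp
    qed
    have neg: "g (- int j - 1) = g (int j + 1)" for j
      using even[of "int j + 1"] by simp
    have first: "toep (Suc (Suc d)) g v 0 = s + e * r"
      unfolding row by (simp add: s_def r_def neg algebra_simps)
    have last: "toep (Suc (Suc d)) g v (Suc d) = e * (s + e * r)"
    proof -
      have "toep (Suc (Suc d)) g v (Suc d) = g (int d + 1) - (\<Sum>j<d. g (int d - int j) * \<phi> j)
         - e * (\<Sum>j<d. g (int d - int j) * \<psi> j) + g 0 * e"
        unfolding row by (simp add: algebra_simps)
      then show ?thesis
        unfolding rev1 rev2 using e by (auto simp: s_def r_def algebra_simps)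
    qed
    have "toep_form (Suc (Suc d)) g v = v 0 * toep (Suc (Suc d)) g v 0 + (\<Sum>i<d. v (Suc i) * toep (Suc (Suc d)) g v (Suc i))
       + v (Suc d) * toep (Suc (Suc d)) g v (Suc d)"
      unfolding toep_form_def by (subst sum.lessThan_Suc, subst sum.lessThan_Suc_shift) simp
    also have "\<dots> = 2 * (s + e * r)"
      using e by (auto simp: mid first last v_def)
    finally have "toep_form (Suc (Suc d)) g v = 2 * (s + e * r)" .
    moreover have "0 < toep_form (Suc (Suc d)) g v"
      by (rule pos[unfolded toep_pos_def, rule_format]) (auto simp: v_def intro!: exI[of _ 0])
    ultimately show ?thesis by simp
  qed
  have "0 < s" "\<bar>r\<bar> \<le> s"
    using form[of 1] form[of "-1"] by auto
  then have "\<bar>\<theta> d\<bar> * s \<le> 1 * s"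
    using \<kappa> by (metis abs_mult abs_of_pos mult_1)
  then show "\<bar>\<theta> d\<bar> \<le> 1"
    using \<open>0 < s\<close> by (simp only: mult_le_cancel_right_pos)
qed

text \<open>Each step of the recursion at most doubles the sum of the moduli of the coefficients \<open>1\<close>,
  \<open>- \<theta> 0\<close>, \<open>- \<theta> 1\<close>, and so on, of the prediction error filter.\<close>

lemma toep_solution_sum_bound:
  assumes even: "\<And>l. g (- l) = g l" and pos: "toep_pos (Suc d) g"
    and \<theta>: "\<And>i. i < d \<Longrightarrow> toep d g \<theta> i = g (int i + 1)"
  shows "(\<Sum>i<d. \<bar>\<theta> i\<bar>) \<le> 2 ^ d - 1"
  using pos \<theta>
proof (induction d arbitrary: \<theta>)
  case 0
  then show ?case by simp
next
  case (Suc d)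
  have pos_d: "toep_pos d g" and pos_Sd: "toep_pos (Suc d) g"
    using toep_pos_mono[OF Suc.prems(1)] by auto
  obtain \<phi> where \<phi>: "\<And>i. i < d \<Longrightarrow> toep d g \<phi> i = g (int i + 1)"
    using toep_pos_solvable[OF pos_d, of "\<lambda>i. g (int i + 1)"] by auto
  have IH: "(\<Sum>i<d. \<bar>\<phi> i\<bar>) \<le> 2 ^ d - 1"
    using Suc.IH[OF pos_Sd \<phi>] by blast
  note step = levinson_step[OF even Suc.prems(1) Suc.prems(2) \<phi>, simplified]
  have "(\<Sum>i<d. \<bar>\<theta> i\<bar>) \<le> (\<Sum>i<d. \<bar>\<phi> i\<bar> + \<bar>\<phi> (d - 1 - i)\<bar>)"
  proof (rule sum_mono)
    fix i assume "i \<in> {..<d}"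
    then have "\<bar>\<theta> i\<bar> \<le> \<bar>\<phi> i\<bar> + \<bar>\<theta> d\<bar> * \<bar>\<phi> (d - 1 - i)\<bar>"
      using step(2)[of i] by (simp add: abs_mult[symmetric])
    also have "\<bar>\<theta> d\<bar> * \<bar>\<phi> (d - 1 - i)\<bar> \<le> 1 * \<bar>\<phi> (d - 1 - i)\<bar>"
      using step(1) by (intro mult_right_mono) auto
    finally show "\<bar>\<theta> i\<bar> \<le> \<bar>\<phi> i\<bar> + \<bar>\<phi> (d - 1 - i)\<bar>" by simp
  qed
  also have "(\<Sum>i<d. \<bar>\<phi> (d - 1 - i)\<bar>) = (\<Sum>i<d. \<bar>\<phi> i\<bar>)"
    by (rule sum.reindex_bij_witness[of _ "\<lambda>j. d - 1 - j" "\<lambda>j. d - 1 - j"]) auto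
  then have "(\<Sum>i<d. \<bar>\<phi> i\<bar> + \<bar>\<phi> (d - 1 - i)\<bar>) = 2 * (\<Sum>i<d. \<bar>\<phi> i\<bar>)"
    by (simp add: sum.distrib)
  finally show ?case
    using IH step(1) by simp
qed

section \<open>Positivity of the empirical covariances\<close>

text \<open>The form at \<open>x\<close> is the squared norm of the convolution of \<open>x\<close> and \<open>Y\<close>. It is positive since
  a convolution of nonzero finite sequences has a nonzero extreme entry.\<close>

lemma autocov_toep_pos:
  fixes Y :: "int \<Rightarrow> real"
  assumes supp: "\<And>t. t \<notin> {1..int M} \<Longrightarrow> Y t = 0" and ne: "Y t0 \<noteq> 0"
  shows "toep_pos d (\<lambda>l. \<Sum>t\<in>{1..int M}. Y t * Y (t - l))"
  unfolding toep_pos_def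
proof (intro allI impI)
  fix x :: "nat \<Rightarrow> real"
  assume x: "\<exists>i<d. x i \<noteq> 0"
  let ?S = "{1 - int d..int M}"
  have shift: "(\<Sum>t\<in>{1..int M}. Y t * Y (t - (int i - int j))) = (\<Sum>s\<in>?S. Y (s + int i) * Y (s + int j))"
    if "i < d" for i j
  proof -
    have "(\<Sum>t\<in>{1..int M}. Y t * Y (t - (int i - int j))) = (\<Sum>s\<in>{1 - int i..int M - int i}. Y (s + int i) * Y (s + int j))"
      by (rule sum.reindex_bij_witness[of _ "\<lambda>s. s + int i" "\<lambda>t. t - int i"]) (auto simp: algebra_simps)
    also have "\<dots> = (\<Sum>s\<in>?S. Y (s + int i) * Y (s + int j))"
      using that by (intro sum.mono_neutral_left) (auto simp: supp)
    finally show ?thesis .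
  qed
  have "toep_form d (\<lambda>l. \<Sum>t\<in>{1..int M}. Y t * Y (t - l)) x
     = (\<Sum>i<d. \<Sum>j<d. \<Sum>s\<in>?S. (x i * Y (s + int i)) * (x j * Y (s + int j)))"
    unfolding toep_form_def toep_def sum_distrib_left
  proof (intro sum.cong refl)
    fix i j assume "i \<in> {..<d}"
    then show "x i * ((\<Sum>t\<in>{1..int M}. Y t * Y (t - (int i - int j))) * x j)
        = (\<Sum>s\<in>?S. (x i * Y (s + int i)) * (x j * Y (s + int j)))"
      by (subst shift) (simp_all add: sum_distrib_left sum_distrib_right algebra_simps)
  qed
  also have "\<dots> = (\<Sum>i<d. \<Sum>s\<in>?S. \<Sum>j<d. (x i * Y (s + int i)) * (x j * Y (s + int j)))"
    by (rule sum.cong[OF refl]) (rule sum.swap)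
  also have "\<dots> = (\<Sum>s\<in>?S. \<Sum>i<d. \<Sum>j<d. (x i * Y (s + int i)) * (x j * Y (s + int j)))"
    by (rule sum.swap)
  also have "\<dots> = (\<Sum>s\<in>?S. (\<Sum>i<d. x i * Y (s + int i))\<^sup>2)"
    by (simp add: power2_eq_square sum_product)
  finally have form: "toep_form d (\<lambda>l. \<Sum>t\<in>{1..int M}. Y t * Y (t - l)) x = (\<Sum>s\<in>?S. (\<Sum>i<d. x i * Y (s + int i))\<^sup>2)" .
  \<comment> \<open>at \<open>t1 - i0\<close> the convolution consists of the single term that pairs the first nonzero entry of
      \<open>x\<close> with the last one of \<open>Y\<close>\<close>
  define i0 where "i0 = (LEAST i. x i \<noteq> 0)"
  define t1 where "t1 = Max {t \<in> {1..int M}. Y t \<noteq> 0}"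
  have fin: "finite {t \<in> {1..int M}. Y t \<noteq> 0}"
    by (rule finite_subset[of _ "{1..int M}"]) auto
  have t0: "{t \<in> {1..int M}. Y t \<noteq> 0} \<noteq> {}"
    using ne supp[of t0] by auto
  have t1: "t1 \<in> {1..int M}" "Y t1 \<noteq> 0"
    using Max_in[OF fin t0] unfolding t1_def by auto
  have above: "Y t = 0" if "t1 < t" for t
  proof (rule ccontr)
    assume "Y t \<noteq> 0"
    then have "t \<in> {t \<in> {1..int M}. Y t \<noteq> 0}" using supp by auto
    then show False using that Max_ge[OF fin, of t] unfolding t1_def by linarith
  qed
  obtain i where i: "i < d" "x i \<noteq> 0" using x by blast
  have i0: "x i0 \<noteq> 0"
    unfolding i0_def by (rule LeastI[of "\<lambda>i. x i \<noteq> 0", OF i(2)])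
  have "i0 \<le> i"
    unfolding i0_def by (rule Least_le[of "\<lambda>i. x i \<noteq> 0", OF i(2)])
  then have i0_less: "i0 < d"
    using i(1) by simp
  have below: "x i = 0" if "i < i0" for i
    using not_less_Least[of i "\<lambda>i. x i \<noteq> 0"] that unfolding i0_def by simp
  have "(\<Sum>i<d. x i * Y (t1 - int i0 + int i)) = (\<Sum>i\<in>{i0}. x i * Y (t1 - int i0 + int i))"
  proof (rule sum.mono_neutral_right)
    show "\<forall>i\<in>{..<d} - {i0}. x i * Y (t1 - int i0 + int i) = 0"
    proof
      fix i assume "i \<in> {..<d} - {i0}"
      then consider "i < i0" | "i0 < i" by fastforce
      then show "x i * Y (t1 - int i0 + int i) = 0"
        by cases (simp_all add: below above)
    qed
  qed (use i0_less in auto)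
  then have "(\<Sum>i<d. x i * Y (t1 - int i0 + int i)) \<noteq> 0"
    using i0 t1(2) by simp
  then have "0 < (\<Sum>i<d. x i * Y (t1 - int i0 + int i))\<^sup>2"
    by simp
  then show "0 < toep_form d (\<lambda>l. \<Sum>t\<in>{1..int M}. Y t * Y (t - l)) x"
    unfolding form using i0_less t1(1) by (intro sum_pos2[of _ "t1 - int i0"]) simp_all
qed

lemma autocov_even:
  fixes Y :: "int \<Rightarrow> real"
  assumes supp: "\<And>t. t \<notin> {1..int M} \<Longrightarrow> Y t = 0"
  shows "(\<Sum>t\<in>{1..int M}. Y t * Y (t - (- l))) = (\<Sum>t\<in>{1..int M}. Y t * Y (t - l))"
proof -
  have "(\<Sum>t\<in>{1..int M}. Y t * Y (t - (- l))) = (\<Sum>t\<in>{t \<in> {1..int M}. t + l \<in> {1..int M}}. Y t * Y (t + l))"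
    using supp by (intro sum.mono_neutral_cong_right) auto
  also have "\<dots> = (\<Sum>t\<in>{t \<in> {1..int M}. t - l \<in> {1..int M}}. Y t * Y (t - l))"
    by (rule sum.reindex_bij_witness[of _ "\<lambda>t. t - l" "\<lambda>t. t + l"]) auto
  also have "\<dots> = (\<Sum>t\<in>{1..int M}. Y t * Y (t - l))"
    using supp by (intro sum.mono_neutral_cong_left) auto
  finally show ?thesis .
qed

lemma sum_lag_pairs:
  fixes F :: "int \<Rightarrow> int \<Rightarrow> 'a::comm_monoid_add"
  shows "(\<Sum>(t\<^sub>1, t\<^sub>2)\<in>{(t\<^sub>1, t\<^sub>2). t\<^sub>1 \<in> {1..M} \<and> t\<^sub>2 \<in> {1..M} \<and> int t\<^sub>1 - int t\<^sub>2 = l}. F (int t\<^sub>1) (int t\<^sub>2))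
     = (\<Sum>t\<in>{t \<in> {1..int M}. t - l \<in> {1..int M}}. F t (t - l))"
  by (rule sum.reindex_bij_witness[of _ "\<lambda>t. (nat t, nat (t - l))" "\<lambda>(t\<^sub>1, t\<^sub>2). int t\<^sub>1"])
    (auto simp: nat_diff_distrib)

text \<open>Extension by zero turns the sum over pairs of grid points at a given lag into a sum over one index
  running through the whole block.\<close>

definition grid :: "(real \<Rightarrow> real) \<Rightarrow> nat \<Rightarrow> int \<Rightarrow> real" where
  "grid h M t = (if t \<in> {1..int M} then h (real_of_int t / real M) else 0)"

lemma taper_mass_grid: "taper_mass h M = (\<Sum>t\<in>{1..int M}. (grid h M t)\<^sup>2)"
  unfolding taper_mass_def
  by (rule sum.reindex_bij_witness[of _ nat int]) (auto simp: grid_def)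

lemma emp_cov_grid:
  "emp_cov h X T M u l \<omega> = (\<Sum>t\<in>{1..int M}. grid h M t * grid h M (t - l) *
     (X (\<lfloor>u * real T\<rfloor> + t - int (M div 2)) T \<omega> * X (\<lfloor>u * real T\<rfloor> + (t - l) - int (M div 2)) T \<omega>)) / taper_mass h M"
proof (cases "taper_mass h M = 0")
  case True
  then show ?thesis by (simp add: emp_cov_def)
next
  case False
  let ?F = "\<lambda>t s. h (real_of_int t / real M) * h (real_of_int s / real M) *
     X (\<lfloor>u * real T\<rfloor> + t - int (M div 2)) T \<omega> * X (\<lfloor>u * real T\<rfloor> + s - int (M div 2)) T \<omega>"
  have "taper_mass h M * emp_cov h X T M u l \<omega> = (\<Sum>t\<in>{t \<in> {1..int M}. t - l \<in> {1..int M}}. ?F t (t - l))"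
    using False sum_lag_pairs[of ?F M l] by (simp add: emp_cov_def)
  also have "\<dots> = (\<Sum>t\<in>{1..int M}. grid h M t * grid h M (t - l) *
     (X (\<lfloor>u * real T\<rfloor> + t - int (M div 2)) T \<omega> * X (\<lfloor>u * real T\<rfloor> + (t - l) - int (M div 2)) T \<omega>))"
    by (intro sum.mono_neutral_cong_left) (auto simp: grid_def)
  finally show ?thesis using False by (simp add: field_simps)
qed

lemma toep_form_divide: "toep_form d (\<lambda>l. g l / c) x = toep_form d g x / c"
  unfolding toep_form_def toep_def sum_divide_distrib sum_distrib_left by simp

lemma emp_cov_even_and_zero_or_pos:
  shows "emp_cov h X T M u (- l) \<omega> = emp_cov h X T M u l \<omega>"
    and "(\<forall>l. emp_cov h X T M u l \<omega> = 0) \<or> (\<forall>d. toep_pos d (\<lambda>l. emp_cov h X T M u l \<omega>))"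
proof -
  define Y where "Y t = grid h M t * X (\<lfloor>u * real T\<rfloor> + t - int (M div 2)) T \<omega>" for t
  have supp: "Y t = 0" if "t \<notin> {1..int M}" for t
    using that by (auto simp: Y_def grid_def)
  have eq: "emp_cov h X T M u l \<omega> = (\<Sum>t\<in>{1..int M}. Y t * Y (t - l)) / taper_mass h M" for l
    unfolding emp_cov_grid Y_def by (simp add: algebra_simps)
  show "emp_cov h X T M u (- l) \<omega> = emp_cov h X T M u l \<omega>"
    unfolding eq using autocov_even[of M Y l] supp by simp
  show "(\<forall>l. emp_cov h X T M u l \<omega> = 0) \<or> (\<forall>d. toep_pos d (\<lambda>l. emp_cov h X T M u l \<omega>))"
  proof (cases "taper_mass h M = 0 \<or> (\<forall>t. Y t = 0)")
    case True
    then show ?thesis by (auto simp: eq)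
  next
    case False
    then obtain t0 where t0: "Y t0 \<noteq> 0" by blast
    have H: "0 < taper_mass h M"
      using False by (auto simp: taper_mass_def less_le intro!: sum_nonneg)
    have "toep_pos d (\<lambda>l. emp_cov h X T M u l \<omega>)" for d
      unfolding toep_pos_def
    proof (intro allI impI)
      fix x :: "nat \<Rightarrow> real" assume "\<exists>i<d. x i \<noteq> 0"
      then have "0 < toep_form d (\<lambda>l. \<Sum>t\<in>{1..int M}. Y t * Y (t - l)) x / taper_mass h M"
        using autocov_toep_pos[of M Y t0 d, OF supp t0] H by (simp add: toep_pos_def)
      also have "\<dots> = toep_form d (\<lambda>l. emp_cov h X T M u l \<omega>) x"
        unfolding eq by (rule toep_form_divide[symmetric])
      finally show "0 < toep_form d (\<lambda>l. emp_cov h X T M u l \<omega>) x" .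
    qed
    then show ?thesis by (intro disjI2 allI)
  qed
qed

text \<open>If the tapered block vanishes, the covariance matrix is singular, and the estimator, which then is
  zero, solves equations with vanishing right-hand side. So the normal equations hold in every case.\<close>

lemma
  fixes h X T M t \<omega>
  defines "g \<equiv> \<lambda>l. emp_cov h X T M (real_of_int t / real T) l \<omega>"
  assumes "i < d"
  shows pred_estimator_normal_eq: "toep d g (\<lambda>j. pred_estimator d h X t T M \<omega> $ j) i = g (int i + 1)"
    and pred_estimator_bound: "\<bar>pred_estimator d h X t T M \<omega> $ i\<bar> \<le> 2 ^ d"
proof -
  have *: "toep d g (\<lambda>j. pred_estimator d h X t T M \<omega> $ j) i = g (int i + 1)
    \<and> \<bar>pred_estimator d h X t T M \<omega> $ i\<bar> \<le> 2 ^ d"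
  proof (cases "\<forall>l. g l = 0")
    case True
    then have g0: "g = (\<lambda>l. 0)" by (intro ext) simp
    have "pred_estimator d h X t T M \<omega> = yule_walker d g"
      by (simp only: pred_estimator_def g_def)
    then have "pred_estimator d h X t T M \<omega> $ i = 0"
      using yule_walker_zero[OF assms(2)] g0 by (simp only:)
    then show ?thesis
      unfolding g0 by (simp add: toep_def)
  next
    case False
    then have pos: "toep_pos n g" for n
      using emp_cov_even_and_zero_or_pos(2)[of h X T M "real_of_int t / real T" \<omega>]
      by (auto simp: g_def)
    have eq: "toep d g (\<lambda>j. pred_estimator d h X t T M \<omega> $ j) i = g (int i + 1)" if "i < d" for i
      using toep_yule_walker[OF pos that] unfolding pred_estimator_def g_def .
    have sum: "(\<Sum>i<d. \<bar>pred_estimator d h X t T M \<omega> $ i\<bar>) \<le> 2 ^ d - 1"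
    proof (rule toep_solution_sum_bound[of g])
      show "g (- l) = g l" for l
        unfolding g_def by (rule emp_cov_even_and_zero_or_pos(1))
    qed (fact pos eq)+
    have "\<bar>pred_estimator d h X t T M \<omega> $ i\<bar> \<le> (\<Sum>i<d. \<bar>pred_estimator d h X t T M \<omega> $ i\<bar>)"
      using assms(2) by (intro member_le_sum[of i]) simp_all
    also note sum
    also have "2 ^ d - 1 \<le> (2 ^ d :: real)" by simp
    finally have "\<bar>pred_estimator d h X t T M \<omega> $ i\<bar> \<le> 2 ^ d" .
    then show ?thesis using eq[OF assms(2)] by (intro conjI)
  qed
  then show "toep d g (\<lambda>j. pred_estimator d h X t T M \<omega> $ j) i = g (int i + 1)"
    and "\<bar>pred_estimator d h X t T M \<omega> $ i\<bar> \<le> 2 ^ d" by auto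
qed

section \<open>Tapers as functions of bounded variation\<close>

text \<open>On \<open>(0, 1]\<close>, the union of the pieces, a taper is controlled by its derivative and its knots. Extended by
  zero, it has the end points \<open>0\<close> and \<open>1\<close> as further jumps; the value at \<open>0\<close> belongs to no piece and is
  replaced by \<open>0\<close>, which changes neither integrals nor sums over the grid.\<close>

definition taper_ext :: "(real \<Rightarrow> real) \<Rightarrow> real \<Rightarrow> real" where
  "taper_ext h x = (if 0 < x \<and> x \<le> 1 then h x else 0)"

definition jump_count :: "nat \<Rightarrow> (nat \<Rightarrow> real) \<Rightarrow> real \<Rightarrow> nat" where
  "jump_count N s x = card {i \<in> {0..N}. s i < x}"

text \<open>An increasing function whose increments dominate the oscillation of the extended taper. In place
  of the actual jumps it uses their upper bound \<open>2 \<parallel>h\<parallel>\<close>.\<close>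

definition taper_variation :: "nat \<Rightarrow> (nat \<Rightarrow> real) \<Rightarrow> (real \<Rightarrow> real) \<Rightarrow> real \<Rightarrow> real" where
  "taper_variation N s h x =
     taper_deriv_norm N s h * max 0 (min 1 x) + 2 * taper_norm h * real (jump_count N s x)"

definition variation_bound :: "nat \<Rightarrow> real \<Rightarrow> real \<Rightarrow> real" where
  "variation_bound N b b' = b' + 2 * b * (real N + 1)"

lemma taper_abs_le:
  assumes "taper N s h" "x \<in> {0..1}"
  shows "\<bar>h x\<bar> \<le> taper_norm h"
  using assms unfolding taper_norm_def taper_def by (intro cSUP_upper) auto

lemma taper_norm_nonneg:
  assumes "taper N s h"
  shows "0 \<le> taper_norm h"
  using taper_abs_le[OF assms, of 0] by simp

lemma taper_ext_abs_le:
  assumes "taper N s h"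
  shows "\<bar>taper_ext h x\<bar> \<le> taper_norm h"
  using taper_abs_le[OF assms, of x] taper_norm_nonneg[OF assms] by (auto simp: taper_ext_def)

lemma taper_deriv_bound:
  assumes t: "taper N s h" and i: "i \<in> {1..N}" and x: "x \<in> {s (i - 1)<..s i}"
  shows "\<bar>vector_derivative h (at x within {s (i - 1)<..s i})\<bar> \<le> taper_deriv_norm N s h"
proof -
  have "\<bar>vector_derivative h (at x within {s (i - 1)<..s i})\<bar>
     \<le> (SUP x\<in>{s (i - 1)<..s i}. \<bar>vector_derivative h (at x within {s (i - 1)<..s i})\<bar>)"
    using t i x unfolding taper_def by (intro cSUP_upper) auto
  also have "\<dots> \<le> taper_deriv_norm N s h"
    unfolding taper_deriv_norm_def using i by (intro Max_ge) auto
  finally show ?thesis .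
qed

lemma taper_knots:
  assumes "taper N s h"
  shows "1 \<le> N" "s 0 = 0" "s N = 1" "i < j \<Longrightarrow> j \<le> N \<Longrightarrow> s i < s j"
  using assms by (auto simp: taper_def strict_mono_on_def)

lemma taper_deriv_norm_nonneg:
  assumes "taper N s h"
  shows "0 \<le> taper_deriv_norm N s h"
proof -
  have "s 1 \<in> {s (1 - 1)<..s 1}"
    using taper_knots(4)[OF assms, of 0 1] taper_knots(1)[OF assms] by simp
  from taper_deriv_bound[OF assms _ this] taper_knots(1)[OF assms] show ?thesis
    by force
qed

lemma taper_piece_lipschitz:
  assumes t: "taper N s h" and i: "i \<in> {1..N}"
    and x: "x \<in> {s (i - 1)<..s i}" and y: "y \<in> {s (i - 1)<..s i}"
  shows "\<bar>h x - h y\<bar> \<le> taper_deriv_norm N s h * \<bar>x - y\<bar>"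
proof -
  let ?S = "{s (i - 1)<..s i}"
  obtain h' where h': "\<And>x. x \<in> ?S \<Longrightarrow> (h has_real_derivative h' x) (at x within ?S)"
    using t i unfolding taper_def by meson
  have lt: "s (i - 1) < s i"
    using x by simp
  have "\<bar>h' z\<bar> \<le> taper_deriv_norm N s h" if z: "z \<in> ?S" for z
  proof -
    have "s i \<in> ?S" "(s i + s (i - 1)) / 2 \<in> ?S" "s i \<noteq> (s i + s (i - 1)) / 2"
      using lt by auto
    then have "\<not> (\<exists>c. ?S = {c})"
      by (metis singletonD)
    then have "z islimpt ?S"
      using z by (intro connected_imp_perfect) auto
    then have "at z within ?S \<noteq> bot"
      by (simp add: trivial_limit_within)
    then have "vector_derivative h (at z within ?S) = h' z"
      using h'[OF z] by (intro vector_derivative_within)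
        (simp_all add: has_real_derivative_iff_has_vector_derivative)
    then show ?thesis
      using taper_deriv_bound[OF t i z] by simp
  qed
  then have "norm (h x - h y) \<le> taper_deriv_norm N s h * norm (x - y)"
    using h' x y by (intro field_differentiable_bound[of ?S h h']) auto
  then show ?thesis by simp
qed

lemma jump_count_mono: "x \<le> y \<Longrightarrow> jump_count N s x \<le> jump_count N s y"
  unfolding jump_count_def by (intro card_mono) auto

lemma taper_variation_mono:
  assumes "taper N s h" "x \<le> y"
  shows "taper_variation N s h x \<le> taper_variation N s h y"
  unfolding taper_variation_def
  using jump_count_mono[OF assms(2), of N s] taper_norm_nonneg[OF assms(1)] taper_deriv_norm_nonneg[OF assms(1)] assms(2)
  by (intro add_mono mult_left_mono) auto

lemma taper_variation_range:
  assumes "taper N s h"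
  shows "0 \<le> taper_variation N s h x"
    and "taper_variation N s h x \<le> variation_bound N (taper_norm h) (taper_deriv_norm N s h)"
proof -
  have "jump_count N s x \<le> card {0..N}"
    unfolding jump_count_def by (intro card_mono) auto
  then have j: "real (jump_count N s x) \<le> real N + 1" by simp
  note nn = taper_norm_nonneg[OF assms] taper_deriv_norm_nonneg[OF assms]
  show "0 \<le> taper_variation N s h x"
    unfolding taper_variation_def using nn by simp
  have "taper_deriv_norm N s h * max 0 (min 1 x) \<le> taper_deriv_norm N s h * 1"
    using nn by (intro mult_left_mono) auto
  moreover have "2 * taper_norm h * real (jump_count N s x) \<le> 2 * taper_norm h * (real N + 1)"
    using nn j by (intro mult_left_mono) auto
  ultimately show "taper_variation N s h x \<le> variation_bound N (taper_norm h) (taper_deriv_norm N s h)"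
    unfolding taper_variation_def variation_bound_def by linarith
qed

text \<open>Either a knot separates \<open>x\<close> from \<open>y\<close>, and then the jump part of the variation already exceeds
  the oscillation \<open>2 \<parallel>h\<parallel>\<close>, or both points lie in one piece, where the taper is Lipschitz, or on the same
  side of \<open>(0, 1]\<close>, where the extension is zero.\<close>

lemma taper_ext_variation:
  assumes t: "taper N s h" and xy: "x \<le> y"
  shows "\<bar>taper_ext h x - taper_ext h y\<bar> \<le> taper_variation N s h y - taper_variation N s h x"
proof (cases "\<exists>i\<in>{0..N}. x \<le> s i \<and> s i < y")
  case True
  then obtain i where i: "i \<in> {0..N}" "x \<le> s i" "s i < y" by blast
  have "jump_count N s x < jump_count N s y"
    unfolding jump_count_def
  proof (rule psubset_card_mono)
    have "i \<in> {i \<in> {0..N}. s i < y} - {i \<in> {0..N}. s i < x}" using i by simp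
    then show "{i \<in> {0..N}. s i < x} \<subset> {i \<in> {0..N}. s i < y}" using xy by fastforce
  qed simp
  then have j: "real (jump_count N s x) + 1 \<le> real (jump_count N s y)" by linarith
  have "\<bar>taper_ext h x - taper_ext h y\<bar> \<le> 2 * taper_norm h * 1"
    using taper_ext_abs_le[OF t, of x] taper_ext_abs_le[OF t, of y] by linarith
  also have "\<dots> \<le> 2 * taper_norm h * (real (jump_count N s y) - real (jump_count N s x))"
    using j taper_norm_nonneg[OF t] by (intro mult_left_mono) auto
  also have "\<dots> \<le> \<dots> + taper_deriv_norm N s h * (max 0 (min 1 y) - max 0 (min 1 x))"
    using taper_deriv_norm_nonneg[OF t] xy by auto
  finally show ?thesis
    unfolding taper_variation_def by (simp add: algebra_simps)
next
  case False
  then have none: "s i < x \<or> y \<le> s i" if "i \<le> N" for i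
    using that by (force simp: not_le not_less)
  show ?thesis
  proof (cases "0 < x \<and> y \<le> 1")
    case False
    then have "y \<le> 0 \<or> 1 < x"
      using none[of 0] none[of N] taper_knots(2,3)[OF t] by force
    then have "taper_ext h x = taper_ext h y"
      using xy by (auto simp: taper_ext_def)
    then show ?thesis
      using taper_variation_mono[OF t xy] by simp
  next
    case True
    \<comment> \<open>the index of the piece containing \<open>x\<close>, which also contains \<open>y\<close>\<close>
    define i where "i = (LEAST i. x \<le> s i)"
    have "x \<le> s N" using True xy taper_knots(3)[OF t] by simp
    then have i: "x \<le> s i" "i \<le> N"
      unfolding i_def by (rule LeastI[of "\<lambda>i. x \<le> s i"], rule Least_le[of "\<lambda>i. x \<le> s i"])
    have i0: "i \<noteq> 0"
      using i(1) True taper_knots(2)[OF t] by (metis not_le)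
    then have prev: "s (i - 1) < x"
      using not_less_Least[of "i - 1" "\<lambda>i. x \<le> s i"] unfolding i_def[symmetric] by (simp add: not_le)
    have "y \<le> s i"
      using none[OF i(2)] i(1) by simp
    then have "\<bar>h x - h y\<bar> \<le> taper_deriv_norm N s h * \<bar>x - y\<bar>"
      using i i0 prev xy by (intro taper_piece_lipschitz[OF t, of i]) auto
    also have "\<dots> = taper_deriv_norm N s h * (max 0 (min 1 y) - max 0 (min 1 x))"
      using True xy by (simp add: max_def min_def)
    also have "\<dots> \<le> \<dots> + 2 * taper_norm h * (real (jump_count N s y) - real (jump_count N s x))"
      using jump_count_mono[OF xy, of N s] taper_norm_nonneg[OF t] by simp
    finally have "\<bar>h x - h y\<bar> \<le> taper_variation N s h y - taper_variation N s h x"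
      unfolding taper_variation_def by (simp add: algebra_simps)
    then show ?thesis
      using True xy by (simp add: taper_ext_def)
  qed
qed

section \<open>Riemann sums and lagged sums\<close>

text \<open>A difference at lag \<open>n\<close> is a sum of \<open>n\<close> differences at lag one, and each of these sums telescopes.\<close>

lemma sum_lag_variation_le:
  fixes V :: "int \<Rightarrow> real"
  assumes range: "\<And>n. 0 \<le> V n" "\<And>n. V n \<le> W"
  shows "(\<Sum>t\<in>{1..int M}. V (t + c + int n) - V (t + c)) \<le> real n * W"
proof (induction n)
  case 0
  then show ?case by simp
next
  case (Suc n)
  have tele: "(\<Sum>t\<in>{1..int M}. V (t + a + 1) - V (t + a)) = V (int M + a + 1) - V (a + 1)" for a
  proof (induction M)
    case 0
    then show ?case by simp
  next
    case (Suc M)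
    have "{1..int (Suc M)} = insert (int M + 1) {1..int M}" by auto
    then show ?case using Suc by (simp add: algebra_simps)
  qed
  have "(\<Sum>t\<in>{1..int M}. V (t + c + int (Suc n)) - V (t + c))
     = (\<Sum>t\<in>{1..int M}. V (t + c + int n) - V (t + c))
       + (\<Sum>t\<in>{1..int M}. V (t + (c + int n) + 1) - V (t + (c + int n)))"
    by (simp add: sum.distrib[symmetric] algebra_simps)
  also have "\<dots> \<le> real n * W + W"
    unfolding tele using Suc range(2)[of "int M + (c + int n) + 1"] range(1)[of "c + int n + 1"]
    by (intro add_mono) simp_all
  finally show ?case by (simp add: algebra_simps)
qed

lemma sum_lag_oscillation_le:
  fixes F V :: "int \<Rightarrow> real"
  assumes dom: "\<And>m n. m \<le> n \<Longrightarrow> \<bar>F m - F n\<bar> \<le> V n - V m"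
    and range: "\<And>n. 0 \<le> V n" "\<And>n. V n \<le> W"
  shows "(\<Sum>t\<in>{1..int M}. \<bar>F (t - l) - F t\<bar>) \<le> real_of_int \<bar>l\<bar> * W"
proof (cases "0 \<le> l")
  case True
  have "(\<Sum>t\<in>{1..int M}. \<bar>F (t - l) - F t\<bar>) \<le> (\<Sum>t\<in>{1..int M}. V (t + (- l) + int (nat l)) - V (t + (- l)))"
    using True dom[of "_ - l" _] by (intro sum_mono) simp
  also have "\<dots> \<le> real (nat l) * W"
    by (rule sum_lag_variation_le[OF range])
  finally show ?thesis using True by simp
next
  case False
  have "(\<Sum>t\<in>{1..int M}. \<bar>F (t - l) - F t\<bar>) \<le> (\<Sum>t\<in>{1..int M}. V (t + 0 + int (nat (- l))) - V (t + 0))"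
  proof (rule sum_mono)
    fix t
    have "\<bar>F t - F (t - l)\<bar> \<le> V (t - l) - V t"
      using False by (intro dom) simp
    then show "\<bar>F (t - l) - F t\<bar> \<le> V (t + 0 + int (nat (- l))) - V (t + 0)"
      using False by (simp add: abs_minus_commute)
  qed
  also have "\<dots> \<le> real (nat (- l)) * W"
    by (rule sum_lag_variation_le[OF range])
  finally show ?thesis using False by simp
qed

text \<open>On a grid interval the error is at most its length times the increment of \<open>V\<close>, and the increments
  telescope. In contrast to a bound by the derivative, this admits jumps.\<close>

lemma riemann_sum_error:
  fixes F V :: "real \<Rightarrow> real"
  assumes int: "F integrable_on {0..1}" and M: "0 < M"
    and dom: "\<And>x y. 0 \<le> x \<Longrightarrow> x \<le> y \<Longrightarrow> y \<le> 1 \<Longrightarrow> \<bar>F x - F y\<bar> \<le> V y - V x"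
  shows "\<bar>integral {0..1} F - (\<Sum>t\<in>{1..int M}. F (real_of_int t / real M)) / real M\<bar> \<le> (V 1 - V 0) / real M"
proof -
  have ind: "\<bar>integral {0..real n / real M} F - (\<Sum>t\<in>{1..int n}. F (real_of_int t / real M)) / real M\<bar>
      \<le> (V (real n / real M) - V 0) / real M" if "n \<le> M" for n
    using that
  proof (induction n)
    case 0
    then show ?case by simp
  next
    case (Suc n)
    define a where "a = real n / real M"
    define b where "b = real (Suc n) / real M"
    have ab: "0 \<le> a" "a \<le> b" "b \<le> 1" "b - a = 1 / real M"
      using Suc.prems M by (auto simp: a_def b_def field_simps)
    have i1: "F integrable_on {0..b}" and i2: "F integrable_on {a..b}"
      using ab by (auto intro: integrable_on_subinterval[OF int])
    have comb: "integral {0..b} F = integral {0..a} F + integral {a..b} F"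
      using Henstock_Kurzweil_Integration.integral_combine[OF ab(1,2) i1] by simp
    have "integral {a..b} F - F b / real M = integral {a..b} (\<lambda>x. F x - F b)"
      using i2 ab by (subst Henstock_Kurzweil_Integration.integral_diff) (auto simp: field_simps)
    also have "\<bar>\<dots>\<bar> \<le> (V b - V a) * (b - a)"
    proof -
      have "norm (integral {a..b} (\<lambda>x. F x - F b)) \<le> integral {a..b} (\<lambda>x. V b - V a)"
      proof (rule integral_norm_bound_integral)
        show "(\<lambda>x. F x - F b) integrable_on {a..b}"
          using i2 by (intro integrable_diff) auto
        fix x assume x: "x \<in> {a..b}"
        then have "\<bar>F x - F b\<bar> \<le> V b - V x"
          using ab by (intro dom) auto
        moreover have "V a \<le> V x"
          using dom[of a x] x ab by auto
        ultimately show "norm (F x - F b) \<le> V b - V a" by simp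
      qed auto
      then show ?thesis using ab by simp
    qed
    finally have step: "\<bar>integral {a..b} F - F b / real M\<bar> \<le> (V b - V a) / real M"
      unfolding ab(4) by simp
    have "{1..int (Suc n)} = insert (int (Suc n)) {1..int n}" by auto
    then have sum: "(\<Sum>t\<in>{1..int (Suc n)}. F (real_of_int t / real M)) = (\<Sum>t\<in>{1..int n}. F (real_of_int t / real M)) + F b"
      by (simp add: b_def)
    have IH: "\<bar>integral {0..a} F - (\<Sum>t\<in>{1..int n}. F (real_of_int t / real M)) / real M\<bar> \<le> (V a - V 0) / real M"
      using Suc by (simp add: a_def)
    have "integral {0..b} F - (\<Sum>t\<in>{1..int (Suc n)}. F (real_of_int t / real M)) / real M
       = (integral {0..a} F - (\<Sum>t\<in>{1..int n}. F (real_of_int t / real M)) / real M) + (integral {a..b} F - F b / real M)"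
      unfolding comb sum by (simp add: add_divide_distrib)
    also have "\<bar>\<dots>\<bar> \<le> (V a - V 0) / real M + (V b - V a) / real M"
      using IH step by (intro order_trans[OF abs_triangle_ineq] add_mono)
    also have "\<dots> = (V b - V 0) / real M"
      by (simp add: diff_divide_distrib)
    finally show ?case by (simp add: b_def)
  qed
  show ?thesis using ind[of M] M by simp
qed

section \<open>Moments of the squared taper\<close>

definition taper_moment :: "(real \<Rightarrow> real) \<Rightarrow> nat \<Rightarrow> real" where
  "taper_moment h j = (LINT x:{0..1}|lborel. (h x)\<^sup>2 * (x - 1 / 2) ^ j)"

text \<open>The discrete counterpart of \<open>taper_moment\<close>. The lag enters only the second factor; it costs a
  variation of the taper per unit of lag.\<close>

definition lagged_moment :: "(real \<Rightarrow> real) \<Rightarrow> nat \<Rightarrow> int \<Rightarrow> nat \<Rightarrow> real" where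
  "lagged_moment h M l j =
     (\<Sum>t\<in>{1..int M}. grid h M t * grid h M (t - l) * (real_of_int t / real M - 1 / 2) ^ j)"

definition moment_error :: "nat \<Rightarrow> nat \<Rightarrow> real \<Rightarrow> real \<Rightarrow> real \<Rightarrow> real" where
  "moment_error N d b b' \<beta> = (real d + 2) * b * variation_bound N b b' + b\<^sup>2 * \<beta>"

lemma taper_sq_integrable:
  assumes "taper N s h"
  shows "integrable lborel (\<lambda>x. indicator {0..1} x * (h x)\<^sup>2)"
proof -
  have "(LINT x|lborel. indicator {0..1} x * (h x)\<^sup>2) = 1"
    using assms by (simp add: taper_def set_lebesgue_integral_def)
  then show ?thesis
    using not_integrable_integral_eq[of lborel "\<lambda>x. indicator {0..1} x * (h x)\<^sup>2"] by fastforce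
qed

lemma half_centred_power_le: "0 \<le> x \<Longrightarrow> x \<le> 1 \<Longrightarrow> \<bar>(x - 1 / 2) ^ j\<bar> \<le> (1 :: real)"
  unfolding power_abs by (intro power_le_one) auto

lemma taper_moment_integrable:
  assumes "taper N s h"
  shows "integrable lborel (\<lambda>x. indicator {0..1} x * ((h x)\<^sup>2 * (x - 1 / 2) ^ j))"
proof (rule Bochner_Integration.integrable_bound[OF taper_sq_integrable[OF assms]])
  have "(\<lambda>x. (indicator {0..1} x * (h x)\<^sup>2) * (x - 1 / 2) ^ j) \<in> borel_measurable lborel"
    by (rule borel_measurable_times[OF borel_measurable_integrable[OF taper_sq_integrable[OF assms]]]) simp
  then show "(\<lambda>x. indicator {0..1} x * ((h x)\<^sup>2 * (x - 1 / 2) ^ j)) \<in> borel_measurable lborel"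
    by (simp add: mult.assoc)
  show "AE x in lborel. norm (indicator {0..1} x * ((h x)\<^sup>2 * (x - 1 / 2) ^ j)) \<le> norm (indicator {0..1} x * (h x)\<^sup>2)"
  proof (intro AE_I2)
    fix x :: real
    show "norm (indicator {0..1} x * ((h x)\<^sup>2 * (x - 1 / 2) ^ j)) \<le> norm (indicator {0..1} x * (h x)\<^sup>2)"
      using mult_left_mono[OF half_centred_power_le[of x j], of "(h x)\<^sup>2"]
      by (cases "x \<in> {0..1}") (simp_all add: abs_mult)
  qed
qed

lemma taper_moment_0:
  assumes "taper N s h"
  shows "taper_moment h 0 = 1"
  using assms by (simp add: taper_def taper_moment_def)

lemma taper_moment_abs_le:
  assumes "taper N s h"
  shows "\<bar>taper_moment h j\<bar> \<le> 1"
proof -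
  have "\<bar>taper_moment h j\<bar> \<le> (LINT x|lborel. \<bar>indicator {0..1} x * ((h x)\<^sup>2 * (x - 1 / 2) ^ j)\<bar>)"
    unfolding taper_moment_def set_lebesgue_integral_def real_scaleR_def by (rule integral_abs_bound)
  also have "\<dots> \<le> (LINT x|lborel. indicator {0..1} x * (h x)\<^sup>2)"
  proof (rule integral_mono)
    show "integrable lborel (\<lambda>x. \<bar>indicator {0..1} x * ((h x)\<^sup>2 * (x - 1 / 2) ^ j)\<bar>)"
      by (intro integrable_abs taper_moment_integrable[OF assms])
    fix x :: real
    show "\<bar>indicator {0..1} x * ((h x)\<^sup>2 * (x - 1 / 2) ^ j)\<bar> \<le> indicator {0..1} x * (h x)\<^sup>2"
      using mult_left_mono[OF half_centred_power_le[of x j], of "(h x)\<^sup>2"]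
      by (cases "x \<in> {0..1}") (simp_all add: abs_mult)
  qed (rule taper_sq_integrable[OF assms])
  also have "\<dots> = 1"
    using assms by (simp add: taper_def set_lebesgue_integral_def)
  finally show ?thesis .
qed

lemma taper_moment_restrict: "taper_moment (restrict h {0..1}) j = taper_moment h j"
  unfolding taper_moment_def set_lebesgue_integral_def
  by (intro Bochner_Integration.integral_cong) (auto simp: indicator_def)

text \<open>For a symmetric taper the integrand is odd about \<open>1 / 2\<close>.\<close>

lemma taper_moment_1_symmetric:
  assumes "\<And>x. x \<in> {0..1} \<Longrightarrow> h x = h (1 - x)"
  shows "taper_moment h 1 = 0"
proof -
  let ?f = "\<lambda>x::real. indicator {0..1} x * ((h x)\<^sup>2 * (x - 1 / 2))"
  have "(LINT x|lborel. ?f x) = \<bar>- 1\<bar> *\<^sub>R (LINT x|lborel. ?f (1 + (- 1) * x))"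
    by (rule lborel_integral_real_affine) simp
  also have "(\<lambda>x. ?f (1 + (- 1) * x)) = (\<lambda>x. - ?f x)"
  proof
    fix x :: real
    show "?f (1 + (- 1) * x) = - ?f x"
      using assms[of x] by (cases "x \<in> {0..1}") (auto simp: indicator_def algebra_simps)
  qed
  finally have "(LINT x|lborel. ?f x) = 0" by simp
  then show ?thesis
    by (simp add: taper_moment_def set_lebesgue_integral_def)
qed

lemma taper_moment_integral:
  assumes "taper N s h"
  shows "(\<lambda>x. (taper_ext h x)\<^sup>2 * (x - 1 / 2) ^ j) integrable_on {0..1}"
    and "taper_moment h j = integral {0..1} (\<lambda>x. (taper_ext h x)\<^sup>2 * (x - 1 / 2) ^ j)"
proof -
  have si: "set_integrable lborel {0..1} (\<lambda>x. (h x)\<^sup>2 * (x - 1 / 2) ^ j)"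
    using taper_moment_integrable[OF assms, of j] by (simp add: set_integrable_def)
  have eq: "(taper_ext h x)\<^sup>2 * (x - 1 / 2) ^ j = (h x)\<^sup>2 * (x - 1 / 2) ^ j" if "x \<in> {0..1} - {0}" for x
    using that by (simp add: taper_ext_def)
  have neg: "negligible {0 :: real}" by simp
  show "(\<lambda>x. (taper_ext h x)\<^sup>2 * (x - 1 / 2) ^ j) integrable_on {0..1}"
    by (rule integrable_spike[OF set_borel_integral_eq_integral(1)[OF si] neg eq])
  have "integral {0..1} (\<lambda>x. (h x)\<^sup>2 * (x - 1 / 2) ^ j) = integral {0..1} (\<lambda>x. (taper_ext h x)\<^sup>2 * (x - 1 / 2) ^ j)"
    by (rule integral_spike[OF neg eq])
  then show "taper_moment h j = integral {0..1} (\<lambda>x. (taper_ext h x)\<^sup>2 * (x - 1 / 2) ^ j)"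
    unfolding taper_moment_def set_borel_integral_eq_integral(2)[OF si] .
qed

lemma grid_taper_ext: "0 < M \<Longrightarrow> grid h M t = taper_ext h (real_of_int t / real M)"
  by (auto simp: grid_def taper_ext_def field_simps)

lemma taper_moment_riemann:
  assumes t: "taper N s h" and M: "0 < M"
  shows "\<bar>lagged_moment h M 0 j / real M - taper_moment h j\<bar>
    \<le> (2 * taper_norm h * variation_bound N (taper_norm h) (taper_deriv_norm N s h) + (taper_norm h)\<^sup>2 * real j) / real M"
proof -
  let ?b = "taper_norm h"
  let ?W = "variation_bound N ?b (taper_deriv_norm N s h)"
  define F where "F x = (taper_ext h x)\<^sup>2 * (x - 1 / 2) ^ j" for x :: real
  define V where "V x = 2 * ?b * taper_variation N s h x + ?b\<^sup>2 * real j * x" for x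
  have b: "0 \<le> ?b" by (rule taper_norm_nonneg[OF t])
  have dom: "\<bar>F x - F y\<bar> \<le> V y - V x" if "0 \<le> x" "x \<le> y" "y \<le> 1" for x y
  proof -
    let ?a = "taper_ext h x" and ?c = "taper_ext h y"
    let ?w = "(x - 1 / 2) ^ j" and ?z = "(y - 1 / 2) ^ j"
    have "F x - F y = (?a + ?c) * (?a - ?c) * ?w + ?c\<^sup>2 * (?w - ?z)"
      by (simp add: F_def power2_eq_square algebra_simps)
    also have "\<bar>\<dots>\<bar> \<le> \<bar>?a + ?c\<bar> * \<bar>?a - ?c\<bar> * \<bar>?w\<bar> + ?c\<^sup>2 * \<bar>?w - ?z\<bar>"
      by (intro order_trans[OF abs_triangle_ineq]) (simp add: abs_mult)
    also have "\<dots> \<le> (2 * ?b) * (taper_variation N s h y - taper_variation N s h x) * 1 + ?b\<^sup>2 * (real j * (y - x))"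
    proof (intro add_mono mult_mono)
      show "\<bar>?a + ?c\<bar> \<le> 2 * ?b"
        using taper_ext_abs_le[OF t, of x] taper_ext_abs_le[OF t, of y] by linarith
      show "\<bar>?a - ?c\<bar> \<le> taper_variation N s h y - taper_variation N s h x"
        by (rule taper_ext_variation[OF t that(2)])
      show "\<bar>?w\<bar> \<le> 1"
        using that by (intro half_centred_power_le) auto
      show "?c\<^sup>2 \<le> ?b\<^sup>2"
        using power_mono[OF taper_ext_abs_le[OF t, of y], of 2] by simp
      show "\<bar>?w - ?z\<bar> \<le> real j * (y - x)"
        using norm_power_diff[of "x - 1 / 2" "y - 1 / 2" j] that by (simp add: abs_minus_commute)
      show "0 \<le> 2 * ?b * (taper_variation N s h y - taper_variation N s h x)"
        using b taper_variation_mono[OF t that(2)] by simp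
    qed (use b in auto)
    finally show ?thesis by (simp add: V_def algebra_simps)
  qed
  have "\<bar>integral {0..1} F - (\<Sum>t\<in>{1..int M}. F (real_of_int t / real M)) / real M\<bar> \<le> (V 1 - V 0) / real M"
    using taper_moment_integral(1)[OF t, of j] by (intro riemann_sum_error M dom) (simp_all add: F_def[abs_def])
  moreover have "(\<Sum>t\<in>{1..int M}. F (real_of_int t / real M)) = lagged_moment h M 0 j"
    by (simp add: lagged_moment_def F_def grid_taper_ext[OF M] power2_eq_square)
  moreover have "integral {0..1} F = taper_moment h j"
    using taper_moment_integral(2)[OF t, of j] by (simp add: F_def[abs_def])
  moreover have "V 1 - V 0 \<le> 2 * ?b * ?W + ?b\<^sup>2 * real j"
  proof -
    have "taper_variation N s h 1 - taper_variation N s h 0 \<le> ?W"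
      using taper_variation_range[OF t, of 1] taper_variation_range[OF t, of 0] by linarith
    then have "2 * ?b * (taper_variation N s h 1 - taper_variation N s h 0) \<le> 2 * ?b * ?W"
      using b by (intro mult_left_mono) auto
    then show ?thesis by (simp add: V_def algebra_simps)
  qed
  ultimately show ?thesis
    using divide_right_mono[of "V 1 - V 0" "2 * ?b * ?W + ?b\<^sup>2 * real j" "real M"]
    by (simp add: abs_minus_commute)
qed

lemma lagged_moment_error:
  assumes t: "taper N s h" and M: "0 < M" and l: "\<bar>l\<bar> \<le> int d" and j: "real j \<le> \<beta>"
  shows "\<bar>lagged_moment h M l j / real M - taper_moment h j\<bar>
    \<le> moment_error N d (taper_norm h) (taper_deriv_norm N s h) \<beta> / real M"
proof -
  let ?b = "taper_norm h"
  let ?W = "variation_bound N ?b (taper_deriv_norm N s h)"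
  have b: "0 \<le> ?b" by (rule taper_norm_nonneg[OF t])
  have W: "0 \<le> ?W" using taper_variation_range[OF t, of 0] by linarith
  have "\<bar>lagged_moment h M l j - lagged_moment h M 0 j\<bar>
     \<le> (\<Sum>t\<in>{1..int M}. \<bar>grid h M t * (grid h M (t - l) - grid h M t) * (real_of_int t / real M - 1 / 2) ^ j\<bar>)"
    unfolding lagged_moment_def sum_subtractf[symmetric]
    by (rule order_trans[OF sum_abs]) (simp add: algebra_simps)
  also have "\<dots> \<le> (\<Sum>t\<in>{1..int M}. ?b * \<bar>grid h M (t - l) - grid h M t\<bar> * 1)"
    unfolding abs_mult
  proof (intro sum_mono mult_mono)
    fix i assume i: "i \<in> {1..int M}"
    show "\<bar>grid h M i\<bar> \<le> ?b"
      unfolding grid_taper_ext[OF M] by (rule taper_ext_abs_le[OF t])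
    show "\<bar>(real_of_int i / real M - 1 / 2) ^ j\<bar> \<le> 1"
      using i M by (intro half_centred_power_le) (auto simp: field_simps)
  qed (use b in auto)
  also have "\<dots> = ?b * (\<Sum>t\<in>{1..int M}. \<bar>grid h M (t - l) - grid h M t\<bar>)"
    by (simp add: sum_distrib_left)
  also have "\<dots> \<le> ?b * (real_of_int \<bar>l\<bar> * ?W)"
  proof (intro mult_left_mono b sum_lag_oscillation_le)
    fix m n :: int
    assume "m \<le> n"
    then show "\<bar>grid h M m - grid h M n\<bar>
       \<le> taper_variation N s h (real_of_int n / real M) - taper_variation N s h (real_of_int m / real M)"
      unfolding grid_taper_ext[OF M] using M by (intro taper_ext_variation[OF t]) (simp add: divide_right_mono)
  qed (rule taper_variation_range[OF t])+
  also have "\<dots> \<le> ?b * (real d * ?W)"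
    using l b W by (intro mult_left_mono mult_right_mono) auto
  finally have "\<bar>lagged_moment h M l j - lagged_moment h M 0 j\<bar> / real M \<le> ?b * (real d * ?W) / real M"
    by (rule divide_right_mono) simp
  then have 1: "\<bar>lagged_moment h M l j / real M - lagged_moment h M 0 j / real M\<bar> \<le> ?b * (real d * ?W) / real M"
    by (simp add: diff_divide_distrib[symmetric])
  have "2 * ?b * ?W + ?b\<^sup>2 * real j \<le> 2 * ?b * ?W + ?b\<^sup>2 * \<beta>"
    using j by (intro add_left_mono mult_left_mono) auto
  then have 2: "\<bar>lagged_moment h M 0 j / real M - taper_moment h j\<bar> \<le> (2 * ?b * ?W + ?b\<^sup>2 * \<beta>) / real M"
    by (intro order_trans[OF taper_moment_riemann[OF t M]] divide_right_mono) auto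
  have "\<bar>lagged_moment h M l j / real M - taper_moment h j\<bar>
    \<le> ?b * (real d * ?W) / real M + (2 * ?b * ?W + ?b\<^sup>2 * \<beta>) / real M"
    using 1 2 by linarith
  also have "\<dots> = moment_error N d ?b (taper_deriv_norm N s h) \<beta> / real M"
    by (simp add: moment_error_def add_divide_distrib[symmetric] algebra_simps)
  finally show ?thesis .
qed

lemma taper_mass_lagged_moment: "taper_mass h M = lagged_moment h M 0 0"
  by (simp add: taper_mass_grid lagged_moment_def power2_eq_square)

text \<open>After normalization by \<open>taper_mass\<close>, the weights of the empirical covariance have total modulus at
  most one, at every lag.\<close>

lemma sum_grid_lag_le_taper_mass:
  "(\<Sum>t\<in>{1..int M}. \<bar>grid h M t * grid h M (t - l)\<bar>) \<le> taper_mass h M"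
proof -
  have "(\<Sum>t\<in>{1..int M}. (grid h M (t - l))\<^sup>2) = (\<Sum>t\<in>{1 - l..int M - l}. (grid h M t)\<^sup>2)"
    by (rule sum.reindex_bij_witness[of _ "\<lambda>t. t + l" "\<lambda>t. t - l"]) auto
  also have "\<dots> = (\<Sum>t\<in>{1 - l..int M - l} \<inter> {1..int M}. (grid h M t)\<^sup>2)"
    by (rule sum.mono_neutral_right) (auto simp: grid_def)
  also have "\<dots> \<le> taper_mass h M"
    unfolding taper_mass_grid by (intro sum_mono2) auto
  finally have 1: "(\<Sum>t\<in>{1..int M}. (grid h M (t - l))\<^sup>2) \<le> taper_mass h M" .
  have "(\<Sum>t\<in>{1..int M}. \<bar>grid h M t * grid h M (t - l)\<bar>)
     \<le> (\<Sum>t\<in>{1..int M}. ((grid h M t)\<^sup>2 + (grid h M (t - l))\<^sup>2) / 2)"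
  proof (rule sum_mono)
    fix t
    have "0 \<le> (\<bar>grid h M t\<bar> - \<bar>grid h M (t - l)\<bar>)\<^sup>2" by simp
    then show "\<bar>grid h M t * grid h M (t - l)\<bar> \<le> ((grid h M t)\<^sup>2 + (grid h M (t - l))\<^sup>2) / 2"
      by (simp add: power2_diff abs_mult)
  qed
  also have "\<dots> = (taper_mass h M + (\<Sum>t\<in>{1..int M}. (grid h M (t - l))\<^sup>2)) / 2"
    unfolding taper_mass_grid sum_divide_distrib[symmetric] sum.distrib ..
  also have "\<dots> \<le> taper_mass h M"
    using 1 by simp
  finally show ?thesis .
qed

lemma normalized_lagged_moment_error:
  assumes t: "taper N s h" and M: "0 < M" and l: "\<bar>l\<bar> \<le> int d" and j: "real j \<le> \<beta>"
    and large: "moment_error N d (taper_norm h) (taper_deriv_norm N s h) \<beta> / real M \<le> 1 / 2"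
  shows "0 < taper_mass h M"
    and "\<bar>lagged_moment h M l j / taper_mass h M - taper_moment h j\<bar>
      \<le> 4 * moment_error N d (taper_norm h) (taper_deriv_norm N s h) \<beta> / real M"
proof -
  let ?e = "moment_error N d (taper_norm h) (taper_deriv_norm N s h) \<beta> / real M"
  have j0: "real 0 \<le> \<beta>" using j by linarith
  have H: "\<bar>taper_mass h M / real M - 1\<bar> \<le> ?e"
    using lagged_moment_error[OF t M, of 0 d 0 \<beta>] j0 taper_moment_0[OF t]
    by (simp add: taper_mass_lagged_moment)
  then have half: "1 / 2 \<le> taper_mass h M / real M"
    using large by linarith
  then show pos: "0 < taper_mass h M"
    using M by (simp add: field_simps)
  define \<eta> where "\<eta> = taper_mass h M / real M"
  define \<sigma> where "\<sigma> = lagged_moment h M l j / real M"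
  define \<mu> where "\<mu> = taper_moment h j"
  have \<sigma>: "\<bar>\<sigma> - \<mu>\<bar> \<le> ?e"
    unfolding \<sigma>_def \<mu>_def by (rule lagged_moment_error[OF t M l j])
  have \<mu>: "\<bar>\<mu>\<bar> \<le> 1" unfolding \<mu>_def by (rule taper_moment_abs_le[OF t])
  have eq: "lagged_moment h M l j / taper_mass h M - \<mu> = ((\<sigma> - \<mu>) - \<mu> * (\<eta> - 1)) / \<eta>"
    using pos M by (simp add: \<sigma>_def \<eta>_def field_simps)
  have "\<bar>(\<sigma> - \<mu>) - \<mu> * (\<eta> - 1)\<bar> \<le> \<bar>\<sigma> - \<mu>\<bar> + \<bar>\<mu>\<bar> * \<bar>\<eta> - 1\<bar>"
    by (simp add: abs_mult[symmetric])
  also have "\<dots> \<le> ?e + 1 * ?e"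
    using \<sigma> \<mu> H by (intro add_mono mult_mono) (auto simp: \<eta>_def)
  finally have num: "\<bar>(\<sigma> - \<mu>) - \<mu> * (\<eta> - 1)\<bar> \<le> 2 * ?e" by simp
  have \<eta>: "1 / 2 \<le> \<eta>" using half by (simp add: \<eta>_def)
  have "\<bar>lagged_moment h M l j / taper_mass h M - \<mu>\<bar> = \<bar>(\<sigma> - \<mu>) - \<mu> * (\<eta> - 1)\<bar> / \<eta>"
    unfolding eq using \<eta> by (simp add: abs_divide)
  also have "\<dots> \<le> (2 * ?e) / (1 / 2)"
    using num \<eta> by (intro frac_le) auto
  finally show "\<bar>lagged_moment h M l j / taper_mass h M - taper_moment h j\<bar>
      \<le> 4 * moment_error N d (taper_norm h) (taper_deriv_norm N s h) \<beta> / real M"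
    by (simp add: \<mu>_def)
qed

section \<open>Taylor expansion in Hoelder balls\<close>

lemma holder_order_eq: "\<beta> = real k + \<alpha> \<Longrightarrow> 0 < \<alpha> \<Longrightarrow> \<alpha> \<le> 1 \<Longrightarrow> holder_order \<beta> = k"
proof -
  assume a: "\<beta> = real k + \<alpha>" "0 < \<alpha>" "\<alpha> \<le> 1"
  then have "\<lceil>\<beta>\<rceil> = int k + 1"
    by (intro ceiling_unique) auto
  then show ?thesis by (simp add: holder_order_def)
qed

lemma holder_ballD:
  fixes g :: "real \<Rightarrow> real"
  assumes g: "g \<in> holder_ball \<beta> R" and R: "0 \<le> R"
    and \<beta>: "\<beta> = real k + \<alpha>" "0 < \<alpha>" "\<alpha> \<le> 1"
  shows "j < k \<Longrightarrow> (nth_vderiv j g has_real_derivative nth_vderiv (Suc j) g x) (at x)"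
    and "j \<le> k \<Longrightarrow> \<bar>nth_vderiv j g x\<bar> \<le> R"
    and "\<bar>nth_vderiv k g x - nth_vderiv k g y\<bar> \<le> 2 * R * \<bar>x - y\<bar> powr \<alpha>"
proof -
  have ord: "holder_order \<beta> = k" by (rule holder_order_eq[OF \<beta>])
  have \<alpha>: "\<beta> - real k = \<alpha>" using \<beta> by simp
  have fin: "holder_norm \<beta> g \<le> ennreal R"
    using g by (simp add: holder_ball_def)
  have diff: "times_differentiable k g"
  proof (rule ccontr)
    assume "\<not> times_differentiable k g"
    then have "holder_norm \<beta> g = \<infinity>"
      unfolding holder_norm_def Let_def ord by simp
    then show False using fin by (simp add: top_unique)
  qed
  have sum: "holder_seminorm \<alpha> (nth_vderiv k g) + (MAX j\<in>{0..k}. sup_norm (nth_vderiv j g)) \<le> ennreal R"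
    using fin diff unfolding holder_norm_def Let_def ord \<alpha> by simp
  show "(nth_vderiv j g has_real_derivative nth_vderiv (Suc j) g x) (at x)" if "j < k"
  proof -
    have "nth_vderiv j g differentiable (at x)"
      using diff that by (simp add: times_differentiable_def)
    then have "(nth_vderiv j g has_vector_derivative vector_derivative (nth_vderiv j g) (at x)) (at x)"
      by (simp add: vector_derivative_works)
    then show ?thesis
      by (simp add: nth_vderiv_def has_real_derivative_iff_has_vector_derivative)
  qed
  have bound: "\<bar>nth_vderiv j g x\<bar> \<le> R" if "j \<le> k" for j x
  proof -
    have "ennreal \<bar>nth_vderiv j g x\<bar> \<le> sup_norm (nth_vderiv j g)"
      unfolding sup_norm_def by (rule SUP_upper2[of x]) auto
    also have "\<dots> \<le> (MAX j\<in>{0..k}. sup_norm (nth_vderiv j g))"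
      using that by (intro Max_ge) auto
    also have "\<dots> \<le> holder_seminorm \<alpha> (nth_vderiv k g) + (MAX j\<in>{0..k}. sup_norm (nth_vderiv j g))"
      by (rule add_increasing[OF _ order_refl]) simp
    also note sum
    finally show ?thesis using R by simp
  qed
  then show "j \<le> k \<Longrightarrow> \<bar>nth_vderiv j g x\<bar> \<le> R" .
  show "\<bar>nth_vderiv k g x - nth_vderiv k g y\<bar> \<le> 2 * R * \<bar>x - y\<bar> powr \<alpha>"
  proof (cases "x = y")
    case True
    then show ?thesis by simp
  next
    case xy: False
    show ?thesis
    proof (cases "\<bar>x - y\<bar> < 1")
      case True
      have "ennreal (\<bar>nth_vderiv k g x - nth_vderiv k g y\<bar> / \<bar>x - y\<bar> powr \<alpha>) \<le> holder_seminorm \<alpha> (nth_vderiv k g)"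
        unfolding holder_seminorm_def using True xy by (intro SUP_upper2[of "(x, y)"]) auto
      also have "\<dots> \<le> holder_seminorm \<alpha> (nth_vderiv k g) + (MAX j\<in>{0..k}. sup_norm (nth_vderiv j g))"
        by simp
      also note sum
      finally have "\<bar>nth_vderiv k g x - nth_vderiv k g y\<bar> / \<bar>x - y\<bar> powr \<alpha> \<le> R"
        using R by simp
      then have "\<bar>nth_vderiv k g x - nth_vderiv k g y\<bar> \<le> R * \<bar>x - y\<bar> powr \<alpha>"
        using xy by (simp add: field_simps)
      also have "\<dots> \<le> 2 * R * \<bar>x - y\<bar> powr \<alpha>"
        using R by (intro mult_right_mono) auto
      finally show ?thesis .
    next
      case False
      have "\<bar>nth_vderiv k g x - nth_vderiv k g y\<bar> \<le> 2 * R * 1"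
        using bound[of k x] bound[of k y] by linarith
      also have "\<dots> \<le> 2 * R * \<bar>x - y\<bar> powr \<alpha>"
        using False R \<beta> by (intro mult_left_mono ge_one_powr_ge_zero) auto
      finally show ?thesis .
    qed
  qed
qed

lemma nth_vderiv_0 [simp]: "nth_vderiv 0 g = g"
  by (simp add: nth_vderiv_def)

text \<open>In Lagrange's form of the remainder, replacing the derivative of order \<open>k\<close> at the intermediate
  point by that at \<open>u\<close> costs a Hoelder increment.\<close>

lemma holder_taylor:
  fixes g :: "real \<Rightarrow> real"
  assumes g: "g \<in> holder_ball \<beta> R" and R: "0 \<le> R"
    and \<beta>: "\<beta> = real k + \<alpha>" "0 < \<alpha>" "\<alpha> \<le> 1"
  shows "\<bar>g (u + \<delta>) - (\<Sum>j\<le>k. nth_vderiv j g u * \<delta> ^ j / fact j)\<bar> \<le> 2 * R * \<bar>\<delta>\<bar> powr \<beta>"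
proof (cases "\<delta> = 0")
  case True
  have "(\<Sum>j\<le>k. nth_vderiv j g u * 0 ^ j / fact j) = g u"
    by (simp add: power_0_left if_distrib if_distribR sum.delta cong: if_cong)
  then show ?thesis using True by simp
next
  case \<delta>: False
  note D = holder_ballD[OF g R \<beta>]
  obtain s where s: "\<bar>s - u\<bar> \<le> \<bar>\<delta>\<bar>"
    "g (u + \<delta>) = (\<Sum>j<k. nth_vderiv j g u / fact j * \<delta> ^ j) + nth_vderiv k g s / fact k * \<delta> ^ k"
  proof (cases "k = 0")
    case True
    then show ?thesis using that[of "u + \<delta>"] by simp
  next
    case False
    have "\<exists>t. (if u + \<delta> < u then u + \<delta> < t \<and> t < u else u < t \<and> t < u + \<delta>) \<and>
        g (u + \<delta>) = (\<Sum>j<k. nth_vderiv j g u / fact j * (u + \<delta> - u) ^ j) + nth_vderiv k g t / fact k * (u + \<delta> - u) ^ k"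
    proof (rule Taylor[where a = "min u (u + \<delta>)" and b = "max u (u + \<delta>)"])
      show "\<forall>m t. m < k \<and> min u (u + \<delta>) \<le> t \<and> t \<le> max u (u + \<delta>) \<longrightarrow>
          (nth_vderiv m g has_real_derivative nth_vderiv (Suc m) g t) (at t)"
        using D(1) by blast
    qed (use False \<delta> in auto)
    then obtain t where "if u + \<delta> < u then u + \<delta> < t \<and> t < u else u < t \<and> t < u + \<delta>"
      "g (u + \<delta>) = (\<Sum>j<k. nth_vderiv j g u / fact j * \<delta> ^ j) + nth_vderiv k g t / fact k * \<delta> ^ k"
      by auto
    then show ?thesis by (intro that[of t]) (auto split: if_splits)
  qed
  have "{..k} = insert k {..<k}" by auto
  then have "g (u + \<delta>) - (\<Sum>j\<le>k. nth_vderiv j g u * \<delta> ^ j / fact j)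
      = (nth_vderiv k g s - nth_vderiv k g u) * \<delta> ^ k / fact k"
    unfolding s(2) by (simp add: field_simps)
  also have "\<bar>\<dots>\<bar> = \<bar>nth_vderiv k g s - nth_vderiv k g u\<bar> * \<bar>\<delta>\<bar> ^ k / fact k"
    by (simp add: abs_mult power_abs)
  also have "\<dots> \<le> (2 * R * \<bar>\<delta>\<bar> powr \<alpha>) * \<bar>\<delta>\<bar> ^ k / 1"
  proof (intro frac_le mult_right_mono)
    have "\<bar>nth_vderiv k g s - nth_vderiv k g u\<bar> \<le> 2 * R * \<bar>s - u\<bar> powr \<alpha>"
      by (rule D(3))
    also have "\<dots> \<le> 2 * R * \<bar>\<delta>\<bar> powr \<alpha>"
      using s(1) R \<beta> by (intro mult_left_mono powr_mono2) auto
    finally show "\<bar>nth_vderiv k g s - nth_vderiv k g u\<bar> \<le> 2 * R * \<bar>\<delta>\<bar> powr \<alpha>" .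
    show "1 \<le> (fact k :: real)" by (rule fact_ge_1)
  qed (use R in auto)
  also have "\<dots> = 2 * R * \<bar>\<delta>\<bar> powr \<beta>"
    using \<delta> \<beta> by (simp add: powr_add powr_realpow)
  finally show ?thesis .
qed

section \<open>The local covariance function and its derivatives\<close>

abbreviation period_ind :: "real \<Rightarrow> real" where
  "period_ind \<equiv> indicator {- pi..pi}"

text \<open>The real part of the \<open>j\<close>th time derivative of the local covariance at lag \<open>l\<close>. The local covariance
  itself is real at the times \<open>t / T\<close>, see \<open>local_cov_real\<close>, but a density that is not even in frequency is
  not excluded beforehand.\<close>

definition cov_deriv :: "(real \<Rightarrow> real \<Rightarrow> real) \<Rightarrow> real \<Rightarrow> nat \<Rightarrow> int \<Rightarrow> real" where
  "cov_deriv f u j l =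
     (LINT \<xi>|lebesgue. period_ind \<xi> * (cos (of_int l * \<xi>) * nth_vderiv j (\<lambda>v. f v \<xi>) u))"

lemma borel_measurable_lebesgueI: "f \<in> borel_measurable borel \<Longrightarrow> f \<in> borel_measurable lebesgue"
  by (simp add: measurable_completion)

lemma integrable_period_ind: "integrable lebesgue (\<lambda>\<xi>. period_ind \<xi> * c)"
proof -
  have "integrable lebesgue (indicator {- pi..pi} :: real \<Rightarrow> real)"
    by (intro integrable_real_indicator) auto
  then show ?thesis by simp
qed

lemma integral_period_ind: "(LINT \<xi>|lebesgue. period_ind \<xi> * c) = 2 * pi * c"
  by simp

lemma period_bounded_integral:
  assumes m: "(\<lambda>\<xi>. period_ind \<xi> * w \<xi>) \<in> borel_measurable lebesgue" and w: "\<And>\<xi>. \<bar>w \<xi>\<bar> \<le> B"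
  shows "integrable lebesgue (\<lambda>\<xi>. period_ind \<xi> * w \<xi>)"
    and "\<bar>LINT \<xi>|lebesgue. period_ind \<xi> * w \<xi>\<bar> \<le> 2 * pi * B"
proof -
  have le: "norm (period_ind \<xi> * w \<xi>) \<le> norm (period_ind \<xi> * B)" for \<xi>
    using w[of \<xi>] by (simp add: indicator_def)
  show i: "integrable lebesgue (\<lambda>\<xi>. period_ind \<xi> * w \<xi>)"
    by (rule Bochner_Integration.integrable_bound[OF integrable_period_ind[of B] m]) (rule AE_I2, rule le)
  have "\<bar>LINT \<xi>|lebesgue. period_ind \<xi> * w \<xi>\<bar> \<le> (LINT \<xi>|lebesgue. \<bar>period_ind \<xi> * w \<xi>\<bar>)"
    by (rule integral_abs_bound)
  also have "\<dots> \<le> (LINT \<xi>|lebesgue. period_ind \<xi> * B)"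
  proof (rule integral_mono)
    show "\<bar>period_ind \<xi> * w \<xi>\<bar> \<le> period_ind \<xi> * B" for \<xi>
      using w[of \<xi>] by (simp add: indicator_def)
  qed (use i integrable_period_ind[of B] in auto)
  also have "\<dots> = 2 * pi * B" by (rule integral_period_ind)
  finally show "\<bar>LINT \<xi>|lebesgue. period_ind \<xi> * w \<xi>\<bar> \<le> 2 * pi * B" .
qed

lemma density_measurable:
  assumes "local_spectral_density f"
  shows "integrable lebesgue (\<lambda>\<xi>. period_ind \<xi> * f u \<xi>)"
  using assms by (auto simp: local_spectral_density_def set_integrable_def)

text \<open>The time derivatives of the spectral density are measurable in frequency as limits of difference
  quotients along this sequence.\<close>

lemma has_real_derivative_LIMSEQ:
  fixes g :: "real \<Rightarrow> real"
  assumes "(g has_real_derivative D) (at x)"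
  shows "(\<lambda>n. (g (x + inverse (real (Suc n))) - g x) / inverse (real (Suc n))) \<longlonglongrightarrow> D"
proof -
  have "((\<lambda>h. (g (x + h) - g x) / h) \<longlongrightarrow> D) (at 0)"
    using assms by (simp add: DERIV_def)
  moreover have "filterlim (\<lambda>n. inverse (real (Suc n))) (at 0) sequentially"
    by (rule filterlim_atI[OF LIMSEQ_inverse_real_of_nat]) simp
  ultimately show ?thesis by (rule filterlim_compose)
qed

lemma density_deriv_measurable:
  assumes f: "local_spectral_density f" and hol: "\<And>\<xi>. (\<lambda>v. f v \<xi>) \<in> holder_ball \<beta> R" and R: "0 \<le> R"
    and \<beta>: "\<beta> = real k + \<alpha>" "0 < \<alpha>" "\<alpha> \<le> 1" and "j \<le> k"
  shows "(\<lambda>\<xi>. period_ind \<xi> * nth_vderiv j (\<lambda>v. f v \<xi>) u) \<in> borel_measurable lebesgue"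
  using assms(7)
proof (induction j arbitrary: u)
  case 0
  then show ?case using borel_measurable_integrable[OF density_measurable[OF f]] by simp
next
  case (Suc j)
  let ?e = "\<lambda>n. inverse (real (Suc n))"
  let ?F = "\<lambda>v \<xi>. period_ind \<xi> * nth_vderiv j (\<lambda>v. f v \<xi>) v"
  show ?case
  proof (rule borel_measurable_LIMSEQ_real)
    show "(\<lambda>\<xi>. (?F (u + ?e n) \<xi> - ?F u \<xi>) / ?e n) \<in> borel_measurable lebesgue" for n
      using Suc by (intro borel_measurable_divide borel_measurable_diff borel_measurable_const) simp_all
    fix \<xi>
    have "(\<lambda>n. (nth_vderiv j (\<lambda>v. f v \<xi>) (u + ?e n) - nth_vderiv j (\<lambda>v. f v \<xi>) u) / ?e n)
        \<longlonglongrightarrow> nth_vderiv (Suc j) (\<lambda>v. f v \<xi>) u"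
      using Suc.prems by (intro has_real_derivative_LIMSEQ holder_ballD(1)[OF hol R \<beta>]) simp
    then have "(\<lambda>n. period_ind \<xi> * ((nth_vderiv j (\<lambda>v. f v \<xi>) (u + ?e n) - nth_vderiv j (\<lambda>v. f v \<xi>) u) / ?e n))
        \<longlonglongrightarrow> period_ind \<xi> * nth_vderiv (Suc j) (\<lambda>v. f v \<xi>) u"
      by (rule tendsto_mult_left)
    then show "(\<lambda>n. (?F (u + ?e n) \<xi> - ?F u \<xi>) / ?e n) \<longlonglongrightarrow> period_ind \<xi> * nth_vderiv (Suc j) (\<lambda>v. f v \<xi>) u"
      by (simp add: right_diff_distrib)
  qed
qed

lemma cos_times_measurable:
  assumes "(\<lambda>\<xi>. period_ind \<xi> * w \<xi>) \<in> borel_measurable lebesgue"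
  shows "(\<lambda>\<xi>. period_ind \<xi> * (cos (of_int l * \<xi>) * w \<xi>)) \<in> borel_measurable lebesgue"
proof -
  have "(\<lambda>\<xi>. cos (of_int l * \<xi>) * (period_ind \<xi> * w \<xi>)) \<in> borel_measurable lebesgue"
    by (rule borel_measurable_times[OF borel_measurable_lebesgueI assms]) measurable
  then show ?thesis by (simp add: mult.left_commute)
qed

lemma abs_cos_times_le: "\<bar>w\<bar> \<le> B \<Longrightarrow> \<bar>cos x * w\<bar> \<le> (B :: real)"
  using mult_mono[of "\<bar>cos x\<bar>" 1 "\<bar>w\<bar>" B] by (simp add: abs_mult)

lemma cov_deriv_abs_le:
  assumes f: "local_spectral_density f" and hol: "\<And>\<xi>. (\<lambda>v. f v \<xi>) \<in> holder_ball \<beta> R" and R: "0 \<le> R"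
    and \<beta>: "\<beta> = real k + \<alpha>" "0 < \<alpha>" "\<alpha> \<le> 1" and "j \<le> k"
  shows "integrable lebesgue (\<lambda>\<xi>. period_ind \<xi> * (cos (of_int l * \<xi>) * nth_vderiv j (\<lambda>v. f v \<xi>) u))"
    and "\<bar>cov_deriv f u j l\<bar> \<le> 2 * pi * R"
proof -
  note m = cos_times_measurable[OF density_deriv_measurable[OF assms]]
  have b: "\<bar>cos (of_int l * \<xi>) * nth_vderiv j (\<lambda>v. f v \<xi>) u\<bar> \<le> R" for \<xi>
    by (intro abs_cos_times_le holder_ballD(2)[OF hol R \<beta> assms(7)])
  show "integrable lebesgue (\<lambda>\<xi>. period_ind \<xi> * (cos (of_int l * \<xi>) * nth_vderiv j (\<lambda>v. f v \<xi>) u))"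
    by (rule period_bounded_integral(1)[OF m b])
  show "\<bar>cov_deriv f u j l\<bar> \<le> 2 * pi * R"
    unfolding cov_deriv_def by (rule period_bounded_integral(2)[OF m b])
qed

text \<open>The Taylor remainder of the density is bounded uniformly in frequency, so the expansion may be
  integrated term by term.\<close>

lemma cov_deriv_taylor:
  assumes f: "local_spectral_density f" and hol: "\<And>\<xi>. (\<lambda>v. f v \<xi>) \<in> holder_ball \<beta> R" and R: "0 \<le> R"
    and \<beta>: "\<beta> = real k + \<alpha>" "0 < \<alpha>" "\<alpha> \<le> 1"
  shows "\<bar>cov_deriv f (u + \<delta>) 0 l - (\<Sum>j\<le>k. cov_deriv f u j l * \<delta> ^ j / fact j)\<bar> \<le> 4 * pi * R * \<bar>\<delta>\<bar> powr \<beta>"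
proof -
  let ?c = "\<lambda>\<xi>. cos (of_int l * \<xi>)"
  let ?d = "\<lambda>j \<xi>. nth_vderiv j (\<lambda>v. f v \<xi>) u"
  define w where "w \<xi> = f (u + \<delta>) \<xi> - (\<Sum>j\<le>k. ?d j \<xi> * \<delta> ^ j / fact j)" for \<xi>
  note int = cov_deriv_abs_le(1)[OF f hol R \<beta>]
  have i0: "integrable lebesgue (\<lambda>\<xi>. period_ind \<xi> * (?c \<xi> * f (u + \<delta>) \<xi>))"
    using int[of 0 l "u + \<delta>"] by simp
  have isum: "integrable lebesgue (\<lambda>\<xi>. \<Sum>j\<le>k. period_ind \<xi> * (?c \<xi> * ?d j \<xi>) * (\<delta> ^ j / fact j))"
    using int by (intro Bochner_Integration.integrable_sum Bochner_Integration.integrable_mult_left) simp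
  have "(\<Sum>j\<le>k. cov_deriv f u j l * \<delta> ^ j / fact j)
     = (\<Sum>j\<le>k. (LINT \<xi>|lebesgue. period_ind \<xi> * (?c \<xi> * ?d j \<xi>) * (\<delta> ^ j / fact j)))"
    unfolding cov_deriv_def by (intro sum.cong refl) simp
  also have "\<dots> = (LINT \<xi>|lebesgue. (\<Sum>j\<le>k. period_ind \<xi> * (?c \<xi> * ?d j \<xi>) * (\<delta> ^ j / fact j)))"
    using int by (intro Bochner_Integration.integral_sum[symmetric] Bochner_Integration.integrable_mult_left) simp
  finally have "cov_deriv f (u + \<delta>) 0 l - (\<Sum>j\<le>k. cov_deriv f u j l * \<delta> ^ j / fact j)
     = (LINT \<xi>|lebesgue. period_ind \<xi> * (?c \<xi> * f (u + \<delta>) \<xi>)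
          - (\<Sum>j\<le>k. period_ind \<xi> * (?c \<xi> * ?d j \<xi>) * (\<delta> ^ j / fact j)))"
    using Bochner_Integration.integral_diff[OF i0 isum] by (simp only: cov_deriv_def nth_vderiv_0)
  also have "(\<lambda>\<xi>. period_ind \<xi> * (?c \<xi> * f (u + \<delta>) \<xi>)
          - (\<Sum>j\<le>k. period_ind \<xi> * (?c \<xi> * ?d j \<xi>) * (\<delta> ^ j / fact j))) = (\<lambda>\<xi>. period_ind \<xi> * (?c \<xi> * w \<xi>))"
    by (rule ext) (simp add: w_def right_diff_distrib sum_distrib_left mult_ac)
  finally have eq: "cov_deriv f (u + \<delta>) 0 l - (\<Sum>j\<le>k. cov_deriv f u j l * \<delta> ^ j / fact j)
     = (LINT \<xi>|lebesgue. period_ind \<xi> * (?c \<xi> * w \<xi>))" .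
  have "(\<lambda>\<xi>. period_ind \<xi> * f (u + \<delta>) \<xi> - (\<Sum>j\<le>k. (period_ind \<xi> * ?d j \<xi>) * (\<delta> ^ j / fact j))) \<in> borel_measurable lebesgue"
    using density_deriv_measurable[OF f hol R \<beta>]
    by (intro borel_measurable_diff[OF borel_measurable_integrable[OF density_measurable[OF f]]]
        borel_measurable_sum borel_measurable_times[OF _ borel_measurable_const]) simp
  then have "(\<lambda>\<xi>. period_ind \<xi> * w \<xi>) \<in> borel_measurable lebesgue"
    by (simp add: w_def right_diff_distrib sum_distrib_left mult_ac)
  moreover have "\<bar>w \<xi>\<bar> \<le> 2 * R * \<bar>\<delta>\<bar> powr \<beta>" for \<xi>
    unfolding w_def by (rule holder_taylor[OF hol R \<beta>])
  ultimately have "\<bar>LINT \<xi>|lebesgue. period_ind \<xi> * (?c \<xi> * w \<xi>)\<bar> \<le> 2 * pi * (2 * R * \<bar>\<delta>\<bar> powr \<beta>)"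
    by (intro period_bounded_integral(2) cos_times_measurable abs_cos_times_le)
  then show ?thesis unfolding eq by simp
qed

lemma Re_local_cov:
  assumes f: "local_spectral_density f"
  shows "Re (local_cov f u l) = cov_deriv f u 0 l"
proof -
  let ?g = "\<lambda>\<xi>. indicator {- pi..pi} \<xi> *\<^sub>R (exp (\<i> * of_int l * complex_of_real \<xi>) * complex_of_real (f u \<xi>))"
  have g: "?g = (\<lambda>\<xi>. exp (\<i> * of_int l * complex_of_real \<xi>) * complex_of_real (period_ind \<xi> * f u \<xi>))"
    by (auto simp: fun_eq_iff scaleR_conv_of_real)
  have m: "(\<lambda>\<xi>. complex_of_real (period_ind \<xi> * f u \<xi>)) \<in> borel_measurable lebesgue"
    by (rule measurable_compose[OF borel_measurable_integrable[OF density_measurable[OF f]] borel_measurable_of_real])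
  have "integrable lebesgue ?g"
  proof (rule Bochner_Integration.integrable_bound[OF density_measurable[OF f, of u]])
    show "?g \<in> borel_measurable lebesgue"
      unfolding g by (intro borel_measurable_times m borel_measurable_lebesgueI) measurable
    show "AE \<xi> in lebesgue. norm (?g \<xi>) \<le> norm (period_ind \<xi> * f u \<xi>)"
      by (intro AE_I2) (simp add: norm_mult norm_exp_eq_Re)
  qed
  then have "Re (local_cov f u l) = (LINT \<xi>|lebesgue. Re (?g \<xi>))"
    unfolding local_cov_def set_lebesgue_integral_def by (rule integral_Re[symmetric])
  also have "(\<lambda>\<xi>. Re (?g \<xi>)) = (\<lambda>\<xi>. period_ind \<xi> * (cos (of_int l * \<xi>) * f u \<xi>))"
    by (rule ext) (simp add: Re_exp)
  finally show ?thesis by (simp add: cov_deriv_def)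
qed

text \<open>The imaginary part of the local covariance is at most \<open>R T\<^sup>-\<^sup>m\<close> at \<open>t / T\<close>, with \<open>m\<close> the
  smaller of \<open>1\<close> and \<open>\<beta>\<close>; writing the same point as \<open>n t / (n T)\<close> makes this bound arbitrarily small.\<close>

lemma local_cov_real:
  assumes wls: "weakly_locally_stationary P \<beta> R T\<^sub>0 X f" and T: "0 < T\<^sub>0" "T\<^sub>0 \<le> real T" and \<beta>: "0 < \<beta>"
  shows "local_cov f (real_of_int t / real T) l = complex_of_real (cov_deriv f (real_of_int t / real T) 0 l)"
proof -
  let ?c = "local_cov f (real_of_int t / real T) l"
  have T0: "0 < real T" using T by linarith
  have le: "\<bar>Im ?c\<bar> \<le> R * (real (Suc n) * real T) powr (- min 1 \<beta>)" for n
  proof -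
    \<comment> \<open>the same point at the finer time scale \<open>Suc n * T\<close>\<close>
    have same: "real_of_int (int (Suc n) * t) / real (Suc n * T) = real_of_int t / real T"
      unfolding of_int_mult of_int_of_nat_eq of_nat_mult
      by (rule mult_divide_mult_cancel_left) simp
    have "T\<^sub>0 \<le> real (Suc n * T)"
      using T T0 by (simp add: algebra_simps add_increasing2)
    then have "norm (complex_of_real (covar P (X (int (Suc n) * t) (Suc n * T)) (X (int (Suc n) * t - l) (Suc n * T)))
        - local_cov f (real_of_int (int (Suc n) * t) / real (Suc n * T)) l) \<le> R * real (Suc n * T) powr (- min 1 \<beta>)"
      using wls unfolding weakly_locally_stationary_def by blast
    then have "norm (complex_of_real (covar P (X (int (Suc n) * t) (Suc n * T)) (X (int (Suc n) * t - l) (Suc n * T))) - ?c)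
        \<le> R * (real (Suc n) * real T) powr (- min 1 \<beta>)"
      unfolding same by (simp only: of_nat_mult)
    from order_trans[OF abs_Im_le_cmod this] show ?thesis by simp
  qed
  have lim: "(\<lambda>n. R * (real (Suc n) * real T) powr (- min 1 \<beta>)) \<longlonglongrightarrow> R * 0"
  proof (intro tendsto_mult tendsto_const tendsto_neg_powr)
    show "LIM n sequentially. real (Suc n) * real T :> at_top"
      using T0 by (intro filterlim_at_top_mult_tendsto_pos[OF tendsto_const]
          filterlim_compose[OF filterlim_real_sequentially filterlim_Suc])
  qed (use \<beta> in auto)
  have "\<bar>Im ?c\<bar> \<le> R * 0"
    by (rule LIMSEQ_le_const[OF lim]) (use le in blast)
  then have "Im ?c = 0" by simp
  moreover have "Re ?c = cov_deriv f (real_of_int t / real T) 0 l"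
    using wls by (intro Re_local_cov) (simp add: weakly_locally_stationary_def)
  ultimately show ?thesis by (simp add: complex_eq_iff)
qed

lemma covar_approx:
  assumes wls: "weakly_locally_stationary P \<beta> R T\<^sub>0 X f" and T: "T\<^sub>0 \<le> real T"
  shows "\<bar>covar P (X t T) (X (t - l) T) - cov_deriv f (real_of_int t / real T) 0 l\<bar> \<le> R * real T powr (- min 1 \<beta>)"
proof -
  let ?z = "complex_of_real (covar P (X t T) (X (t - l) T)) - local_cov f (real_of_int t / real T) l"
  have "\<bar>Re ?z\<bar> \<le> norm ?z" by (rule abs_Re_le_cmod)
  also have "\<dots> \<le> R * real T powr (- min 1 \<beta>)"
    using wls T by (simp add: weakly_locally_stationary_def)
  finally show ?thesis
    using Re_local_cov[of f] wls by (simp add: weakly_locally_stationary_def)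
qed

section \<open>Coercivity of the local covariance matrix\<close>

lemma integral_cos_period:
  "(LINT \<xi>|lebesgue. period_ind \<xi> * cos (of_int l * \<xi>)) = (if l = 0 then 2 * pi else 0)"
proof (cases "l = 0")
  case True
  then show ?thesis by simp
next
  case False
  have "(LINT \<xi>|lebesgue. period_ind \<xi> * cos (of_int l * \<xi>)) = (LINT \<xi>|lborel. cos (of_int l * \<xi>) * period_ind \<xi>)"
    by (subst integral_completion) (simp_all add: mult.commute)
  also have "\<dots> = sin (of_int l * pi) / of_int l - sin (of_int l * (- pi)) / of_int l"
  proof (rule integral_FTC_Icc_real)
    fix x :: real
    show "((\<lambda>x. sin (of_int l * x) / of_int l) has_real_derivative cos (of_int l * x)) (at x)"
      using False by (auto intro!: derivative_eq_intros)
  qed auto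
  also have "\<dots> = 0"
    using sin_int_times_real[of l] by (simp add: sin_integer_2pi sin_npi_int mult.commute)
  finally show ?thesis using False by simp
qed

text \<open>The form is the integral of \<open>f\<close> against the squared modulus of the trigonometric polynomial with
  coefficients \<open>x\<close>; replacing \<open>f\<close> by its lower bound leaves Parseval's identity.\<close>

lemma cov_toep_coercive:
  assumes f: "local_spectral_density f" and low: "\<And>\<xi>. f_min \<le> f u \<xi>"
  shows "2 * pi * f_min * (\<Sum>i<d. (x i)\<^sup>2) \<le> toep_form d (cov_deriv f u 0) x"
proof -
  define P where "P \<xi> = (\<Sum>i<d. \<Sum>j<d. x i * x j * cos (of_int (int i - int j) * \<xi>))" for \<xi> :: real
  have P: "P \<xi> = (\<Sum>i<d. x i * cos (real i * \<xi>))\<^sup>2 + (\<Sum>i<d. x i * sin (real i * \<xi>))\<^sup>2" for \<xi>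
    unfolding P_def power2_eq_square sum_product sum.distrib[symmetric]
    by (intro sum.cong refl) (simp add: cos_diff left_diff_distrib algebra_simps)
  have cf: "integrable lebesgue (\<lambda>\<xi>. period_ind \<xi> * (cos (of_int l * \<xi>) * f u \<xi>))" for l :: int
  proof (rule Bochner_Integration.integrable_bound[OF density_measurable[OF f, of u]])
    show "(\<lambda>\<xi>. period_ind \<xi> * (cos (of_int l * \<xi>) * f u \<xi>)) \<in> borel_measurable lebesgue"
      by (intro cos_times_measurable borel_measurable_integrable density_measurable[OF f])
    show "AE \<xi> in lebesgue. norm (period_ind \<xi> * (cos (of_int l * \<xi>) * f u \<xi>)) \<le> norm (period_ind \<xi> * f u \<xi>)"
      by (intro AE_I2) (simp add: abs_mult indicator_def abs_cos_times_le[of _ "\<bar>f u _\<bar>", unfolded abs_mult])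
  qed
  have c1: "integrable lebesgue (\<lambda>\<xi>. period_ind \<xi> * cos (of_int l * \<xi>))" for l :: int
    by (rule period_bounded_integral(1)[of _ 1])
      (auto intro!: borel_measurable_lebesgueI)
  have sum_int: "(\<Sum>i<d. \<Sum>j<d. x i * x j * (LINT \<xi>|lebesgue. period_ind \<xi> * (cos (of_int (int i - int j) * \<xi>) * w \<xi>)))
       = (LINT \<xi>|lebesgue. period_ind \<xi> * (P \<xi> * w \<xi>))"
    and int: "integrable lebesgue (\<lambda>\<xi>. period_ind \<xi> * (P \<xi> * w \<xi>))"
    if w: "\<And>l :: int. integrable lebesgue (\<lambda>\<xi>. period_ind \<xi> * (cos (of_int l * \<xi>) * w \<xi>))" for w
  proof -
    have e: "period_ind \<xi> * (P \<xi> * w \<xi>) = (\<Sum>i<d. \<Sum>j<d. x i * x j * (period_ind \<xi> * (cos (of_int (int i - int j) * \<xi>) * w \<xi>)))" for \<xi>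
      unfolding P_def sum_distrib_left sum_distrib_right by (intro sum.cong refl) (simp add: mult_ac)
    show "integrable lebesgue (\<lambda>\<xi>. period_ind \<xi> * (P \<xi> * w \<xi>))"
      unfolding e by (intro Bochner_Integration.integrable_sum Bochner_Integration.integrable_mult_right w)
    show "(\<Sum>i<d. \<Sum>j<d. x i * x j * (LINT \<xi>|lebesgue. period_ind \<xi> * (cos (of_int (int i - int j) * \<xi>) * w \<xi>)))
       = (LINT \<xi>|lebesgue. period_ind \<xi> * (P \<xi> * w \<xi>))"
    proof -
      let ?t = "\<lambda>i j \<xi>. x i * x j * (period_ind \<xi> * (cos (of_int (int i - int j) * \<xi>) * w \<xi>))"
      have t: "integrable lebesgue (?t i j)" for i j
        by (intro Bochner_Integration.integrable_mult_right w)
      have "(LINT \<xi>|lebesgue. (\<Sum>i<d. \<Sum>j<d. ?t i j \<xi>)) = (\<Sum>i<d. (LINT \<xi>|lebesgue. (\<Sum>j<d. ?t i j \<xi>)))"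
        by (intro Bochner_Integration.integral_sum Bochner_Integration.integrable_sum t)
      also have "\<dots> = (\<Sum>i<d. \<Sum>j<d. (LINT \<xi>|lebesgue. ?t i j \<xi>))"
        by (intro sum.cong[OF refl] Bochner_Integration.integral_sum t)
      finally show ?thesis
        unfolding e by (simp only: Bochner_Integration.integral_mult_right_zero)
    qed
  qed
  have c2: "integrable lebesgue (\<lambda>\<xi>. period_ind \<xi> * (cos (of_int l * \<xi>) * f_min))" for l :: int
    using Bochner_Integration.integrable_mult_left[OF c1[of l], of f_min] by (simp add: mult.assoc)
  have "2 * pi * f_min * (\<Sum>i<d. (x i)\<^sup>2) = (\<Sum>i<d. \<Sum>j<d. x i * x j * (if i = j then 2 * pi * f_min else 0))"
    by (simp add: sum_distrib_left power2_eq_square if_distrib sum.delta cong: if_cong)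
      (simp add: mult_ac)
  also have "\<dots> = (\<Sum>i<d. \<Sum>j<d. x i * x j * (LINT \<xi>|lebesgue. period_ind \<xi> * (cos (of_int (int i - int j) * \<xi>) * f_min)))"
  proof (intro sum.cong refl arg_cong2[of _ _ _ _ "(*)"])
    fix i j
    have "(LINT \<xi>|lebesgue. period_ind \<xi> * (cos (of_int (int i - int j) * \<xi>) * f_min))
       = (LINT \<xi>|lebesgue. period_ind \<xi> * cos (of_int (int i - int j) * \<xi>)) * f_min"
      by (simp only: mult.assoc[symmetric]) simp
    then show "(if i = j then 2 * pi * f_min else 0) = (LINT \<xi>|lebesgue. period_ind \<xi> * (cos (of_int (int i - int j) * \<xi>) * f_min))"
      unfolding integral_cos_period by simp
  qed
  also have "\<dots> = (LINT \<xi>|lebesgue. period_ind \<xi> * (P \<xi> * f_min))"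
    by (rule sum_int[OF c2])
  also have "\<dots> \<le> (LINT \<xi>|lebesgue. period_ind \<xi> * (P \<xi> * f u \<xi>))"
    by (intro integral_mono int c2 cf mult_left_mono low) (auto simp: P)
  also have "\<dots> = (\<Sum>i<d. \<Sum>j<d. x i * x j * (LINT \<xi>|lebesgue. period_ind \<xi> * (cos (of_int (int i - int j) * \<xi>) * f u \<xi>)))"
    by (rule sum_int[OF cf, symmetric])
  also have "\<dots> = toep_form d (cov_deriv f u 0) x"
    by (simp add: toep_form_def toep_def cov_deriv_def sum_distrib_left mult_ac)
  finally show ?thesis .
qed

section \<open>The mean of the empirical covariances\<close>

definition rate :: "real \<Rightarrow> nat \<Rightarrow> nat \<Rightarrow> real" where
  "rate \<beta> M T = 1 / real M + (real M / real T) powr \<beta>"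

lemma rate_ge:
  assumes "0 < M"
  shows "1 / real M \<le> rate \<beta> M T" "(real M / real T) powr \<beta> \<le> rate \<beta> M T" "0 < rate \<beta> M T"
  using assms by (simp_all add: rate_def add_pos_nonneg)

text \<open>For \<open>\<beta> \<ge> 1\<close> the left-hand side is \<open>1 / T\<close>, which is at most \<open>1 / M\<close> if \<open>M \<le> T\<close>, and
  otherwise at most \<open>1\<close>, hence at most \<open>(M / T)\<^sup>\<beta>\<close>.\<close>

lemma stationarity_error_le_rate:
  assumes M: "0 < M" and T: "0 < T" and \<beta>: "0 < \<beta>"
  shows "real T powr (- min 1 \<beta>) \<le> rate \<beta> M T"
proof (cases "1 \<le> \<beta>")
  case True
  then have e: "real T powr (- min 1 \<beta>) = 1 / real T"
    using T by (simp add: powr_minus_divide min_def)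
  show ?thesis
  proof (cases "M \<le> T")
    case True
    then have "1 / real T \<le> 1 / real M"
      using M by (intro divide_left_mono) auto
    then show ?thesis unfolding e using rate_ge(1)[OF M, of \<beta> T] by linarith
  next
    case False
    have "1 / real T \<le> 1" using T by simp
    also have "1 \<le> (real M / real T) powr \<beta>"
      using False T True by (intro ge_one_powr_ge_zero) (auto simp: field_simps)
    finally show ?thesis unfolding e using rate_ge(2)[OF M, where \<beta> = \<beta> and T = T] by linarith
  qed
next
  case False
  have "real T powr (- min 1 \<beta>) = (1 / real T) powr \<beta>"
    using False T by (simp add: powr_minus_divide min_def powr_divide)
  also have "\<dots> \<le> (real M / real T) powr \<beta>"
    using M T \<beta> by (intro powr_mono2 divide_right_mono) auto
  also have "\<dots> \<le> rate \<beta> M T"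
    by (rule rate_ge(2)[OF M])
  finally show ?thesis .
qed

lemma integrable_product_of_squares:
  fixes U V :: "'w \<Rightarrow> real"
  assumes U: "U \<in> borel_measurable P" "integrable P (\<lambda>\<omega>. (U \<omega>)\<^sup>2)"
    and V: "V \<in> borel_measurable P" "integrable P (\<lambda>\<omega>. (V \<omega>)\<^sup>2)"
  shows "integrable P (\<lambda>\<omega>. U \<omega> * V \<omega>)"
proof (rule Bochner_Integration.integrable_bound[OF Bochner_Integration.integrable_add[OF U(2) V(2)]])
  show "(\<lambda>\<omega>. U \<omega> * V \<omega>) \<in> borel_measurable P"
    using U V by simp
  show "AE \<omega> in P. norm (U \<omega> * V \<omega>) \<le> norm ((U \<omega>)\<^sup>2 + (V \<omega>)\<^sup>2)"
  proof (intro AE_I2)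
    fix \<omega>
    have "0 \<le> (\<bar>U \<omega>\<bar> - \<bar>V \<omega>\<bar>)\<^sup>2" by simp
    then have "2 * \<bar>U \<omega> * V \<omega>\<bar> \<le> (U \<omega>)\<^sup>2 + (V \<omega>)\<^sup>2"
      by (simp add: power2_diff abs_mult)
    then show "norm (U \<omega> * V \<omega>) \<le> norm ((U \<omega>)\<^sup>2 + (V \<omega>)\<^sup>2)"
      using abs_ge_zero[of "U \<omega> * V \<omega>"] by simp
  qed
qed

text \<open>The coefficients of the expansion of the mean of the empirical covariance in powers of \<open>M / T\<close>.\<close>

definition bias_coeff :: "(real \<Rightarrow> real) \<Rightarrow> (real \<Rightarrow> real \<Rightarrow> real) \<Rightarrow> real \<Rightarrow> nat \<Rightarrow> int \<Rightarrow> real" where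
  "bias_coeff h f u j l = taper_moment h j * cov_deriv f u j l / fact j"

definition mean_error :: "nat \<Rightarrow> nat \<Rightarrow> real \<Rightarrow> real \<Rightarrow> real \<Rightarrow> real \<Rightarrow> real" where
  "mean_error N d b b' \<beta> R = (4 * pi + 1) * R + (\<beta> + 1) * (2 * pi * R) * (4 * moment_error N d b b' \<beta>)"

text \<open>The hypotheses of the theorem on the array, its spectral density and the taper. That on the
  fluctuations is kept apart, since it enters only through moments of the noise.\<close>

locale stationary_setup =
  fixes P :: "'w measure" and \<beta> R f_min \<alpha> T\<^sub>0 :: real and k :: nat
    and X :: "int \<Rightarrow> nat \<Rightarrow> 'w \<Rightarrow> real" and f :: "real \<Rightarrow> real \<Rightarrow> real"
    and N :: nat and s :: "nat \<Rightarrow> real" and h :: "real \<Rightarrow> real"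
  assumes R: "0 < R" and f_min: "0 < f_min"
    and \<beta>: "\<beta> = real k + \<alpha>" "0 < \<alpha>" "\<alpha> \<le> 1"
    and T0: "0 < T\<^sub>0"
    and mean_zero: "\<And>t T. T\<^sub>0 \<le> real T \<Longrightarrow> (\<integral>\<omega>. X t T \<omega> \<partial>P) = 0"
    and wls: "weakly_locally_stationary P \<beta> R T\<^sub>0 X f"
    and f_low: "\<And>u \<xi>. f_min \<le> f u \<xi>"
    and taper: "taper N s h"
begin

abbreviation "b \<equiv> taper_norm h"
abbreviation "b' \<equiv> taper_deriv_norm N s h"

lemma \<beta>_pos: "0 < \<beta>" and k_le: "real k \<le> \<beta>" "\<beta> \<le> real k + 1"
  using \<beta> by auto

lemma density: "local_spectral_density f" and hol: "(\<lambda>u. f u \<xi>) \<in> holder_ball \<beta> R"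
  using wls by (simp_all add: weakly_locally_stationary_def)

lemma X_measurable: "T\<^sub>0 \<le> real T \<Longrightarrow> X t T \<in> borel_measurable P"
  and X_square_integrable: "T\<^sub>0 \<le> real T \<Longrightarrow> integrable P (\<lambda>\<omega>. (X t T \<omega>)\<^sup>2)"
  using wls by (simp_all add: weakly_locally_stationary_def)

lemma cov_bound: "j \<le> k \<Longrightarrow> \<bar>cov_deriv f u j l\<bar> \<le> 2 * pi * R"
  using cov_deriv_abs_le(2)[OF density hol _ \<beta>] R by simp

lemma moment_error_nonneg: "0 \<le> moment_error N d b b' \<beta>"
proof -
  have "0 \<le> variation_bound N b b'"
    using taper_variation_range[OF taper, of 0] by linarith
  then show ?thesis
    unfolding moment_error_def using taper_norm_nonneg[OF taper] \<beta>_pos by simp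
qed

lemma mean_error_pos: "0 < mean_error N d b b' \<beta> R"
proof -
  have "0 < (4 * pi + 1) * R"
    using R by (intro mult_pos_pos add_pos_pos) auto
  then show ?thesis
    unfolding mean_error_def using R moment_error_nonneg[of d] \<beta>_pos
    by (intro add_pos_nonneg mult_nonneg_nonneg) auto
qed

lemma emp_cov_measurable:
  assumes "T\<^sub>0 \<le> real T"
  shows "(\<lambda>\<omega>. emp_cov h X T M u l \<omega>) \<in> borel_measurable P"
  unfolding emp_cov_grid
  by (intro borel_measurable_divide borel_measurable_sum borel_measurable_times borel_measurable_const
      X_measurable assms)

lemma emp_cov_mean:
  assumes T: "T\<^sub>0 \<le> real T"
  shows "(\<integral>\<omega>. emp_cov h X T M (real_of_int t / real T) l \<omega> \<partial>P)
    = (\<Sum>i\<in>{1..int M}. grid h M i * grid h M (i - l) *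
        covar P (X (t + i - int (M div 2)) T) (X (t + i - int (M div 2) - l) T)) / taper_mass h M"
proof -
  have T1: "0 < real T" using T T0 by linarith
  then have fl: "\<lfloor>real_of_int t / real T * real T\<rfloor> = t" by simp
  have int: "integrable P (\<lambda>\<omega>. X i T \<omega> * X i' T \<omega>)" for i i'
    by (intro integrable_product_of_squares X_measurable X_square_integrable T)
  have "(\<integral>\<omega>. emp_cov h X T M (real_of_int t / real T) l \<omega> \<partial>P)
    = (\<integral>\<omega>. (\<Sum>i\<in>{1..int M}. grid h M i * grid h M (i - l) *
        (X (t + i - int (M div 2)) T \<omega> * X (t + (i - l) - int (M div 2)) T \<omega>)) \<partial>P) / taper_mass h M"
    unfolding emp_cov_grid fl by (rule integral_divide_zero)
  also have "(\<integral>\<omega>. (\<Sum>i\<in>{1..int M}. grid h M i * grid h M (i - l) *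
        (X (t + i - int (M div 2)) T \<omega> * X (t + (i - l) - int (M div 2)) T \<omega>)) \<partial>P)
    = (\<Sum>i\<in>{1..int M}. (\<integral>\<omega>. grid h M i * grid h M (i - l) *
        (X (t + i - int (M div 2)) T \<omega> * X (t + (i - l) - int (M div 2)) T \<omega>) \<partial>P))"
    by (intro Bochner_Integration.integral_sum Bochner_Integration.integrable_mult_right int)
  also have "\<dots> = (\<Sum>i\<in>{1..int M}. grid h M i * grid h M (i - l) *
        covar P (X (t + i - int (M div 2)) T) (X (t + i - int (M div 2) - l) T))"
  proof (intro sum.cong refl)
    fix i
    have "t + (i - l) - int (M div 2) = t + i - int (M div 2) - l" by simp
    then show "(\<integral>\<omega>. grid h M i * grid h M (i - l) *
        (X (t + i - int (M div 2)) T \<omega> * X (t + (i - l) - int (M div 2)) T \<omega>) \<partial>P)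
      = grid h M i * grid h M (i - l) * covar P (X (t + i - int (M div 2)) T) (X (t + i - int (M div 2) - l) T)"
      by (simp only: covar_def mean_zero[OF T]) simp
  qed
  finally show ?thesis .
qed

text \<open>The observation with index \<open>i\<close> in the block has rescaled time \<open>u + w x\<close>, where \<open>w = i / M - 1 / 2\<close>; here
  evenness of \<open>M\<close> enters.\<close>

lemma covar_expansion:
  assumes T: "T\<^sub>0 \<le> real T" and M: "0 < M" "even M" and i: "i \<in> {1..int M}"
  shows "\<bar>covar P (X (t + i - int (M div 2)) T) (X (t + i - int (M div 2) - l) T)
      - (\<Sum>j\<le>k. cov_deriv f (real_of_int t / real T) j l * ((real_of_int i / real M - 1 / 2) * (real M / real T)) ^ j / fact j)\<bar>
    \<le> (4 * pi + 1) * R * rate \<beta> M T"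
proof -
  have T1: "0 < real T" using T T0 by linarith
  let ?w = "real_of_int i / real M - 1 / 2" and ?x = "real M / real T" and ?u = "real_of_int t / real T"
  have half: "real_of_int (int (M div 2)) = real M / 2"
    using M(2) by (auto elim: evenE)
  have pos: "real_of_int (t + i - int (M div 2)) / real T = ?u + ?w * ?x"
    unfolding of_int_diff of_int_add half using M T1 by (simp add: field_simps)
  have w: "\<bar>?w\<bar> \<le> 1"
    using half_centred_power_le[of "real_of_int i / real M" 1] i M by (simp add: field_simps)
  have "\<bar>covar P (X (t + i - int (M div 2)) T) (X (t + i - int (M div 2) - l) T) - cov_deriv f (?u + ?w * ?x) 0 l\<bar>
      \<le> R * real T powr (- min 1 \<beta>)"
    using covar_approx[OF wls T, of "t + i - int (M div 2)" l] unfolding pos .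
  also have "\<dots> \<le> R * rate \<beta> M T"
    using R T1 by (intro mult_left_mono stationarity_error_le_rate M \<beta>_pos) auto
  finally have 1: "\<bar>covar P (X (t + i - int (M div 2)) T) (X (t + i - int (M div 2) - l) T) - cov_deriv f (?u + ?w * ?x) 0 l\<bar>
      \<le> R * rate \<beta> M T" .
  have "\<bar>cov_deriv f (?u + ?w * ?x) 0 l - (\<Sum>j\<le>k. cov_deriv f ?u j l * (?w * ?x) ^ j / fact j)\<bar>
      \<le> 4 * pi * R * \<bar>?w * ?x\<bar> powr \<beta>"
    using R by (intro cov_deriv_taylor[OF density hol _ \<beta>]) simp
  also have "\<dots> \<le> 4 * pi * R * ?x powr \<beta>"
  proof (intro mult_left_mono powr_mono2)
    show "\<bar>?w * ?x\<bar> \<le> ?x"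
      using mult_right_mono[OF w, of ?x] by (simp add: abs_mult)
  qed (use R \<beta>_pos in auto)
  also have "\<dots> \<le> 4 * pi * R * rate \<beta> M T"
    using R by (intro mult_left_mono rate_ge M) auto
  finally have 2: "\<bar>cov_deriv f (?u + ?w * ?x) 0 l - (\<Sum>j\<le>k. cov_deriv f ?u j l * (?w * ?x) ^ j / fact j)\<bar>
      \<le> 4 * pi * R * rate \<beta> M T" .
  have "(4 * pi + 1) * R * rate \<beta> M T = 4 * pi * R * rate \<beta> M T + R * rate \<beta> M T"
    by (simp add: algebra_simps)
  then show ?thesis using 1 2 by linarith
qed

text \<open>Averaging the Taylor polynomials of the covariances with the weights of the estimator produces
  normalized lagged moments of the taper, which converge to the moments in \<open>bias_coeff\<close> at rate
  \<open>1 / M\<close>.\<close>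

lemma emp_cov_mean_expansion:
  assumes T: "T\<^sub>0 \<le> real T" and M: "0 < M" "even M" and l: "\<bar>l\<bar> \<le> int d"
    and large: "moment_error N d b b' \<beta> / real M \<le> 1 / 2" and x1: "real M / real T \<le> 1"
  shows "\<bar>(\<integral>\<omega>. emp_cov h X T M (real_of_int t / real T) l \<omega> \<partial>P)
      - (\<Sum>j\<le>k. bias_coeff h f (real_of_int t / real T) j l * (real M / real T) ^ j)\<bar>
    \<le> mean_error N d b b' \<beta> R * rate \<beta> M T"
proof -
  let ?u = "real_of_int t / real T" and ?x = "real M / real T" and ?H = "taper_mass h M"
  let ?w = "\<lambda>i. real_of_int i / real M - 1 / 2"
  let ?g = "\<lambda>i. grid h M i * grid h M (i - l)"
  let ?C = "\<lambda>i. covar P (X (t + i - int (M div 2)) T) (X (t + i - int (M div 2) - l) T)"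
  let ?p = "\<lambda>i. \<Sum>j\<le>k. cov_deriv f ?u j l * (?w i * ?x) ^ j / fact j"
  let ?c = "\<lambda>j. cov_deriv f ?u j l / fact j * ?x ^ j"
  let ?e = "moment_error N d b b' \<beta>"
  have H: "0 < ?H"
    using normalized_lagged_moment_error(1)[OF taper M(1) l _ large, of 0] \<beta>_pos by simp
  have x0: "0 \<le> ?x" by simp
  have split: "(\<Sum>i\<in>{1..int M}. ?g i * ?p i) = (\<Sum>j\<le>k. ?c j * lagged_moment h M l j)"
    unfolding lagged_moment_def sum_distrib_left power_mult_distrib
    by (subst sum.swap) (intro sum.cong refl, simp add: power_mult_distrib mult_ac)
  have "\<bar>(\<Sum>i\<in>{1..int M}. ?g i * ?C i) - (\<Sum>i\<in>{1..int M}. ?g i * ?p i)\<bar>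
      \<le> (\<Sum>i\<in>{1..int M}. \<bar>?g i\<bar> * \<bar>?C i - ?p i\<bar>)"
    unfolding sum_subtractf[symmetric] right_diff_distrib[symmetric]
    by (rule order_trans[OF sum_abs]) (simp add: abs_mult)
  also have "\<dots> \<le> (\<Sum>i\<in>{1..int M}. \<bar>?g i\<bar> * ((4 * pi + 1) * R * rate \<beta> M T))"
    by (intro sum_mono mult_left_mono covar_expansion T M) auto
  also have "\<dots> \<le> ?H * ((4 * pi + 1) * R * rate \<beta> M T)"
    unfolding sum_distrib_right[symmetric]
    using R rate_ge(3)[OF M(1), of \<beta> T] by (intro mult_right_mono sum_grid_lag_le_taper_mass) auto
  finally have "\<bar>(\<Sum>i\<in>{1..int M}. ?g i * ?C i) - (\<Sum>i\<in>{1..int M}. ?g i * ?p i)\<bar> / ?H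
      \<le> ?H * ((4 * pi + 1) * R * rate \<beta> M T) / ?H"
    using H by (intro divide_right_mono) auto
  then have 1: "\<bar>(\<Sum>i\<in>{1..int M}. ?g i * ?C i) / ?H - (\<Sum>i\<in>{1..int M}. ?g i * ?p i) / ?H\<bar>
      \<le> (4 * pi + 1) * R * rate \<beta> M T"
    using H by (simp add: diff_divide_distrib[symmetric] abs_divide)
  have "\<bar>(\<Sum>j\<le>k. ?c j * lagged_moment h M l j) / ?H - (\<Sum>j\<le>k. ?c j * taper_moment h j)\<bar>
     = \<bar>\<Sum>j\<le>k. ?c j * (lagged_moment h M l j / ?H - taper_moment h j)\<bar>"
    by (simp add: sum_divide_distrib sum_subtractf right_diff_distrib)
  also have "\<dots> \<le> (\<Sum>j\<le>k. (2 * pi * R) * (4 * ?e / real M))"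
  proof (intro order_trans[OF sum_abs] sum_mono)
    fix j assume "j \<in> {..k}"
    then have j: "j \<le> k" by simp
    have "\<bar>cov_deriv f ?u j l\<bar> / fact j \<le> 2 * pi * R / 1"
      using cov_bound[OF j] R by (intro frac_le) (auto simp: fact_ge_1)
    then have "\<bar>cov_deriv f ?u j l\<bar> / fact j * ?x ^ j \<le> 2 * pi * R * 1"
      using x0 x1 R by (intro mult_mono power_le_one) auto
    then have "\<bar>?c j\<bar> \<le> 2 * pi * R"
      by (simp add: abs_mult)
    moreover have "\<bar>lagged_moment h M l j / ?H - taper_moment h j\<bar> \<le> 4 * ?e / real M"
      using j k_le by (intro normalized_lagged_moment_error(2)[OF taper M(1) l _ large]) simp
    ultimately show "\<bar>?c j * (lagged_moment h M l j / ?H - taper_moment h j)\<bar> \<le> (2 * pi * R) * (4 * ?e / real M)"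
      unfolding abs_mult[of "?c j"] using R by (intro mult_mono) auto
  qed
  also have "\<dots> = (real k + 1) * (2 * pi * R) * (4 * ?e) * (1 / real M)"
    by simp
  also have "\<dots> \<le> (\<beta> + 1) * (2 * pi * R) * (4 * ?e) * rate \<beta> M T"
    using R k_le \<beta>_pos moment_error_nonneg[of d] rate_ge(1)[OF M(1), of \<beta> T] by (intro mult_mono) auto
  finally have 2: "\<bar>(\<Sum>i\<in>{1..int M}. ?g i * ?p i) / ?H - (\<Sum>j\<le>k. ?c j * taper_moment h j)\<bar>
      \<le> (\<beta> + 1) * (2 * pi * R) * (4 * ?e) * rate \<beta> M T"
    unfolding split .
  have 3: "(\<Sum>j\<le>k. bias_coeff h f ?u j l * ?x ^ j) = (\<Sum>j\<le>k. ?c j * taper_moment h j)"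
    by (simp add: bias_coeff_def mult_ac)
  have "mean_error N d b b' \<beta> R * rate \<beta> M T
     = (4 * pi + 1) * R * rate \<beta> M T + (\<beta> + 1) * (2 * pi * R) * (4 * ?e) * rate \<beta> M T"
    by (simp add: mean_error_def algebra_simps)
  then show ?thesis
    unfolding 3 emp_cov_mean[OF T] using 1 2 by linarith
qed

lemma bias_coeff_bound: "j \<le> k \<Longrightarrow> \<bar>bias_coeff h f u j l\<bar> \<le> 2 * pi * R"
proof -
  assume j: "j \<le> k"
  have "\<bar>bias_coeff h f u j l\<bar> = \<bar>taper_moment h j\<bar> * \<bar>cov_deriv f u j l\<bar> / fact j"
    by (simp add: bias_coeff_def abs_mult)
  also have "\<dots> \<le> 1 * (2 * pi * R) / 1"
    using taper_moment_abs_le[OF taper] cov_bound[OF j] R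
    by (intro frac_le mult_mono) (auto simp: fact_ge_1)
  finally show ?thesis by simp
qed

lemma bias_coeff_0: "bias_coeff h f u 0 = cov_deriv f u 0"
  by (rule ext) (simp add: bias_coeff_def taper_moment_0[OF taper])

lemma bias_coeff_coercive: "2 * pi * f_min * (\<Sum>i<d. (x i)\<^sup>2) \<le> toep_form d (bias_coeff h f u 0) x"
  unfolding bias_coeff_0 by (rule cov_toep_coercive[OF density f_low])

end

section \<open>Expansion of the solution of a perturbed Toeplitz system\<close>

text \<open>If \<open>g\<close> has the expansion \<open>\<Sum>n. b n * x ^ n\<close>, these are the coefficients of the formal power series
  solution of the Yule--Walker equations for \<open>g\<close>.\<close>

function pred_coeff :: "nat \<Rightarrow> (nat \<Rightarrow> int \<Rightarrow> real) \<Rightarrow> nat \<Rightarrow> nat \<Rightarrow> real" where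
  "pred_coeff d b n = toep_solve d (b 0) (\<lambda>i. b n (int i + 1) - (\<Sum>m\<in>{..<n}. toep d (b (n - m)) (pred_coeff d b m) i))"
  by pat_completeness auto
termination by (relation "Wellfounded.measure (\<lambda>(d, b, n). n)") auto

declare pred_coeff.simps [simp del]

text \<open>With \<open>S\<close> the factor in front of the power, the coefficients of order at most \<open>k\<close> are bounded by
  \<open>S (1 + S)\<^sup>k\<close>; the exponent \<open>\<beta>\<close> makes the bound continuous in \<open>\<beta>\<close>.\<close>

definition coeff_bound :: "nat \<Rightarrow> real \<Rightarrow> real \<Rightarrow> real" where
  "coeff_bound d r \<beta> = (real d)\<^sup>2 * r * (1 + (real d)\<^sup>2 * r) powr \<beta>"

locale expansion =
  fixes d k :: nat and b :: "nat \<Rightarrow> int \<Rightarrow> real" and \<kappa> G :: real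
  assumes \<kappa>: "0 < \<kappa>" and G: "0 \<le> G" and d: "1 \<le> d"
    and coercive: "\<And>x. \<kappa> * (\<Sum>i<d. (x i)\<^sup>2) \<le> toep_form d (b 0) x"
    and bound: "\<And>j l. j \<le> k \<Longrightarrow> \<bar>b j l\<bar> \<le> G"
begin

definition "S = (real d)\<^sup>2 * (G / \<kappa>)"
definition "\<Theta> x i = (\<Sum>n\<le>k. pred_coeff d b n i * x ^ n)"

lemma S_nonneg: "0 \<le> S" and dG_nonneg: "0 \<le> real d * G"
  unfolding S_def using \<kappa> G by auto

lemma pos: "toep_pos d (b 0)"
  by (rule coercive_imp_toep_pos[OF coercive \<kappa>])

lemma pred_coeff_eq:
  assumes "i < d"
  shows "(\<Sum>m\<le>n. toep d (b (n - m)) (pred_coeff d b m) i) = b n (int i + 1)"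
proof -
  have "toep d (b 0) (pred_coeff d b n) i
      = b n (int i + 1) - (\<Sum>m<n. toep d (b (n - m)) (pred_coeff d b m) i)"
    by (subst pred_coeff.simps) (rule toep_solve[OF pos assms])
  moreover have "{..n} = insert n {..<n}" by auto
  ultimately show ?thesis by simp
qed

text \<open>By coercivity, the coefficient of order \<open>n\<close> is at most \<open>S\<close> times one plus the sum of the bounds of
  the preceding ones, and \<open>S (1 + S) ^ n\<close> is the solution of this recursion.\<close>

lemma pred_coeff_bound:
  assumes "n \<le> k" "i < d"
  shows "\<bar>pred_coeff d b n i\<bar> \<le> S * (1 + S) ^ n"
  using assms
proof (induction n arbitrary: i rule: less_induct)
  case (less n)
  have geom: "1 + (\<Sum>m<n. S * (1 + S) ^ m) = (1 + S) ^ n" for n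
    by (induction n) (simp_all add: algebra_simps)
  have "\<bar>pred_coeff d b n i\<bar> \<le> real d * (G + (\<Sum>m<n. real d * G * (S * (1 + S) ^ m))) / \<kappa>"
  proof (rule coercive_solution_bound[OF coercive \<kappa> _ less.prems(2)])
    fix i assume i: "i < d"
    have "toep d (b 0) (pred_coeff d b n) i
        = b n (int i + 1) - (\<Sum>m<n. toep d (b (n - m)) (pred_coeff d b m) i)"
      by (subst pred_coeff.simps) (rule toep_solve[OF pos i])
    also have "\<bar>\<dots>\<bar> \<le> \<bar>b n (int i + 1)\<bar> + (\<Sum>m<n. \<bar>toep d (b (n - m)) (pred_coeff d b m) i\<bar>)"
      by (intro order_trans[OF abs_triangle_ineq4] add_left_mono sum_abs)
    also have "\<dots> \<le> G + (\<Sum>m<n. real d * G * (S * (1 + S) ^ m))"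
      using less by (intro add_mono sum_mono abs_toep_le bound G) auto
    finally show "\<bar>toep d (b 0) (pred_coeff d b n) i\<bar> \<le> G + (\<Sum>m<n. real d * G * (S * (1 + S) ^ m))" .
  qed
  also have "G + (\<Sum>m<n. real d * G * (S * (1 + S) ^ m)) \<le> real d * G * (1 + (\<Sum>m<n. S * (1 + S) ^ m))"
  proof -
    have "G * 1 \<le> G * real d"
      using d G by (intro mult_left_mono) auto
    then show ?thesis
      unfolding distrib_left sum_distrib_left by (simp add: mult.commute)
  qed
  then have "real d * (G + (\<Sum>m<n. real d * G * (S * (1 + S) ^ m))) / \<kappa> \<le> real d * (real d * G * (1 + S) ^ n) / \<kappa>"
    unfolding geom using \<kappa> by (intro divide_right_mono mult_left_mono) auto
  also have "\<dots> = S * (1 + S) ^ n"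
    by (simp add: S_def power2_eq_square)
  finally show ?case .
qed

lemma pred_coeff_bound_uniform:
  assumes "n \<le> k" "i < d"
  shows "\<bar>pred_coeff d b n i\<bar> \<le> S * (1 + S) ^ k"
  using pred_coeff_bound[OF assms] power_increasing[OF assms(1), of "1 + S"] S_nonneg
  by (meson add_increasing2 mult_left_mono order_refl order_trans)

lemma expansion_bound:
  assumes "i < d" "0 \<le> x"
  shows "\<bar>\<Theta> x i\<bar> \<le> (real k + 1) * (S * (1 + S) ^ k) * max 1 (x ^ k)"
proof -
  have "\<bar>\<Theta> x i\<bar> \<le> (\<Sum>n\<le>k. \<bar>pred_coeff d b n i * x ^ n\<bar>)"
    unfolding \<Theta>_def by (rule sum_abs)
  also have "\<dots> \<le> (\<Sum>n\<le>k. (S * (1 + S) ^ k) * max 1 (x ^ k))"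
    unfolding abs_mult
  proof (intro sum_mono mult_mono)
    fix n assume n: "n \<in> {..k}"
    then show "\<bar>pred_coeff d b n i\<bar> \<le> S * (1 + S) ^ k"
      using assms by (intro pred_coeff_bound_uniform) auto
    show "\<bar>x ^ n\<bar> \<le> max 1 (x ^ k)"
    proof (cases "x \<le> 1")
      case True
      then show ?thesis using power_le_one[of x n] assms by (simp add: power_abs le_max_iff_disj)
    next
      case False
      then show ?thesis using power_increasing[of n k x] n assms by (simp add: power_abs le_max_iff_disj)
    qed
  qed (use S_nonneg in auto)
  also have "\<dots> = (real k + 1) * (S * (1 + S) ^ k) * max 1 (x ^ k)" by simp
  finally show ?thesis .
qed

text \<open>Multiplying the truncated series, all terms of order at most \<open>k\<close> cancel by construction.\<close>

lemma expansion_residual: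
  assumes i: "i < d" and x: "0 \<le> x" "x \<le> 1"
  shows "\<bar>(\<Sum>j\<le>k. b j (int i + 1) * x ^ j) - toep d (\<lambda>l. \<Sum>j\<le>k. b j l * x ^ j) (\<Theta> x) i\<bar>
    \<le> (real k + 1)\<^sup>2 * (real d * G * (S * (1 + S) ^ k)) * x ^ (k + 1)"
proof -
  define t where "t j m = x ^ (j + m) * toep d (b j) (pred_coeff d b m) i" for j m
  \<comment> \<open>all products of the truncated series, and those of total order at most \<open>k\<close>\<close>
  define A where "A = {..k} \<times> {..k}"
  define B where "B = {(j, m). j + m \<le> k}"
  have B: "B \<subseteq> A" "finite A" by (auto simp: A_def B_def)
  have 1: "toep d (\<lambda>l. \<Sum>j\<le>k. b j l * x ^ j) (\<Theta> x) i = (\<Sum>(j, m)\<in>A. t j m)"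
  proof -
    have "toep d (\<lambda>l. \<Sum>j\<le>k. b j l * x ^ j) (\<Theta> x) i
       = (\<Sum>p<d. \<Sum>(j, m)\<in>A. (b j (int i - int p) * x ^ j) * (pred_coeff d b m p * x ^ m))"
      unfolding toep_def \<Theta>_def sum_product A_def sum.cartesian_product ..
    also have "\<dots> = (\<Sum>(j, m)\<in>A. \<Sum>p<d. (b j (int i - int p) * x ^ j) * (pred_coeff d b m p * x ^ m))"
      by (subst sum.swap) (simp add: case_prod_unfold)
    also have "\<dots> = (\<Sum>(j, m)\<in>A. t j m)"
      unfolding t_def toep_def sum_distrib_left
      by (intro sum.cong refl) (auto simp: power_add mult_ac intro!: sum.cong)
    finally show ?thesis .
  qed
  have 2: "(\<Sum>j\<le>k. b j (int i + 1) * x ^ j) = (\<Sum>(j, m)\<in>B. t j m)"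
  proof -
    have "(\<Sum>(j, m)\<in>B. t j m) = (\<Sum>(m, j)\<in>B. t j m)"
      by (rule sum.reindex_bij_witness[of _ "\<lambda>(j, m). (m, j)" "\<lambda>(j, m). (m, j)"]) (auto simp: B_def)
    also have "\<dots> = (\<Sum>n\<le>k. \<Sum>m\<le>n. t (n - m) m)"
      unfolding B_def by (rule sum.triangle_reindex_eq)
    also have "\<dots> = (\<Sum>n\<le>k. x ^ n * (\<Sum>m\<le>n. toep d (b (n - m)) (pred_coeff d b m) i))"
      unfolding sum_distrib_left by (intro sum.cong refl) (simp add: t_def)
    also have "\<dots> = (\<Sum>j\<le>k. b j (int i + 1) * x ^ j)"
      unfolding pred_coeff_eq[OF i] by (simp add: mult.commute)
    finally show ?thesis ..
  qed
  have "(\<Sum>(j, m)\<in>A. t j m) = (\<Sum>(j, m)\<in>A - B. t j m) + (\<Sum>(j, m)\<in>B. t j m)"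
    by (rule sum.subset_diff[OF B])
  then have "\<bar>(\<Sum>j\<le>k. b j (int i + 1) * x ^ j) - toep d (\<lambda>l. \<Sum>j\<le>k. b j l * x ^ j) (\<Theta> x) i\<bar>
      = \<bar>\<Sum>(j, m)\<in>A - B. t j m\<bar>"
    unfolding 1 2 by simp
  also have "\<dots> \<le> (\<Sum>p\<in>A - B. \<bar>case p of (j, m) \<Rightarrow> t j m\<bar>)"
    by (rule sum_abs)
  also have "\<dots> \<le> (\<Sum>p\<in>A - B. x ^ (k + 1) * (real d * G * (S * (1 + S) ^ k)))"
  proof (rule sum_mono)
    fix p assume p: "p \<in> A - B"
    obtain j m where jm: "p = (j, m)" by (cases p)
    have jm': "j \<le> k" "m \<le> k" "k + 1 \<le> j + m"
      using p jm by (auto simp: A_def B_def)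
    have "\<bar>t j m\<bar> \<le> x ^ (k + 1) * (real d * G * (S * (1 + S) ^ k))"
      unfolding t_def abs_mult
    proof (rule mult_mono)
      show "\<bar>x ^ (j + m)\<bar> \<le> x ^ (k + 1)"
        using power_decreasing[OF jm'(3), of x] x by (simp add: power_abs)
      show "\<bar>toep d (b j) (pred_coeff d b m) i\<bar> \<le> real d * G * (S * (1 + S) ^ k)"
        using jm' by (intro abs_toep_le bound pred_coeff_bound_uniform G)
    qed (use x in auto)
    then show "\<bar>case p of (j, m) \<Rightarrow> t j m\<bar> \<le> x ^ (k + 1) * (real d * G * (S * (1 + S) ^ k))"
      by (simp add: jm)
  qed
  also have "\<dots> = real (card (A - B)) * (x ^ (k + 1) * (real d * G * (S * (1 + S) ^ k)))"
    by simp
  also have "\<dots> \<le> (real k + 1)\<^sup>2 * (x ^ (k + 1) * (real d * G * (S * (1 + S) ^ k)))"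
  proof (rule mult_right_mono)
    have "card (A - B) \<le> card A" by (rule card_mono[OF B(2)]) auto
    also have "card A = (k + 1) * (k + 1)" by (simp add: A_def)
    finally have "real (card (A - B)) \<le> real ((k + 1) * (k + 1))" by (rule of_nat_mono)
    then show "real (card (A - B)) \<le> (real k + 1)\<^sup>2"
      by (simp add: power2_eq_square algebra_simps)
    show "0 \<le> x ^ (k + 1) * (real d * G * (S * (1 + S) ^ k))"
      using x dG_nonneg S_nonneg by simp
  qed
  finally show ?thesis by (simp add: mult_ac)
qed

text \<open>Here \<open>g\<close> stands for the empirical covariances, \<open>gm\<close> for their means, and \<open>\<theta>\<close> for the solution of
  the empirical system. Applying the matrix of \<open>gm\<close>, which is still coercive, to \<open>\<theta> - \<Theta> x\<close> leaves the
  fluctuation \<open>g - gm\<close> multiplied by bounded quantities, the residual of the truncated series, and the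
  error of the expansion of \<open>gm\<close>.\<close>

lemma solution_error:
  assumes eq: "\<And>i. i < d \<Longrightarrow> toep d g \<theta> i = g (int i + 1)"
    and \<theta>: "\<And>i. i < d \<Longrightarrow> \<bar>\<theta> i\<bar> \<le> B"
    and gm: "\<And>l. \<bar>l\<bar> \<le> int d \<Longrightarrow> \<bar>gm l - (\<Sum>j\<le>k. b j l * x ^ j)\<bar> \<le> \<rho>"
    and e: "\<And>l. \<bar>l\<bar> \<le> int d \<Longrightarrow> \<bar>g l - gm l\<bar> \<le> e"
    and x: "0 \<le> x" "x \<le> 1" and small: "real d * (real k * G * x + \<rho>) \<le> \<kappa> / 2" and i: "i < d"
  shows "\<bar>\<theta> i - \<Theta> x i\<bar> \<le> 2 * real d / \<kappa> * ((1 + real d * B) * e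
      + (real k + 1)\<^sup>2 * (real d * G * (S * (1 + S) ^ k)) * x ^ (k + 1)
      + (1 + real d * ((real k + 1) * (S * (1 + S) ^ k))) * \<rho>)"
proof -
  let ?p = "\<lambda>l. \<Sum>j\<le>k. b j l * x ^ j"
  let ?A = "(real k + 1) * (S * (1 + S) ^ k)"
  let ?r = "(real k + 1)\<^sup>2 * (real d * G * (S * (1 + S) ^ k)) * x ^ (k + 1)"
  have e0: "0 \<le> e" using e[of 0] by linarith
  have \<rho>0: "0 \<le> \<rho>" using gm[of 0] by linarith
  have B0: "0 \<le> B" using \<theta>[OF i] by linarith
  have A: "\<bar>\<Theta> x i\<bar> \<le> ?A" if "i < d" for i
    using expansion_bound[OF that x(1)] power_le_one[OF x, of k] by (simp add: max_def split: if_splits)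
  have diff0: "\<bar>gm l - b 0 l\<bar> \<le> real k * G * x + \<rho>" if "\<bar>l\<bar> \<le> int d" for l
  proof -
    have "{..k} = insert 0 {1..k}" by auto
    then have "?p l - b 0 l = (\<Sum>j\<in>{1..k}. b j l * x ^ j)" by simp
    also have "\<bar>\<dots>\<bar> \<le> (\<Sum>j\<in>{1..k}. G * x)"
    proof (intro order_trans[OF sum_abs] sum_mono)
      fix j assume j: "j \<in> {1..k}"
      have "\<bar>b j l\<bar> * \<bar>x ^ j\<bar> \<le> G * x"
        using bound[of j l] j x G power_decreasing[of 1 j x] by (intro mult_mono) (auto simp: power_abs)
      then show "\<bar>b j l * x ^ j\<bar> \<le> G * x" by (simp add: abs_mult)
    qed
    also have "\<dots> = real k * G * x" by simp
    finally show ?thesis using gm[OF that] by linarith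
  qed
  have co: "\<kappa> / 2 * (\<Sum>i<d. (y i)\<^sup>2) \<le> toep_form d gm y" for y
  proof -
    let ?n = "\<Sum>i<d. (y i)\<^sup>2"
    have "\<bar>toep_form d gm y - toep_form d (b 0) y\<bar> \<le> real d * (real k * G * x + \<rho>) * ?n"
      by (rule toep_form_perturb[OF diff0])
    also have "\<dots> \<le> \<kappa> / 2 * ?n"
      by (intro mult_right_mono small sum_nonneg) auto
    finally have "toep_form d (b 0) y - \<kappa> / 2 * ?n \<le> toep_form d gm y" by linarith
    then show ?thesis using coercive[of y] by (simp add: field_simps)
  qed
  have "\<bar>\<theta> i - \<Theta> x i\<bar> \<le> real d * ((1 + real d * B) * e + ?r + (1 + real d * ?A) * \<rho>) / (\<kappa> / 2)"
  proof (rule coercive_solution_bound[of "\<kappa> / 2" d gm "\<lambda>i. \<theta> i - \<Theta> x i", OF co _ _ i])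
    fix i assume i: "i < d"
    have lags: "\<bar>int i - int j\<bar> \<le> int d" if "j < d" for j
      using that i by auto
    have "toep d gm (\<lambda>i. \<theta> i - \<Theta> x i) i
      = (g (int i + 1) - gm (int i + 1)) - toep d (\<lambda>l. g l - gm l) \<theta> i
        + (?p (int i + 1) - toep d ?p (\<Theta> x) i)
        + (gm (int i + 1) - ?p (int i + 1)) - toep d (\<lambda>l. gm l - ?p l) (\<Theta> x) i"
      unfolding toep_diff toep_diff_left using eq[OF i] by simp
    moreover have "\<bar>g (int i + 1) - gm (int i + 1)\<bar> \<le> e" "\<bar>gm (int i + 1) - ?p (int i + 1)\<bar> \<le> \<rho>"
      using i by (auto intro!: e gm)
    moreover have "\<bar>toep d (\<lambda>l. g l - gm l) \<theta> i\<bar> \<le> real d * e * B"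
      by (intro abs_toep_le e \<theta> e0 lags)
    moreover have "\<bar>toep d (\<lambda>l. gm l - ?p l) (\<Theta> x) i\<bar> \<le> real d * \<rho> * ?A"
      by (intro abs_toep_le gm A \<rho>0 lags)
    moreover have "\<bar>?p (int i + 1) - toep d ?p (\<Theta> x) i\<bar> \<le> ?r"
      by (rule expansion_residual[OF i x])
    ultimately have "\<bar>toep d gm (\<lambda>i. \<theta> i - \<Theta> x i) i\<bar> \<le> e + real d * e * B + ?r + \<rho> + real d * \<rho> * ?A"
      by linarith
    also have "\<dots> = (1 + real d * B) * e + ?r + (1 + real d * ?A) * \<rho>"
      by (simp add: algebra_simps)
    finally show "\<bar>toep d gm (\<lambda>i. \<theta> i - \<Theta> x i) i\<bar> \<le> (1 + real d * B) * e + ?r + (1 + real d * ?A) * \<rho>" .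
  qed (use \<kappa> in auto)
  then show ?thesis by (simp add: mult_ac)
qed

end

section \<open>Uniform error bound for the estimator\<close>

text \<open>The constant in the regime in which the matrix of the means is coercive. It is the bound of
  \<open>solution_error\<close> with \<open>k\<close> replaced by \<open>\<beta>\<close>.\<close>

definition main_const :: "nat \<Rightarrow> nat \<Rightarrow> real \<Rightarrow> real \<Rightarrow> real \<Rightarrow> real \<Rightarrow> real \<Rightarrow> real" where
  "main_const N d f_min b b' \<beta> R =
     2 * real d / (2 * pi * f_min) *
       ((\<beta> + 1)\<^sup>2 * (real d * (2 * pi * R) * coeff_bound d (R / f_min) \<beta>)
        + (1 + real d * ((\<beta> + 1) * coeff_bound d (R / f_min) \<beta>)) * mean_error N d b b' \<beta> R)"

text \<open>The constant in the remaining regimes. The first factor bounds the estimator and its expansion, and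
  each summand of the second factor, multiplied by \<open>rate\<close>, is at least one in one of them.\<close>

definition trivial_const :: "nat \<Rightarrow> nat \<Rightarrow> real \<Rightarrow> real \<Rightarrow> real \<Rightarrow> real \<Rightarrow> real \<Rightarrow> real" where
  "trivial_const N d f_min b b' \<beta> R =
     (2 ^ d + (\<beta> + 1) * coeff_bound d (R / f_min) \<beta>) *
       (1 + 2 * moment_error N d b b' \<beta> + 4 * real d * mean_error N d b b' \<beta> R / (2 * pi * f_min)
        + (1 + 4 * real d * \<beta> * (R / f_min)) powr \<beta>)"

definition bias_const :: "nat \<Rightarrow> nat \<Rightarrow> real \<Rightarrow> real \<Rightarrow> real \<Rightarrow> real \<Rightarrow> real \<Rightarrow> real" where
  "bias_const N d f_min b b' \<beta> R = main_const N d f_min b b' \<beta> R + trivial_const N d f_min b b' \<beta> R"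

definition noise_const :: "nat \<Rightarrow> real \<Rightarrow> real" where
  "noise_const d f_min = 2 * real d / (2 * pi * f_min) * (1 + real d * 2 ^ d)"

text \<open>The random variables whose moments \<open>assumption_C\<close> controls.\<close>

definition fluctuation ::
  "(real \<Rightarrow> real) \<Rightarrow> (int \<Rightarrow> nat \<Rightarrow> 'w \<Rightarrow> real) \<Rightarrow> 'w measure \<Rightarrow> nat \<Rightarrow> nat \<Rightarrow> real \<Rightarrow> int \<Rightarrow> 'w \<Rightarrow> real" where
  "fluctuation h X P T M u l \<omega> = emp_cov h X T M u l \<omega> - (\<integral>\<omega>'. emp_cov h X T M u l \<omega>' \<partial>P)"

context stationary_setup
begin

lemma expansion_bias_coeff: "1 \<le> d \<Longrightarrow> expansion d k (bias_coeff h f u) (2 * pi * f_min) (2 * pi * R)"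
  using f_min R by unfold_locales (auto intro: bias_coeff_coercive bias_coeff_bound)

definition predictor_expansion :: "nat \<Rightarrow> real \<Rightarrow> real \<Rightarrow> nat \<Rightarrow> real" where
  "predictor_expansion d u x i = (\<Sum>n\<le>k. pred_coeff d (bias_coeff h f u) n i * x ^ n)"

lemma coeff_bound_nonneg: "0 \<le> coeff_bound d (R / f_min) \<beta>"
  unfolding coeff_bound_def using R f_min by simp

lemma coeff_bound_ge:
  "(real d)\<^sup>2 * (R / f_min) * (1 + (real d)\<^sup>2 * (R / f_min)) ^ k \<le> coeff_bound d (R / f_min) \<beta>"
proof -
  have S: "0 \<le> (real d)\<^sup>2 * (R / f_min)" using R f_min by simp
  have "(1 + (real d)\<^sup>2 * (R / f_min)) ^ k = (1 + (real d)\<^sup>2 * (R / f_min)) powr real k"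
    using S by (subst powr_realpow) auto
  also have "\<dots> \<le> (1 + (real d)\<^sup>2 * (R / f_min)) powr \<beta>"
    using S k_le by (intro powr_mono) auto
  finally show ?thesis
    unfolding coeff_bound_def using S by (intro mult_left_mono) auto
qed

lemma main_const_nonneg: "0 \<le> main_const N d f_min b b' \<beta> R"
  unfolding main_const_def
  using R f_min \<beta>_pos coeff_bound_nonneg[of d] mean_error_pos[of d]
  by (intro mult_nonneg_nonneg add_nonneg_nonneg divide_nonneg_nonneg) auto

lemma noise_const_nonneg: "0 \<le> noise_const d f_min"
  unfolding noise_const_def using f_min by simp

lemma trivial_const_ge:
  assumes "0 \<le> z" "z \<le> 1 + 2 * moment_error N d b b' \<beta> + 4 * real d * mean_error N d b b' \<beta> R / (2 * pi * f_min)
        + (1 + 4 * real d * \<beta> * (R / f_min)) powr \<beta>"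
  shows "(2 ^ d + (\<beta> + 1) * coeff_bound d (R / f_min) \<beta>) * z \<le> trivial_const N d f_min b b' \<beta> R"
  unfolding trivial_const_def using assms coeff_bound_nonneg[of d] \<beta>_pos
  by (intro mult_left_mono add_nonneg_nonneg mult_nonneg_nonneg) auto

text \<open>If the block is short, or long compared with \<open>T\<close>, the right-hand side is bounded from below and
  boundedness of the estimator suffices. Otherwise the mean of the empirical covariance matrix is close
  to the local covariance matrix.\<close>

lemma estimator_error:
  assumes T: "T\<^sub>0 \<le> real T" and M: "0 < M" "even M" and i: "i < d"
  shows "\<bar>pred_estimator d h X t T M \<omega> $ i
        - predictor_expansion d (real_of_int t / real T) (real M / real T) i\<bar>
    \<le> bias_const N d f_min b b' \<beta> R * rate \<beta> M T
      + noise_const d f_min * (\<Sum>l\<in>{- int d..int d}. \<bar>fluctuation h X P T M (real_of_int t / real T) l \<omega>\<bar>)"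
proof -
  let ?u = "real_of_int t / real T" and ?x = "real M / real T" and ?q = "rate \<beta> M T"
  let ?e = "moment_error N d b b' \<beta>" and ?m = "mean_error N d b b' \<beta> R"
  let ?\<kappa> = "2 * pi * f_min" and ?G = "2 * pi * R"
  let ?S = "coeff_bound d (R / f_min) \<beta>"
  let ?E = "\<Sum>l\<in>{- int d..int d}. \<bar>fluctuation h X P T M ?u l \<omega>\<bar>"
  let ?D = "\<bar>pred_estimator d h X t T M \<omega> $ i - predictor_expansion d ?u ?x i\<bar>"
  have d: "1 \<le> d" using i by simp
  interpret E: expansion d k "bias_coeff h f ?u" ?\<kappa> ?G
    by (rule expansion_bias_coeff[OF d])
  have T1: "0 < real T" using T T0 by linarith
  have x0: "0 < ?x" using M T1 by simp
  have q: "0 < ?q" "1 / real M \<le> ?q" "?x powr \<beta> \<le> ?q"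
    using rate_ge[OF M(1)] by auto
  have GS: "E.S = (real d)\<^sup>2 * (R / f_min)"
    by (simp add: E.S_def)
  have S: "E.S * (1 + E.S) ^ k \<le> ?S"
    unfolding GS by (rule coeff_bound_ge)
  have S0: "0 \<le> E.S * (1 + E.S) ^ k"
    using E.S_nonneg by simp
  have exp: "predictor_expansion d ?u ?x = E.\<Theta> ?x"
    by (rule ext) (simp add: predictor_expansion_def E.\<Theta>_def)
  have E0: "0 \<le> noise_const d f_min * ?E"
    by (intro mult_nonneg_nonneg noise_const_nonneg sum_nonneg) auto
  have est: "\<bar>pred_estimator d h X t T M \<omega> $ i\<bar> \<le> 2 ^ d"
    by (rule pred_estimator_bound[OF i])
  have kS: "(real k + 1) * (E.S * (1 + E.S) ^ k) \<le> (\<beta> + 1) * ?S"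
    using S S0 k_le by (intro mult_mono) auto
  have e0: "0 \<le> ?e" and m0: "0 < ?m" and C0: "0 \<le> ?S"
    by (rule moment_error_nonneg mean_error_pos coeff_bound_nonneg)+
  let ?b = "2 ^ d + (\<beta> + 1) * ?S"
  have b0: "0 \<le> ?b" using C0 \<beta>_pos by simp
  let ?z2 = "2 * ?e" and ?z3 = "4 * real d * ?m / ?\<kappa>" and ?z4 = "(1 + 4 * real d * \<beta> * (R / f_min)) powr \<beta>"
  have z: "0 \<le> ?z2" "0 \<le> ?z3" "0 \<le> ?z4"
    using e0 m0 f_min by auto
  have triv: ?thesis if D: "?D \<le> ?b * (z * ?q)" and z: "0 \<le> z" "z \<le> 1 + ?z2 + ?z3 + ?z4" for z
  proof -
    have "?D \<le> (?b * z) * ?q" using D by (simp add: mult.assoc)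
    also have "\<dots> \<le> trivial_const N d f_min b b' \<beta> R * ?q"
      using q(1) by (intro mult_right_mono trivial_const_ge[OF z]) auto
    also have "\<dots> \<le> bias_const N d f_min b b' \<beta> R * ?q"
      using q(1) main_const_nonneg[of d] by (intro mult_right_mono) (auto simp: bias_const_def)
    finally show ?thesis using E0 by linarith
  qed
  have triangle: "?D \<le> 2 ^ d + (\<beta> + 1) * ?S * max 1 (?x ^ k)"
  proof -
    have "\<bar>E.\<Theta> ?x i\<bar> \<le> (real k + 1) * (E.S * (1 + E.S) ^ k) * max 1 (?x ^ k)"
      using x0 by (intro E.expansion_bound[OF i]) auto
    also have "\<dots> \<le> (\<beta> + 1) * ?S * max 1 (?x ^ k)"
      using kS by (intro mult_right_mono) auto
    finally show ?thesis
      unfolding exp using est abs_triangle_ineq4[of "pred_estimator d h X t T M \<omega> $ i" "E.\<Theta> ?x i"] by linarith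
  qed
  show ?thesis
  proof (cases "?x \<le> 1")
    case False
    have "?x ^ k = ?x powr real k" using x0 by (simp add: powr_realpow)
    also have "\<dots> \<le> ?x powr \<beta>" using False k_le by (intro powr_mono) auto
    finally have 1: "?x ^ k \<le> ?x powr \<beta>" .
    have "1 \<le> ?x ^ k" using False by (intro one_le_power) auto
    then have "?D \<le> 2 ^ d + (\<beta> + 1) * ?S * ?x ^ k"
      using triangle by (simp add: max_def split: if_splits)
    also have "\<dots> \<le> 2 ^ d * ?x powr \<beta> + (\<beta> + 1) * ?S * ?x powr \<beta>"
    proof (intro add_mono mult_left_mono 1)
      show "(2::real) ^ d \<le> 2 ^ d * ?x powr \<beta>"
        using \<open>1 \<le> ?x ^ k\<close> 1 mult_left_mono[of 1 "?x powr \<beta>" "2 ^ d"] by simp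
    qed (use C0 \<beta>_pos in auto)
    also have "\<dots> = ?b * ?x powr \<beta>"
      by (simp add: algebra_simps)
    also have "\<dots> \<le> ?b * (1 * ?q)"
      unfolding mult_1 by (rule mult_left_mono[OF q(3) b0])
    finally show ?thesis
      using z by (intro triv[of 1]) auto
  next
    case x1: True
    have "max 1 (?x ^ k) = 1"
      using power_le_one[of ?x k] x0 x1 by (simp add: max_def)
    then have D: "?D \<le> ?b * 1"
      using triangle by simp
    have triv1: ?thesis if "1 \<le> z * ?q" "0 \<le> z" "z \<le> 1 + ?z2 + ?z3 + ?z4" for z
      using order_trans[OF D mult_left_mono[OF that(1) b0]] that(2,3) by (rule triv)
    \<comment> \<open>the grid is too coarse for the taper; the mean is too far from its expansion; the block is too
        long for its expansion to be close to the constant term; or none of these\<close>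
    consider (short) "1 / 2 < ?e / real M" | (rate) "?\<kappa> / 4 < real d * (?m * ?q)"
      | (long) "?\<kappa> / 4 < real d * (real k * ?G * ?x)"
      | (good) "?e / real M \<le> 1 / 2" "real d * (?m * ?q) \<le> ?\<kappa> / 4" "real d * (real k * ?G * ?x) \<le> ?\<kappa> / 4"
      by linarith
    then show ?thesis
    proof cases
      case short
      have "1 \<le> ?z2 * (1 / real M)" using short M by (simp add: field_simps)
      also have "\<dots> \<le> ?z2 * ?q" by (rule mult_left_mono[OF q(2) z(1)])
      finally show ?thesis using z by (intro triv1[of ?z2]) auto
    next
      case rate
      then have "1 \<le> ?z3 * ?q" using f_min by (simp add: field_simps)
      then show ?thesis using z by (intro triv1[of ?z3]) auto
    next
      case long
      have "real d * (real k * ?G * ?x) = ?\<kappa> / 4 * (4 * real d * real k * (R / f_min) * ?x)"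
        using f_min by simp
      then have "?\<kappa> / 4 * 1 < ?\<kappa> / 4 * (4 * real d * real k * (R / f_min) * ?x)"
        using long by linarith
      then have "1 \<le> 4 * real d * real k * (R / f_min) * ?x"
        using f_min by (subst (asm) mult_less_cancel_left_pos) auto
      also have "\<dots> \<le> (1 + 4 * real d * \<beta> * (R / f_min)) * ?x"
      proof (rule mult_right_mono)
        have "4 * real d * real k * (R / f_min) \<le> 4 * real d * \<beta> * (R / f_min)"
          using k_le R f_min by (intro mult_right_mono mult_left_mono) auto
        then show "4 * real d * real k * (R / f_min) \<le> 1 + 4 * real d * \<beta> * (R / f_min)" by linarith
      qed (use x0 in auto)
      finally have "1 \<le> ((1 + 4 * real d * \<beta> * (R / f_min)) * ?x) powr \<beta>"
        using \<beta>_pos by (intro ge_one_powr_ge_zero) auto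
      also have "\<dots> = ?z4 * ?x powr \<beta>"
        using \<beta>_pos R f_min x0 by (intro powr_mult)
      also have "\<dots> \<le> ?z4 * ?q"
        by (rule mult_left_mono[OF q(3) z(3)])
      finally show ?thesis using z by (intro triv1[of ?z4]) auto
    next
      case good
      have small: "real d * (real k * ?G * ?x + ?m * ?q) \<le> ?\<kappa> / 2"
        using good(2,3) by (simp add: distrib_left)
      have fl: "\<bar>emp_cov h X T M ?u l \<omega> - (\<integral>\<omega>'. emp_cov h X T M ?u l \<omega>' \<partial>P)\<bar> \<le> ?E" if "\<bar>l\<bar> \<le> int d" for l
      proof -
        have "l \<in> {- int d..int d}" using that by auto
        from member_le_sum[OF this, of "\<lambda>l. \<bar>fluctuation h X P T M ?u l \<omega>\<bar>"] show ?thesis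
          by (simp add: fluctuation_def)
      qed
      have "?D \<le> 2 * real d / ?\<kappa> * ((1 + real d * 2 ^ d) * ?E
          + (real k + 1)\<^sup>2 * (real d * ?G * (E.S * (1 + E.S) ^ k)) * ?x ^ (k + 1)
          + (1 + real d * ((real k + 1) * (E.S * (1 + E.S) ^ k))) * (?m * ?q))"
        unfolding exp
        by (rule E.solution_error[where g = "\<lambda>l. emp_cov h X T M ?u l \<omega>"
              and gm = "\<lambda>l. \<integral>\<omega>'. emp_cov h X T M ?u l \<omega>' \<partial>P",
              OF pred_estimator_normal_eq pred_estimator_bound emp_cov_mean_expansion[OF T M _ good(1) x1]
                fl less_imp_le[OF x0] x1 small i])
      also have "\<dots> \<le> 2 * real d / ?\<kappa> * ((1 + real d * 2 ^ d) * ?E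
          + (\<beta> + 1)\<^sup>2 * (real d * ?G * ?S) * ?q
          + (1 + real d * ((\<beta> + 1) * ?S)) * (?m * ?q))"
      proof (rule mult_left_mono)
        have "?x ^ (k + 1) = ?x powr real (k + 1)" using x0 by (subst powr_realpow) auto
        also have "\<dots> \<le> ?x powr \<beta>" using x0 x1 k_le by (intro powr_mono') auto
        finally have "?x ^ (k + 1) \<le> ?q" using q(3) by linarith
        then have "(real k + 1)\<^sup>2 * (real d * ?G * (E.S * (1 + E.S) ^ k)) * ?x ^ (k + 1)
            \<le> (\<beta> + 1)\<^sup>2 * (real d * ?G * ?S) * ?q"
          using S S0 k_le R x0 C0 \<beta>_pos by (intro mult_mono power_mono) auto
        moreover have "(1 + real d * ((real k + 1) * (E.S * (1 + E.S) ^ k))) * (?m * ?q)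
            \<le> (1 + real d * ((\<beta> + 1) * ?S)) * (?m * ?q)"
          using m0 q(1) kS by (intro mult_right_mono add_left_mono mult_left_mono) auto
        ultimately show "(1 + real d * 2 ^ d) * ?E
          + (real k + 1)\<^sup>2 * (real d * ?G * (E.S * (1 + E.S) ^ k)) * ?x ^ (k + 1)
          + (1 + real d * ((real k + 1) * (E.S * (1 + E.S) ^ k))) * (?m * ?q)
          \<le> (1 + real d * 2 ^ d) * ?E + (\<beta> + 1)\<^sup>2 * (real d * ?G * ?S) * ?q
          + (1 + real d * ((\<beta> + 1) * ?S)) * (?m * ?q)"
          by (intro add_mono order_refl)
      qed (use f_min in auto)
      also have "\<dots> = main_const N d f_min b b' \<beta> R * ?q + noise_const d f_min * ?E"
        by (simp add: main_const_def noise_const_def algebra_simps)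
      also have "\<dots> \<le> bias_const N d f_min b b' \<beta> R * ?q + noise_const d f_min * ?E"
      proof -
        have "0 \<le> trivial_const N d f_min b b' \<beta> R"
          using trivial_const_ge[of 0 d] z by simp
        then show ?thesis
          using q(1) by (intro add_right_mono mult_right_mono) (auto simp: bias_const_def)
      qed
      finally show ?thesis .
    qed
  qed
qed

text \<open>The constant term of the expansion is the local predictor, because the squared taper has total mass
  one.\<close>

lemma local_pred_coeffs_eq:
  assumes T: "T\<^sub>0 \<le> real T" and i: "i < d"
  shows "local_pred_coeffs d f (real_of_int t / real T) $ i
    = complex_of_real (pred_coeff d (bias_coeff h f (real_of_int t / real T)) 0 i)"
proof -
  let ?u = "real_of_int t / real T"
  have d: "1 \<le> d" using i by simp
  interpret E: expansion d k "bias_coeff h f ?u" "2 * pi * f_min" "2 * pi * R"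
    by (rule expansion_bias_coeff[OF d])
  have "local_cov f ?u = (\<lambda>l. complex_of_real (cov_deriv f ?u 0 l))"
    by (rule ext) (rule local_cov_real[OF wls T0 T \<beta>_pos])
  then have "local_pred_coeffs d f ?u $ i = complex_of_real (yule_walker d (bias_coeff h f ?u 0) $ i)"
    unfolding local_pred_coeffs_def bias_coeff_0 by (simp only: yule_walker_complex_of_real[OF i])
  moreover have "yule_walker d (bias_coeff h f ?u 0) $ i = pred_coeff d (bias_coeff h f ?u) 0 i"
  proof (rule toep_pos_unique[OF E.pos _ i])
    fix i assume i: "i < d"
    show "toep d (bias_coeff h f ?u 0) (\<lambda>i. yule_walker d (bias_coeff h f ?u 0) $ i) i
      = toep d (bias_coeff h f ?u 0) (pred_coeff d (bias_coeff h f ?u) 0) i"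
      using toep_yule_walker[OF E.pos i] E.pred_coeff_eq[OF i, of 0] by simp
  qed
  ultimately show ?thesis by simp
qed

lemma pred_coeff_1_symmetric:
  assumes "\<And>x. x \<in> {0..1} \<Longrightarrow> h x = h (1 - x)" and i: "i < d"
  shows "pred_coeff d (bias_coeff h f u) 1 i = 0"
proof -
  have d: "1 \<le> d" using i by simp
  interpret E: expansion d k "bias_coeff h f u" "2 * pi * f_min" "2 * pi * R"
    by (rule expansion_bias_coeff[OF d])
  have "taper_moment h 1 = 0"
    by (rule taper_moment_1_symmetric) (rule assms(1))
  then have 0: "bias_coeff h f u 1 l = 0" for l
    by (simp add: bias_coeff_def)
  show ?thesis
  proof (rule toep_pos_unique[OF E.pos _ i, where y = "\<lambda>i. 0"])
    fix i assume i: "i < d"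
    show "toep d (bias_coeff h f u 0) (pred_coeff d (bias_coeff h f u) 1) i = toep d (bias_coeff h f u 0) (\<lambda>i. 0) i"
      using E.pred_coeff_eq[OF i, of 1] 0 by (simp add: toep_def)
  qed
qed

end

section \<open>Moments of the fluctuation\<close>

lemma powr_sum_le:
  fixes B :: "'a \<Rightarrow> real"
  assumes "finite L" "\<And>l. l \<in> L \<Longrightarrow> 0 \<le> B l" "1 \<le> p"
  shows "(\<Sum>l\<in>L. B l powr p) \<le> (\<Sum>l\<in>L. B l) powr p"
proof -
  let ?s = "\<Sum>l\<in>L. B l"
  have s0: "0 \<le> ?s" using assms(2) by (rule sum_nonneg)
  have split: "y powr p = y * y powr (p - 1)" if "0 \<le> y" for y :: real
    using that powr_mult_base[of y "p - 1"] by simp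
  have "(\<Sum>l\<in>L. B l powr p) \<le> (\<Sum>l\<in>L. B l * ?s powr (p - 1))"
  proof (rule sum_mono)
    fix l assume l: "l \<in> L"
    then have "B l \<le> ?s" using assms by (intro member_le_sum) auto
    then show "B l powr p \<le> B l * ?s powr (p - 1)"
      unfolding split[OF assms(2)[OF l]] using assms(2)[OF l] assms(3)
      by (intro mult_left_mono powr_mono2) auto
  qed
  also have "\<dots> = ?s powr p"
    unfolding split[OF s0] by (simp add: sum_distrib_right)
  finally show ?thesis .
qed

text \<open>A crude replacement for the triangle inequality in \<open>L\<^sup>p\<close>, sufficient since the number of lags is
  fixed: the sum is at most the number of its terms times the largest one.\<close>

lemma sum_powr_le:
  fixes a :: "'a \<Rightarrow> real"
  assumes "finite L" "\<And>l. l \<in> L \<Longrightarrow> 0 \<le> a l" "1 \<le> p"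
  shows "(\<Sum>l\<in>L. a l) powr p \<le> real (card L) powr p * (\<Sum>l\<in>L. a l powr p)"
proof (cases "L = {}")
  case True
  then show ?thesis by simp
next
  case False
  then obtain l0 where l0: "l0 \<in> L" "\<And>l. l \<in> L \<Longrightarrow> a l \<le> a l0"
    using Max_in[of "a ` L"] Max_ge[of "a ` L"] assms(1) by (metis (no_types, lifting) empty_is_image finite_imageI image_iff)
  have "(\<Sum>l\<in>L. a l) \<le> (\<Sum>l\<in>L. a l0)"
    using l0 by (intro sum_mono)
  then have "(\<Sum>l\<in>L. a l) powr p \<le> (real (card L) * a l0) powr p"
    using assms by (intro powr_mono2 sum_nonneg) auto
  also have "\<dots> = real (card L) powr p * a l0 powr p"
    by (rule powr_mult)
  also have "\<dots> \<le> real (card L) powr p * (\<Sum>l\<in>L. a l powr p)"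
    using l0(1) assms(1) member_le_sum[of l0 L "\<lambda>l. a l powr p"] by (intro mult_left_mono) auto
  finally show ?thesis .
qed

lemma Lp_bounded_dominated_sum:
  assumes L: "finite L" and p: "1 \<le> p" and c: "0 \<le> c"
    and U: "\<And>l. l \<in> L \<Longrightarrow> Lp_bounded P p (U l) (B l)"
    and V: "V \<in> borel_measurable P" and le: "\<And>\<omega>. \<omega> \<in> space P \<Longrightarrow> \<bar>V \<omega>\<bar> \<le> c * (\<Sum>l\<in>L. \<bar>U l \<omega>\<bar>)"
  shows "Lp_bounded P p V (c * real (card L) * (\<Sum>l\<in>L. B l))"
proof -
  let ?C = "c * real (card L)"
  let ?I = "\<lambda>l. \<integral>\<omega>. \<bar>U l \<omega>\<bar> powr p \<partial>P"
  have C: "0 \<le> ?C" using c by simp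
  have Bl: "0 \<le> B l" "?I l \<le> B l powr p" if "l \<in> L" for l
  proof -
    have root: "?I l powr (1 / p) \<le> B l"
      using U[OF that] by (simp add: Lp_bounded_def)
    then show "0 \<le> B l" using powr_ge_zero[of "?I l" "1 / p"] by linarith
    have "0 \<le> ?I l" by (rule integral_nonneg_AE) simp
    then have "?I l = (?I l powr (1 / p)) powr p"
      using p by (simp add: powr_powr)
    also have "\<dots> \<le> B l powr p"
      using root p by (intro powr_mono2) auto
    finally show "?I l \<le> B l powr p" .
  qed
  have int: "integrable P (\<lambda>\<omega>. \<bar>U l \<omega>\<bar> powr p)" if "l \<in> L" for l
    using U[OF that] by (simp add: Lp_bounded_def)
  have isum: "integrable P (\<lambda>\<omega>. ?C powr p * (\<Sum>l\<in>L. \<bar>U l \<omega>\<bar> powr p))"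
    by (intro Bochner_Integration.integrable_mult_right Bochner_Integration.integrable_sum int)
  have dom: "\<bar>V \<omega>\<bar> powr p \<le> ?C powr p * (\<Sum>l\<in>L. \<bar>U l \<omega>\<bar> powr p)" if "\<omega> \<in> space P" for \<omega>
  proof -
    have "\<bar>V \<omega>\<bar> powr p \<le> (c * (\<Sum>l\<in>L. \<bar>U l \<omega>\<bar>)) powr p"
      using le[OF that] p by (intro powr_mono2) auto
    also have "\<dots> = c powr p * (\<Sum>l\<in>L. \<bar>U l \<omega>\<bar>) powr p"
      by (rule powr_mult)
    also have "\<dots> \<le> c powr p * (real (card L) powr p * (\<Sum>l\<in>L. \<bar>U l \<omega>\<bar> powr p))"
      using L p by (intro mult_left_mono sum_powr_le) auto
    also have "\<dots> = ?C powr p * (\<Sum>l\<in>L. \<bar>U l \<omega>\<bar> powr p)"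
      using c by (simp add: powr_mult)
    finally show ?thesis .
  qed
  have nn: "0 \<le> (\<Sum>l\<in>L. \<bar>U l \<omega>\<bar> powr p)" for \<omega>
    by (intro sum_nonneg) auto
  have Vm: "(\<lambda>\<omega>. \<bar>V \<omega>\<bar> powr p) \<in> borel_measurable P"
    using V by measurable
  have iV: "integrable P (\<lambda>\<omega>. \<bar>V \<omega>\<bar> powr p)"
  proof (rule Bochner_Integration.integrable_bound[OF isum Vm], rule AE_I2)
    fix \<omega> assume "\<omega> \<in> space P"
    from dom[OF this] show "norm (\<bar>V \<omega>\<bar> powr p) \<le> norm (?C powr p * (\<Sum>l\<in>L. \<bar>U l \<omega>\<bar> powr p))"
      using nn[of \<omega>] by (simp add: abs_mult)
  qed
  have "(\<integral>\<omega>. \<bar>V \<omega>\<bar> powr p \<partial>P) \<le> (\<integral>\<omega>. ?C powr p * (\<Sum>l\<in>L. \<bar>U l \<omega>\<bar> powr p) \<partial>P)"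
    by (rule integral_mono[OF iV isum dom])
  also have "\<dots> = ?C powr p * (\<Sum>l\<in>L. ?I l)"
    using int by simp
  also have "\<dots> \<le> ?C powr p * (\<Sum>l\<in>L. B l) powr p"
    using Bl by (intro mult_left_mono order_trans[OF sum_mono powr_sum_le[OF L _ p]]) auto
  also have "\<dots> = (?C * (\<Sum>l\<in>L. B l)) powr p"
    by (rule powr_mult[symmetric])
  finally have "(\<integral>\<omega>. \<bar>V \<omega>\<bar> powr p \<partial>P) powr (1 / p) \<le> ((?C * (\<Sum>l\<in>L. B l)) powr p) powr (1 / p)"
    using p by (intro powr_mono2 integral_nonneg_AE) auto
  also have "\<dots> = ?C * (\<Sum>l\<in>L. B l)"
    using p C Bl(1) by (simp add: powr_powr sum_nonneg)
  finally show ?thesis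
    using V iV by (simp add: Lp_bounded_def)
qed

section \<open>Continuity of the constants\<close>

lemma const_bias_bias_const: "const_bias (\<lambda>N d f_min b b' \<beta> R. real d * bias_const N d f_min b b' \<beta> R)"
  unfolding const_bias_def
proof (intro allI)
  fix N d
  let ?D = "{0<..} \<times> {0..} \<times> {0..} \<times> {0<..} \<times> {0<..} :: (real \<times> real \<times> real \<times> real \<times> real) set"
  have nz: "fst y \<noteq> 0" "2 * pi * fst y \<noteq> 0"
      "1 + (real d)\<^sup>2 * (snd (snd (snd (snd y))) / fst y) \<noteq> 0"
      "1 + 4 * real d * fst (snd (snd (snd y))) * (snd (snd (snd (snd y))) / fst y) \<noteq> 0" if y: "y \<in> ?D" for y
  proof -
    show "fst y \<noteq> 0" "2 * pi * fst y \<noteq> 0" using y by auto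
    have r: "0 \<le> snd (snd (snd (snd y))) / fst y" using y by auto
    then have "0 \<le> (real d)\<^sup>2 * (snd (snd (snd (snd y))) / fst y)" by (intro mult_nonneg_nonneg) auto
    then show "1 + (real d)\<^sup>2 * (snd (snd (snd (snd y))) / fst y) \<noteq> 0" by linarith
    have "0 \<le> 4 * real d * fst (snd (snd (snd y))) * (snd (snd (snd (snd y))) / fst y)"
      using y r by (intro mult_nonneg_nonneg) auto
    then show "1 + 4 * real d * fst (snd (snd (snd y))) * (snd (snd (snd (snd y))) / fst y) \<noteq> 0" by linarith
  qed
  show "continuous_on ?D (\<lambda>(f_min, b, b', \<beta>, R). real d * bias_const N d f_min b b' \<beta> R)"
    unfolding bias_const_def main_const_def trivial_const_def mean_error_def moment_error_def
      variation_bound_def coeff_bound_def case_prod_unfold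
    by (intro continuous_intros ballI nz)
qed

definition noise_bound ::
  "(nat \<Rightarrow> int \<Rightarrow> real \<Rightarrow> real \<Rightarrow> real \<Rightarrow> real \<Rightarrow> real \<Rightarrow> real) \<Rightarrow>
   nat \<Rightarrow> nat \<Rightarrow> real \<Rightarrow> real \<Rightarrow> real \<Rightarrow> real \<Rightarrow> real \<Rightarrow> real \<Rightarrow> real \<Rightarrow> real \<Rightarrow> real" where
  "noise_bound K N d p m f_min b b' \<beta> R C =
     noise_const d f_min * real (card {- int d..int d}) * (\<Sum>l\<in>{- int d..int d}. K N l p m b b' C)"

lemma const_noise_noise_bound:
  assumes "constC K"
  shows "const_noise (noise_bound K)"
  unfolding const_noise_def
proof (intro allI)
  fix N d
  let ?D = "{1..} \<times> UNIV \<times> {0<..} \<times> {0..} \<times> {0..} \<times> {0<..} \<times> {0<..} \<times> {0<..}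
    :: (real \<times> real \<times> real \<times> real \<times> real \<times> real \<times> real \<times> real) set"
  have K: "continuous_on ?D (\<lambda>y. K N l (fst y) (fst (snd y)) (fst (snd (snd (snd y)))) (fst (snd (snd (snd (snd y)))))
      (snd (snd (snd (snd (snd (snd (snd y))))))))" for l
  proof -
    have "continuous_on ({1..} \<times> UNIV \<times> {0..} \<times> {0..} \<times> {0<..}) (\<lambda>(p, m, b, b', C). K N l p m b b' C)"
      using assms by (simp add: constC_def)
    moreover have "continuous_on ?D (\<lambda>y. (fst y, fst (snd y), fst (snd (snd (snd y))), fst (snd (snd (snd (snd y)))),
        snd (snd (snd (snd (snd (snd (snd y)))))))) "
      by (intro continuous_intros)
    moreover have "(\<lambda>y. (fst y, fst (snd y), fst (snd (snd (snd y))), fst (snd (snd (snd (snd y)))),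
        snd (snd (snd (snd (snd (snd (snd y)))))))) ` ?D \<subseteq> {1..} \<times> UNIV \<times> {0..} \<times> {0..} \<times> {0<..}"
      by auto
    ultimately have "continuous_on ?D (\<lambda>y. case (fst y, fst (snd y), fst (snd (snd (snd y))), fst (snd (snd (snd (snd y)))),
        snd (snd (snd (snd (snd (snd (snd y))))))) of (p, m, b, b', C) \<Rightarrow> K N l p m b b' C)"
      by (rule continuous_on_compose2)
    then show ?thesis by simp
  qed
  show "continuous_on ?D (\<lambda>(p, m, f_min, b, b', \<beta>, R, C). noise_bound K N d p m f_min b b' \<beta> R C)"
    unfolding noise_bound_def noise_const_def case_prod_unfold
    by (intro continuous_intros K) auto
qed

section \<open>Splitting the error into bias and noise\<close>

lemma abs_diff_clamp_le:
  fixes y :: real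
  assumes "\<bar>y\<bar> \<le> B + E" "0 \<le> E"
  shows "\<bar>y - max (- B) (min B y)\<bar> \<le> E"
  using assms unfolding max_def min_def by (split if_split)+ linarith

context stationary_setup
begin

definition bias_bound :: "nat \<Rightarrow> nat \<Rightarrow> nat \<Rightarrow> real" where
  "bias_bound d T M = bias_const N d f_min b b' \<beta> R * rate \<beta> M T"

definition estimation_error :: "nat \<Rightarrow> int \<Rightarrow> nat \<Rightarrow> nat \<Rightarrow> 'w \<Rightarrow> nat \<Rightarrow> real" where
  "estimation_error d t T M \<omega> i = pred_estimator d h X t T M \<omega> $ i
     - predictor_expansion d (real_of_int t / real T) (real M / real T) i"

text \<open>Since the error is at most the deterministic bound plus a multiple of the fluctuations, what
  remains after truncating it at the deterministic bound is at most that multiple of the fluctuations.\<close>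

definition clamped_error :: "nat \<Rightarrow> int \<Rightarrow> nat \<Rightarrow> nat \<Rightarrow> 'w \<Rightarrow> nat \<Rightarrow> real" where
  "clamped_error d t T M \<omega> i = max (- bias_bound d T M) (min (bias_bound d T M) (estimation_error d t T M \<omega> i))"

definition bias_part :: "nat \<Rightarrow> int \<Rightarrow> nat \<Rightarrow> nat \<Rightarrow> 'w \<Rightarrow> real Matrix.vec" where
  "bias_part d t T M \<omega> = Matrix.vec d (clamped_error d t T M \<omega>)"

definition noise_part :: "nat \<Rightarrow> int \<Rightarrow> nat \<Rightarrow> nat \<Rightarrow> 'w \<Rightarrow> real Matrix.vec" where
  "noise_part d t T M \<omega> = Matrix.vec d (\<lambda>i. estimation_error d t T M \<omega> i - clamped_error d t T M \<omega> i)"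

lemma error_parts_carrier: "bias_part d t T M \<omega> \<in> carrier_vec d" "noise_part d t T M \<omega> \<in> carrier_vec d"
  by (simp_all add: bias_part_def noise_part_def)

lemma bias_bound_nonneg:
  assumes "0 < M"
  shows "0 \<le> bias_bound d T M"
proof -
  have "0 \<le> trivial_const N d f_min b b' \<beta> R"
    using trivial_const_ge[of 0 d] moment_error_nonneg[of d] mean_error_pos[of d] f_min by simp
  then show ?thesis
    unfolding bias_bound_def bias_const_def
    using main_const_nonneg[of d] rate_ge(3)[OF assms, of \<beta> T] by simp
qed

lemma bias_coeff_restrict: "bias_coeff (restrict h {0..1}) f u = bias_coeff h f u"
  by (intro ext) (simp add: bias_coeff_def taper_moment_restrict)

lemma error_decomposition:
  assumes T: "T\<^sub>0 \<le> real T" and i: "i < d"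
  shows "complex_of_real (pred_estimator d h X t T M \<omega> $ i) - local_pred_coeffs d f (real_of_int t / real T) $ i
    = complex_of_real
        ((\<Sum>l=1..k. Matrix.vec d (pred_coeff d (bias_coeff (restrict h {0..1}) f (real_of_int t / real T)) l) $ i
            * (real M / real T) ^ l)
         + bias_part d t T M \<omega> $ i + noise_part d t T M \<omega> $ i)"
proof -
  let ?u = "real_of_int t / real T"
  have "{..k} = insert 0 {1..k}" by auto
  then have "predictor_expansion d ?u (real M / real T) i
      = pred_coeff d (bias_coeff h f ?u) 0 i + (\<Sum>l=1..k. pred_coeff d (bias_coeff h f ?u) l i * (real M / real T) ^ l)"
    by (simp add: predictor_expansion_def)
  then have "pred_estimator d h X t T M \<omega> $ i - pred_coeff d (bias_coeff h f ?u) 0 i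
      = (\<Sum>l=1..k. pred_coeff d (bias_coeff h f ?u) l i * (real M / real T) ^ l)
        + bias_part d t T M \<omega> $ i + noise_part d t T M \<omega> $ i"
    using i by (simp add: bias_part_def noise_part_def estimation_error_def)
  moreover have "(\<Sum>l=1..k. Matrix.vec d (pred_coeff d (bias_coeff (restrict h {0..1}) f ?u) l) $ i * (real M / real T) ^ l)
      = (\<Sum>l=1..k. pred_coeff d (bias_coeff h f ?u) l i * (real M / real T) ^ l)"
    using i by (simp add: bias_coeff_restrict)
  ultimately show ?thesis
    unfolding local_pred_coeffs_eq[OF T i] of_real_diff[symmetric] by (simp only:)
qed

lemma bias_part_bound:
  assumes M: "0 < M"
  shows "L2_set (\<lambda>i. bias_part d t T M \<omega> $ i) {..<d}
    \<le> real d * bias_const N d f_min b b' \<beta> R * (1 / real M + (real M / real T) powr \<beta>)"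
proof -
  have "L2_set (\<lambda>i. bias_part d t T M \<omega> $ i) {..<d} \<le> (\<Sum>i<d. \<bar>bias_part d t T M \<omega> $ i\<bar>)"
    by (rule L2_set_le_sum_abs)
  also have "\<dots> \<le> (\<Sum>i<d. bias_bound d T M)"
    using bias_bound_nonneg[OF M, of d T] by (intro sum_mono) (auto simp: bias_part_def clamped_error_def)
  finally show ?thesis
    by (simp add: bias_bound_def rate_def mult_ac)
qed

lemma noise_part_le_fluctuation:
  assumes T: "T\<^sub>0 \<le> real T" and M: "0 < M" "even M" and i: "i < d"
  shows "\<bar>noise_part d t T M \<omega> $ i\<bar>
    \<le> noise_const d f_min * (\<Sum>l\<in>{- int d..int d}. \<bar>fluctuation h X P T M (real_of_int t / real T) l \<omega>\<bar>)"
    (is "_ \<le> ?E")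
proof -
  have "\<bar>estimation_error d t T M \<omega> i\<bar> \<le> bias_bound d T M + ?E"
    unfolding estimation_error_def bias_bound_def by (rule estimator_error[OF T M i])
  moreover have "0 \<le> ?E"
    by (intro mult_nonneg_nonneg noise_const_nonneg sum_nonneg) auto
  ultimately have "\<bar>estimation_error d t T M \<omega> i - clamped_error d t T M \<omega> i\<bar> \<le> ?E"
    unfolding clamped_error_def by (rule abs_diff_clamp_le)
  then show ?thesis using i by (simp add: noise_part_def)
qed

lemma noise_part_Lp_bounded:
  assumes C: "assumption_C K\<^sub>C m\<^sub>C P T\<^sub>0 X C \<mu>"
    and T: "T\<^sub>0 \<le> real T" and M: "0 < M" "even M" and p: "1 \<le> p" and i: "i < d"
  shows "Lp_bounded P p (\<lambda>\<omega>. noise_part d t T M \<omega> $ i)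
    (noise_bound K\<^sub>C N d p (m\<^sub>C p (abs_moments \<mu>)) f_min b b' \<beta> R C * real M powr (- 1 / 2))"
proof -
  let ?u = "real_of_int t / real T"
  let ?B = "\<lambda>l. K\<^sub>C N l p (m\<^sub>C p (abs_moments \<mu>)) b b' C * real M powr (- 1 / 2)"
  have v: "(\<lambda>\<omega>. noise_part d t T M \<omega> $ i) = (\<lambda>\<omega>. estimation_error d t T M \<omega> i - clamped_error d t T M \<omega> i)"
    using i by (simp add: noise_part_def)
  have "(\<lambda>\<omega>. estimation_error d t T M \<omega> i) \<in> borel_measurable P"
    unfolding estimation_error_def pred_estimator_def
    by (intro borel_measurable_diff borel_measurable_yule_walker borel_measurable_const emp_cov_measurable T i)
  then have meas: "(\<lambda>\<omega>. noise_part d t T M \<omega> $ i) \<in> borel_measurable P"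
    unfolding v clamped_error_def
    by (intro borel_measurable_diff borel_measurable_max borel_measurable_min borel_measurable_const)
  have "Lp_bounded P p (\<lambda>\<omega>. noise_part d t T M \<omega> $ i)
      (noise_const d f_min * real (card {- int d..int d}) * (\<Sum>l\<in>{- int d..int d}. ?B l))"
  proof (rule Lp_bounded_dominated_sum[OF _ p noise_const_nonneg _ meas noise_part_le_fluctuation[OF T M i]])
    fix l
    have "fluctuation h X P T M ?u l = (\<lambda>\<omega>. emp_cov h X T M ?u l \<omega> - (\<integral>\<omega>'. emp_cov h X T M ?u l \<omega>' \<partial>P))"
      by (rule ext) (simp only: fluctuation_def)
    then show "Lp_bounded P p (fluctuation h X P T M ?u l) (?B l)"
      using C[unfolded assumption_C_def, rule_format, OF taper T p M(1) M(2), of ?u l] by (simp only:)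
  qed auto
  then show ?thesis
    by (simp only: noise_bound_def sum_distrib_right[symmetric] mult.assoc)
qed

lemma first_coeff_symmetric:
  assumes sym: "\<forall>x\<in>{0..1}. h x = h (1 - x)"
  shows "Matrix.vec d (pred_coeff d (bias_coeff (restrict h {0..1}) f u) 1) = 0\<^sub>v d"
  unfolding bias_coeff_restrict
proof (rule eq_vecI)
  fix i assume "i < dim_vec (0\<^sub>v d :: real Matrix.vec)"
  then have i: "i < d" by simp
  have "pred_coeff d (bias_coeff h f u) 1 i = 0"
    using sym by (intro pred_coeff_1_symmetric[OF _ i]) (rule bspec)
  then show "Matrix.vec d (pred_coeff d (bias_coeff h f u) 1) $ i = 0\<^sub>v d $ i"
    using i by (simp only: index_vec index_zero_vec)
qed simp

end

theorem theorem3p2: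
  shows
  "\<exists>(a :: nat \<Rightarrow> (real \<Rightarrow> real) \<Rightarrow> (real \<Rightarrow> real \<Rightarrow> real) \<Rightarrow> nat \<Rightarrow> real \<Rightarrow> real Matrix.vec) K\<^sub>1.
    const_bias K\<^sub>1 \<and>
    (\<forall>K\<^sub>C m\<^sub>C. constC K\<^sub>C \<longrightarrow>
      (\<exists>K\<^sub>2 m\<^sub>2. const_noise K\<^sub>2 \<and>
        (\<forall>(P :: 'w measure) \<beta> R f_min k \<alpha> T\<^sub>0 X f N s h C \<mu> d.
          0 < \<beta> \<and> 0 < R \<and> 0 < f_min \<and>
          \<beta> = real k + \<alpha> \<and> 0 < \<alpha> \<and> \<alpha> \<le> 1 \<and>
          prob_space P \<and> 0 < T\<^sub>0 \<and>
          (\<forall>t T. T\<^sub>0 \<le> real T \<longrightarrow> (\<integral>\<omega>. X t T \<omega> \<partial>P) = 0) \<and>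
          weakly_locally_stationary P \<beta> R T\<^sub>0 X f \<and>
          (\<forall>u \<xi>. f_min \<le> f u \<xi>) \<and>
          taper N s h \<and>
          0 < C \<and> real_distribution \<mu> \<and>
          assumption_C K\<^sub>C m\<^sub>C P T\<^sub>0 X C \<mu> \<and>
          1 \<le> d
          \<longrightarrow>
          (\<forall>l u. a d (restrict h {0..1}) f l u \<in> carrier_vec d) \<and>
          (\<exists>(r :: int \<Rightarrow> nat \<Rightarrow> nat \<Rightarrow> 'w \<Rightarrow> real Matrix.vec) (v :: int \<Rightarrow> nat \<Rightarrow> nat \<Rightarrow> 'w \<Rightarrow> real Matrix.vec).
            \<forall>t T M. T\<^sub>0 \<le> real T \<and> 0 < M \<and> even M \<longrightarrow>
              (\<forall>\<omega>. r t T M \<omega> \<in> carrier_vec d) \<and>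
              (\<forall>\<omega>. v t T M \<omega> \<in> carrier_vec d) \<and>
              (\<forall>\<omega>\<in>space P. \<forall>i<d.
                complex_of_real (pred_estimator d h X t T M \<omega> $ i)
                  - local_pred_coeffs d f (real_of_int t / real T) $ i
                = complex_of_real
                    ((\<Sum>l=1..k. a d (restrict h {0..1}) f l (real_of_int t / real T) $ i
                                   * (real M / real T) ^ l)
                     + r t T M \<omega> $ i + v t T M \<omega> $ i)) \<and>
              (\<forall>\<omega>\<in>space P. L2_set (\<lambda>i. r t T M \<omega> $ i) {..<d}
                \<le> K\<^sub>1 N d f_min (taper_norm h) (taper_deriv_norm N s h) \<beta> R
                    * (1 / real M + (real M / real T) powr \<beta>)) \<and>
              (\<forall>p\<ge>1. \<forall>i<d.
                Lp_bounded P p (\<lambda>\<omega>. v t T M \<omega> $ i)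
                  (K\<^sub>2 N d p (m\<^sub>2 p (abs_moments \<mu>)) f_min (taper_norm h) (taper_deriv_norm N s h) \<beta> R C
                     * real M powr (- 1 / 2)))) \<and>
          ((\<forall>x\<in>{0..1}. h x = h (1 - x)) \<longrightarrow>
             (\<forall>u. a d (restrict h {0..1}) f 1 u = 0\<^sub>v d)))))"
proof (intro exI[of _ "\<lambda>d h f l u. Matrix.vec d (pred_coeff d (bias_coeff h f u) l)"]
    exI[of _ "\<lambda>N d f_min b b' \<beta> R. real d * bias_const N d f_min b b' \<beta> R"]
    conjI[OF const_bias_bias_const] allI impI, goal_cases)
  case (1 K\<^sub>C m\<^sub>C)
  show ?case
  proof (intro exI[of _ "noise_bound K\<^sub>C"] exI[of _ m\<^sub>C] conjI[OF const_noise_noise_bound[OF 1]] allI impI,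
      elim conjE, goal_cases)
    case (1 P \<beta> R f_min k \<alpha> T\<^sub>0 X f N s h C \<mu> d)
    interpret stationary_setup P \<beta> R f_min \<alpha> T\<^sub>0 k X f N s h
      by unfold_locales (rule 1 | rule 1(9)[rule_format], assumption | rule 1(11)[rule_format])+
    have C: "assumption_C K\<^sub>C m\<^sub>C P T\<^sub>0 X C \<mu>"
      by (rule 1)
    show ?case
      by (intro conjI; (rule exI[of _ "bias_part d"], rule exI[of _ "noise_part d"])?;
          intro conjI allI impI ballI; (elim conjE)?;
          rule vec_carrier error_parts_carrier error_decomposition bias_part_bound
            noise_part_Lp_bounded[OF C] first_coeff_symmetric; (assumption+)?)
  qed
qed

end
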